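(* Let $R$ be an associative ring with unit and let $\mathbb M$ be an $\mathcal R$-module that preserves direct limits. The following statements are equivalent: (1) $\mathbb M$ is an ML module. (2) $\mathbb M$ is a direct limit of FP submodules (i.e. there is a direct system $\{\mathbb F_i\}$ of submodules of $\mathbb M$, with inclusions as transition morphisms, each $\mathbb F_i$ an FP module, such that $\mathbb M=\varinjlim_i\mathbb F_i$). (3) The kernel of every morphism $\mathbb F\to\mathbb M$ is an FP module, for any FP module $\mathbb F$.
   Context: "$R$-module" means left $R$-module. An $\mathcal R$-module is a covariant additive functor from the category of $R$-modules to abelian groups; morphisms are natural transformations. Kernels, submodules (subfunctors) and direct limits (over upward directed sets) of $\mathcal R$-modules are taken objectwise. $\mathbb M$ preserves direct limits if the natural map $\varinjlim_i\mathbb M(S_i)\to\mathbb M(\varinjlim_i S_i)$ is an isomorphism for every direct system of $R$-modules over an upward directed set. An FP module is an $\mathcal R$-module that preserves direct limits and also preserves direct products, i.e. the natural map $\mathbb M(\prod_i S_i)\to\prod_i\mathbb M(S_i)$ is an isomorphism for every set $\{S_i\}$ of $R$-modules. An ML module is an $\mathcal R$-module $\mathbb M$ that preserves direct limits and such that the natural map $\mathbb M(\prod_i S_i)\to\prod_i\mathbb M(S_i)$ is injective for every set $\{S_i\}$ of $R$-modules. *)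

theory Defs
  imports "HOL-Algebra.Algebra" "HOL-Library.Equipollence"
begin

text \<open>
  HOL has no type of all sets, so ``all modules'' is read relative to a universe of small sets: a
  collection \<open>U\<close> of subsets of a type. \<open>U\<close> need not be closed under power sets: HOL cannot prove that
  a collection with this additional closure and an infinite member exists. If \<open>U\<close> is closed
  under function spaces (up to bijection), as a Grothendieck universe is, every small family of small
  modules has a small product; in general the conditions on products below concern exactly
  those small families whose product is small.
\<close>

definition small_universe :: "'u set set \<Rightarrow> bool"
  where "small_universe U \<longleftrightarrow>
    (\<forall>A\<in>U. \<forall>B. B \<lesssim> A \<longrightarrow> B \<in> U) \<and>
    (\<forall>I\<in>U. \<forall>A :: 'u \<Rightarrow> 'u set. (\<forall>i\<in>I. A i \<in> U) \<longrightarrow> (\<Union>i\<in>I. A i) \<in> U) \<and>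
    (\<exists>A\<in>U. infinite A)"

lemma small_universe_UNIV:
  assumes "infinite (UNIV :: 'u set)"
  shows "small_universe (UNIV :: 'u set set)"
  using assms unfolding small_universe_def by auto


section \<open>Left modules\<close>

text \<open>
  The library locale \<open>module\<close> assumes a commutative ring. The record type \<open>module\<close> is kept; its fields
  for multiplication and one are unused.
\<close>

locale left_module = R?: ring R + M?: abelian_group M
  for R :: "('r, 'x) ring_scheme" (structure) and M :: "('r, 'u, 'm) module_scheme" (structure) +
  assumes smult_closed:
      "\<lbrakk>a \<in> carrier R; x \<in> carrier M\<rbrakk> \<Longrightarrow> a \<odot>\<^bsub>M\<^esub> x \<in> carrier M"
    and smult_l_distr:
      "\<lbrakk>a \<in> carrier R; b \<in> carrier R; x \<in> carrier M\<rbrakk> \<Longrightarrow>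
        (a \<oplus>\<^bsub>R\<^esub> b) \<odot>\<^bsub>M\<^esub> x = a \<odot>\<^bsub>M\<^esub> x \<oplus>\<^bsub>M\<^esub> b \<odot>\<^bsub>M\<^esub> x"
    and smult_r_distr:
      "\<lbrakk>a \<in> carrier R; x \<in> carrier M; y \<in> carrier M\<rbrakk> \<Longrightarrow>
        a \<odot>\<^bsub>M\<^esub> (x \<oplus>\<^bsub>M\<^esub> y) = a \<odot>\<^bsub>M\<^esub> x \<oplus>\<^bsub>M\<^esub> a \<odot>\<^bsub>M\<^esub> y"
    and smult_assoc1:
      "\<lbrakk>a \<in> carrier R; b \<in> carrier R; x \<in> carrier M\<rbrakk> \<Longrightarrow>
        (a \<otimes>\<^bsub>R\<^esub> b) \<odot>\<^bsub>M\<^esub> x = a \<odot>\<^bsub>M\<^esub> (b \<odot>\<^bsub>M\<^esub> x)"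
    and smult_one: "x \<in> carrier M \<Longrightarrow> \<one>\<^bsub>R\<^esub> \<odot>\<^bsub>M\<^esub> x = x"

definition Mods :: "'u set set \<Rightarrow> ('r, 'x) ring_scheme \<Rightarrow> ('r, 'u) module set"
  where "Mods U R = {S. left_module R S \<and> carrier S \<in> U}"

definition lin :: "('r, 'x) ring_scheme \<Rightarrow> ('r, 'u) module \<Rightarrow> ('r, 'u) module \<Rightarrow> ('u \<Rightarrow> 'u) set"
  where "lin R S T = {h \<in> hom (add_monoid S) (add_monoid T).
    \<forall>a\<in>carrier R. \<forall>x\<in>carrier S. h (a \<odot>\<^bsub>S\<^esub> x) = a \<odot>\<^bsub>T\<^esub> h x}"


section \<open>Direct products\<close>

definition product_map :: "'i set \<Rightarrow> ('i \<Rightarrow> 'a \<Rightarrow> 'b) \<Rightarrow> 'a \<Rightarrow> 'i \<Rightarrow> 'b"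
  where "product_map I p x = (\<lambda>i\<in>I. p i x)"

text \<open>
  The set-theoretic product of the modules \<open>S i\<close> does not have its carrier in the type \<open>'u\<close>; hence a
  product is a small module \<open>P\<close> with projections that identify it with the set-theoretic one.
\<close>

definition is_product ::
  "'u set set \<Rightarrow> ('r, 'x) ring_scheme \<Rightarrow> 'i set \<Rightarrow> ('i \<Rightarrow> ('r, 'u) module) \<Rightarrow>
    ('r, 'u) module \<Rightarrow> ('i \<Rightarrow> 'u \<Rightarrow> 'u) \<Rightarrow> bool"
  where "is_product U R I S P p \<longleftrightarrow>
    (\<forall>i\<in>I. S i \<in> Mods U R) \<and> P \<in> Mods U R \<and> (\<forall>i\<in>I. p i \<in> lin R P (S i)) \<and>
    product_map I p \<in> iso (add_monoid P) (product_group I (\<lambda>i. add_monoid (S i)))"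


section \<open>Direct limits\<close>

definition directed_set :: "'i set \<Rightarrow> ('i \<Rightarrow> 'i \<Rightarrow> bool) \<Rightarrow> bool"
  where "directed_set I leq \<longleftrightarrow>
    I \<noteq> {} \<and> reflp_on I leq \<and> transp_on I leq \<and> (\<forall>i\<in>I. \<forall>j\<in>I. \<exists>k\<in>I. leq i k \<and> leq j k)"

text \<open>
  The direct limit of abelian groups \<open>G i\<close> with transition maps \<open>t i j\<close> is the disjoint union of the
  \<open>G i\<close> modulo the relation of becoming equal at some later index.
\<close>

definition limit_rel ::
  "'i set \<Rightarrow> ('i \<Rightarrow> 'i \<Rightarrow> bool) \<Rightarrow> ('i \<Rightarrow> ('b, 'x) monoid_scheme) \<Rightarrow> ('i \<Rightarrow> 'i \<Rightarrow> 'b \<Rightarrow> 'b) \<Rightarrow>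
    (('i \<times> 'b) \<times> ('i \<times> 'b)) set"
  where "limit_rel I leq G t =
    {((i, x), (j, y)) | i x j y. i \<in> I \<and> j \<in> I \<and> x \<in> carrier (G i) \<and> y \<in> carrier (G j) \<and>
      (\<exists>k\<in>I. leq i k \<and> leq j k \<and> t i k x = t j k y)}"

definition direct_limit ::
  "'i set \<Rightarrow> ('i \<Rightarrow> 'i \<Rightarrow> bool) \<Rightarrow> ('i \<Rightarrow> ('b, 'x) monoid_scheme) \<Rightarrow> ('i \<Rightarrow> 'i \<Rightarrow> 'b \<Rightarrow> 'b) \<Rightarrow>
    ('i \<times> 'b) set monoid"
  where "direct_limit I leq G t =
    \<lparr>carrier = (SIGMA i:I. carrier (G i)) // limit_rel I leq G t,
     monoid.mult = (\<lambda>A B. limit_rel I leq G t ``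
       {(k, t i k x \<otimes>\<^bsub>G k\<^esub> t j k y) | i x j y k.
          (i, x) \<in> A \<and> (j, y) \<in> B \<and> k \<in> I \<and> leq i k \<and> leq j k}),
     one = limit_rel I leq G t `` {(i, \<one>\<^bsub>G i\<^esub>) | i. i \<in> I}\<rparr>"

text \<open>The map out of the direct limit induced by compatible maps \<open>f i\<close> out of the \<open>G i\<close>.\<close>

definition limit_map :: "('i \<Rightarrow> 'b \<Rightarrow> 'c) \<Rightarrow> ('i \<times> 'b) set \<Rightarrow> 'c"
  where "limit_map f A = the_elem ((\<lambda>(i, x). f i x) ` A)"

definition direct_system ::
  "'u set set \<Rightarrow> ('r, 'x) ring_scheme \<Rightarrow> 'i set \<Rightarrow> ('i \<Rightarrow> 'i \<Rightarrow> bool) \<Rightarrow>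
    ('i \<Rightarrow> ('r, 'u) module) \<Rightarrow> ('i \<Rightarrow> 'i \<Rightarrow> 'u \<Rightarrow> 'u) \<Rightarrow> bool"
  where "direct_system U R I leq S s \<longleftrightarrow>
    directed_set I leq \<and> (\<forall>i\<in>I. S i \<in> Mods U R) \<and>
    (\<forall>i\<in>I. \<forall>j\<in>I. leq i j \<longrightarrow> s i j \<in> lin R (S i) (S j)) \<and>
    (\<forall>i\<in>I. \<forall>x\<in>carrier (S i). s i i x = x) \<and>
    (\<forall>i\<in>I. \<forall>j\<in>I. \<forall>k\<in>I. leq i j \<and> leq j k \<longrightarrow>
      (\<forall>x\<in>carrier (S i). s j k (s i j x) = s i k x))"

definition is_direct_limit ::
  "'u set set \<Rightarrow> ('r, 'x) ring_scheme \<Rightarrow> 'i set \<Rightarrow> ('i \<Rightarrow> 'i \<Rightarrow> bool) \<Rightarrow>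
    ('i \<Rightarrow> ('r, 'u) module) \<Rightarrow> ('i \<Rightarrow> 'i \<Rightarrow> 'u \<Rightarrow> 'u) \<Rightarrow>
    ('r, 'u) module \<Rightarrow> ('i \<Rightarrow> 'u \<Rightarrow> 'u) \<Rightarrow> bool"
  where "is_direct_limit U R I leq S s L f \<longleftrightarrow>
    direct_system U R I leq S s \<and> L \<in> Mods U R \<and> (\<forall>i\<in>I. f i \<in> lin R (S i) L) \<and>
    (\<forall>i\<in>I. \<forall>j\<in>I. leq i j \<longrightarrow> (\<forall>x\<in>carrier (S i). f j (s i j x) = f i x)) \<and>
    limit_map f \<in> iso (direct_limit I leq (\<lambda>i. add_monoid (S i)) s) (add_monoid L)"


section \<open>Functors from modules to abelian groups\<close>

text \<open>
  HOL functions are total, so a linear map matters only through its values on the carrier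
  of its source, and it does not determine its source and target, which \<open>arr\<close> therefore takes as
  arguments. Abelian groups are multiplicative \<open>comm_group\<close>s.
\<close>

record ('r, 'u) rfunctor =
  obj :: "('r, 'u) module \<Rightarrow> 'u monoid"
  arr :: "('r, 'u) module \<Rightarrow> ('r, 'u) module \<Rightarrow> ('u \<Rightarrow> 'u) \<Rightarrow> 'u \<Rightarrow> 'u"

definition rmodule :: "'u set set \<Rightarrow> ('r, 'x) ring_scheme \<Rightarrow> ('r, 'u) rfunctor \<Rightarrow> bool"
  where "rmodule U R M \<longleftrightarrow>
    (\<forall>S\<in>Mods U R. comm_group (obj M S) \<and> carrier (obj M S) \<in> U) \<and>
    (\<forall>S\<in>Mods U R. \<forall>T\<in>Mods U R. \<forall>f\<in>lin R S T. arr M S T f \<in> hom (obj M S) (obj M T)) \<and>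
    (\<forall>S\<in>Mods U R. \<forall>T\<in>Mods U R. \<forall>f\<in>lin R S T. \<forall>g\<in>lin R S T.
      (\<forall>x\<in>carrier S. f x = g x) \<longrightarrow> (\<forall>y\<in>carrier (obj M S). arr M S T f y = arr M S T g y)) \<and>
    (\<forall>S\<in>Mods U R. \<forall>y\<in>carrier (obj M S). arr M S S (\<lambda>x. x) y = y) \<and>
    (\<forall>S\<in>Mods U R. \<forall>T\<in>Mods U R. \<forall>V\<in>Mods U R. \<forall>f\<in>lin R S T. \<forall>g\<in>lin R T V.
      \<forall>y\<in>carrier (obj M S). arr M S V (g \<circ> f) y = arr M T V g (arr M S T f y)) \<and>
    (\<forall>S\<in>Mods U R. \<forall>T\<in>Mods U R. \<forall>f\<in>lin R S T. \<forall>g\<in>lin R S T.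
      \<forall>y\<in>carrier (obj M S).
        arr M S T (\<lambda>x. f x \<oplus>\<^bsub>T\<^esub> g x) y = arr M S T f y \<otimes>\<^bsub>obj M T\<^esub> arr M S T g y)"

definition rmorphism ::
  "'u set set \<Rightarrow> ('r, 'x) ring_scheme \<Rightarrow> ('r, 'u) rfunctor \<Rightarrow> ('r, 'u) rfunctor \<Rightarrow>
    (('r, 'u) module \<Rightarrow> 'u \<Rightarrow> 'u) \<Rightarrow> bool"
  where "rmorphism U R F M \<alpha> \<longleftrightarrow>
    (\<forall>S\<in>Mods U R. \<alpha> S \<in> hom (obj F S) (obj M S)) \<and>
    (\<forall>S\<in>Mods U R. \<forall>T\<in>Mods U R. \<forall>f\<in>lin R S T. \<forall>x\<in>carrier (obj F S).
      \<alpha> T (arr F S T f x) = arr M S T f (\<alpha> S x))"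

definition rsubmodule ::
  "'u set set \<Rightarrow> ('r, 'x) ring_scheme \<Rightarrow> ('r, 'u) rfunctor \<Rightarrow> ('r, 'u) rfunctor \<Rightarrow> bool"
  where "rsubmodule U R F M \<longleftrightarrow>
    rmodule U R F \<and> (\<forall>S\<in>Mods U R. carrier (obj F S) \<subseteq> carrier (obj M S)) \<and>
    rmorphism U R F M (\<lambda>S x. x)"

definition rkernel ::
  "('r, 'u) rfunctor \<Rightarrow> ('r, 'u) rfunctor \<Rightarrow> (('r, 'u) module \<Rightarrow> 'u \<Rightarrow> 'u) \<Rightarrow> ('r, 'u) rfunctor"
  where "rkernel F M \<alpha> =
    \<lparr>obj = (\<lambda>S. (obj F S)\<lparr>carrier := kernel (obj F S) (obj M S) (\<alpha> S)\<rparr>), arr = arr F\<rparr>"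

definition preserves_direct_limits ::
  "'u set set \<Rightarrow> ('r, 'x) ring_scheme \<Rightarrow> ('r, 'u) rfunctor \<Rightarrow> bool"
  where "preserves_direct_limits U R M \<longleftrightarrow>
    (\<forall>I\<in>U. \<forall>leq S s L f. is_direct_limit U R I leq S s L f \<longrightarrow>
      limit_map (\<lambda>i. arr M (S i) L (f i))
        \<in> iso (direct_limit I leq (\<lambda>i. obj M (S i)) (\<lambda>i j. arr M (S i) (S j) (s i j))) (obj M L))"

definition preserves_products ::
  "'u set set \<Rightarrow> ('r, 'x) ring_scheme \<Rightarrow> ('r, 'u) rfunctor \<Rightarrow> bool"
  where "preserves_products U R M \<longleftrightarrow>
    (\<forall>I\<in>U. \<forall>S P p. is_product U R I S P p \<longrightarrow>
      product_map I (\<lambda>i. arr M P (S i) (p i)) \<in> iso (obj M P) (product_group I (\<lambda>i. obj M (S i))))"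

definition FP_module :: "'u set set \<Rightarrow> ('r, 'x) ring_scheme \<Rightarrow> ('r, 'u) rfunctor \<Rightarrow> bool"
  where "FP_module U R M \<longleftrightarrow>
    rmodule U R M \<and> preserves_direct_limits U R M \<and> preserves_products U R M"

definition Mittag_Leffler_module :: "'u set set \<Rightarrow> ('r, 'x) ring_scheme \<Rightarrow> ('r, 'u) rfunctor \<Rightarrow> bool"
  where "Mittag_Leffler_module U R M \<longleftrightarrow>
    rmodule U R M \<and> preserves_direct_limits U R M \<and>
    (\<forall>I\<in>U. \<forall>S P p. is_product U R I S P p \<longrightarrow>
      inj_on (product_map I (\<lambda>i. arr M P (S i) (p i))) (carrier (obj M P)))"

text \<open>
  Below, \<open>\<lambda>i j x. x\<close> are the inclusions \<open>F i \<subseteq> F j\<close>, and \<open>limit_map (\<lambda>i x. x)\<close> is the map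
  induced by the inclusions \<open>F i \<subseteq> M\<close>; naturality in \<open>S\<close> is automatic.
\<close>

definition direct_limit_of_FP_submodules ::
  "'u set set \<Rightarrow> ('r, 'x) ring_scheme \<Rightarrow> ('r, 'u) rfunctor \<Rightarrow> bool"
  where "direct_limit_of_FP_submodules U R M \<longleftrightarrow>
    (\<exists>I\<in>U. \<exists>(leq :: 'u \<Rightarrow> 'u \<Rightarrow> bool) F.
      directed_set I leq \<and>
      (\<forall>i\<in>I. rsubmodule U R (F i) M \<and> FP_module U R (F i)) \<and>
      (\<forall>i\<in>I. \<forall>j\<in>I. leq i j \<longrightarrow> rsubmodule U R (F i) (F j)) \<and>
      (\<forall>S\<in>Mods U R.
        limit_map (\<lambda>i x. x) \<in> iso (direct_limit I leq (\<lambda>i. obj (F i) S) (\<lambda>i j x. x)) (obj M S)))"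

end

theory Submission
  imports Defs
begin

text \<open>Three facts carry the proof.

First, every module \<open>S\<close> is a direct limit of finitely presented ones: it is the union of its finitely
generated submodules, and a finitely generated module \<open>N / K\<close> with \<open>N\<close> free of finite rank is the limit of
the quotients of \<open>N\<close> by finitely generated submodules of \<open>K\<close>. A functor \<open>M\<close> that preserves direct limits
is therefore controlled by the finitely presented modules: every element of \<open>M S\<close> has the form
\<open>M g a\<close> with \<open>a \<in> M A\<close>, \<open>g : A \<rightarrow> S\<close> and \<open>A\<close> finitely presented (\<open>element_from_presented\<close>). Here
\<open>A\<close> can be taken from a fixed small set of modules.

Secondly, let \<open>M\<close> be Mittag-Leffler. A subfunctor \<open>C\<close> of \<open>M\<close> inherits the injectivity of the comparison maps
for direct limits and products, so it is FP as soon as these maps are surjective for \<open>C\<close>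
(\<open>subfunctor_FP\<close>). They are surjective for the image \<open>S \<mapsto> {M g a | g : A \<rightarrow> S}\<close> of a representable functor
with \<open>A\<close> finitely presented, because they are surjective for \<open>Hom(A, -)\<close> (\<open>orbit_FP\<close>). By the first fact these
images exhaust \<open>M\<close>. They are directed: two of them, given by \<open>a \<in> M A\<close> and \<open>b \<in> M B\<close>, lie in the one
given by \<open>a + b \<in> M (A \<oplus> B)\<close>, and the first fact, applied to this element, leads back to the small set
of modules (\<open>orbits_directed\<close>). So \<open>M\<close> is a direct limit of FP submodules. The converse is
clear: an element of \<open>M (\<Prod> S\<^sub>i)\<close> with trivial components lies in some FP submodule, where
it must be trivial.

Thirdly, the criterion for subfunctors also applies to the kernel \<open>K\<close> of a morphism \<open>F \<rightarrow> M\<close> with \<open>F\<close> an FP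
module: by injectivity for \<open>M\<close>, a preimage in \<open>F\<close> of an element of \<open>K\<close> lies in \<open>K\<close>, in the case of
direct limits after passing to a later index (\<open>Mittag_Leffler_imp_kernel_FP\<close>).
Conversely, let \<open>x = M g a\<close> have trivial components in all \<open>M S\<^sub>i\<close>, where \<open>g : A \<rightarrow> \<Prod> S\<^sub>i\<close>. The components of \<open>g\<close> then
lie in the kernel of the morphism \<open>Hom(A, -) \<rightarrow> M\<close> that \<open>a\<close> defines. If this kernel preserves products,
it contains \<open>g\<close> itself, so \<open>x = 1\<close> (\<open>kernel_FP_imp_Mittag_Leffler\<close>).\<close>

section \<open>Small sets\<close>

text \<open>The modules, linear maps and lists that serve as indices below do not live in the type \<open>'u\<close>, so smallness
is needed for sets of arbitrary type. A surjection rather than an injection is asked for since it is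
directly a decoding of indices in \<open>'u\<close>.\<close>

definition small :: "'u set set \<Rightarrow> 'b set \<Rightarrow> bool"
  where "small U B \<longleftrightarrow> (\<exists>A\<in>U. \<exists>d. B = d ` A)"

lemma small_image: "small U B \<Longrightarrow> small U (f ` B)"
  unfolding small_def by (metis image_image)

locale small_sets =
  fixes U :: "'u set set"
  assumes small_universe: "small_universe U"
begin

lemma mem_lepoll: "A \<in> U \<Longrightarrow> B \<lesssim> A \<Longrightarrow> B \<in> U"
  using small_universe unfolding small_universe_def by blast

lemma mem_subset: "A \<in> U \<Longrightarrow> B \<subseteq> A \<Longrightarrow> B \<in> U"
  using mem_lepoll subset_imp_lepoll by blast

lemma mem_image: "A \<in> U \<Longrightarrow> f ` A \<in> U"
  using mem_lepoll image_lepoll by blast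

lemma mem_UN: "I \<in> U \<Longrightarrow> (\<And>i. i \<in> I \<Longrightarrow> A i \<in> U) \<Longrightarrow> (\<Union>i\<in>I. A i) \<in> U"
  using small_universe unfolding small_universe_def by blast

lemma infinite_UNIV: "infinite (UNIV :: 'u set)"
  using small_universe unfolding small_universe_def by (meson rev_finite_subset subset_UNIV)

lemma small_mem: "A \<in> U \<Longrightarrow> small U A"
  unfolding small_def by (metis image_ident)

lemma mem_small: "small U A \<Longrightarrow> A \<in> U"
  unfolding small_def using mem_image by blast

lemma small_subset:
  assumes "small U B" and "C \<subseteq> B"
  shows "small U C"
proof -
  obtain A d where A: "A \<in> U" "B = d ` A" using assms(1) unfolding small_def by blast
  have "C = d ` {a\<in>A. d a \<in> C}" using A(2) assms(2) by auto
  moreover have "{a\<in>A. d a \<in> C} \<in> U" using A(1) by (rule mem_subset) auto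
  ultimately show ?thesis unfolding small_def by blast
qed

text \<open>An infinite type is in bijection with its square. The coding of pairs turns a disjoint union into
a subset of \<open>'u\<close> and is also used for the carriers of biproducts.\<close>

definition pair :: "'u \<times> 'u \<Rightarrow> 'u"
  where "pair = (SOME p. inj p)"

lemma inj_pair: "inj pair"
proof -
  have "|(UNIV :: 'u set) \<times> (UNIV :: 'u set)| \<le>o |UNIV :: 'u set|"
    by (rule ordIso_imp_ordLeq[OF card_of_Times_same_infinite[OF infinite_UNIV]])
  then have "\<exists>p :: 'u \<times> 'u \<Rightarrow> 'u. inj p"
    unfolding card_of_ordLeq[symmetric] by auto
  then show ?thesis unfolding pair_def by (rule someI_ex)
qed

lemma pair_eq [simp]: "pair (x, y) = pair (x', y') \<longleftrightarrow> x = x' \<and> y = y'"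
  using inj_pair by (auto dest: injD)

definition unpair :: "'u \<Rightarrow> 'u \<times> 'u"
  where "unpair = inv_into UNIV pair"

lemma unpair_pair [simp]: "unpair (pair z) = z"
  by (simp add: unpair_def inj_pair)

text \<open>A small universe is closed under unions of families of subsets of \<open>'u\<close> with indices in \<open>'u\<close>. A general
union is the image of a disjoint union of such a family, formed with \<open>pair\<close>.\<close>

lemma small_UN:
  assumes I: "small U I" and B: "\<And>i. i \<in> I \<Longrightarrow> small U (B i)"
  shows "small U (\<Union>i\<in>I. B i)"
proof -
  obtain J d where J: "J \<in> U" "I = d ` J" using I unfolding small_def by blast
  obtain A e where A: "\<And>i. i \<in> I \<Longrightarrow> A i \<in> U \<and> B i = e i ` A i"
    using B unfolding small_def by metis
  define C where "C = (\<Union>j\<in>J. (\<lambda>x. pair (j, x)) ` A (d j))"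
  have "C \<in> U"
    unfolding C_def using J A by (intro mem_UN mem_image) auto
  moreover have "(\<Union>i\<in>I. B i) = (\<lambda>(j, x). e (d j) x) ` unpair ` C"
    using J(2) A by (auto simp: C_def image_image image_UN)
  ultimately show ?thesis
    by (simp add: small_image small_mem)
qed

lemma small_Sigma:
  assumes "small U I" and "\<And>i. i \<in> I \<Longrightarrow> small U (B i)"
  shows "small U (Sigma I B)"
proof -
  have "Sigma I B = (\<Union>i\<in>I. Pair i ` B i)" by auto
  then show ?thesis using assms by (simp add: small_UN small_image)
qed

lemma small_UNIV_nat: "small U (UNIV :: nat set)"
proof -
  obtain A where A: "A \<in> U" "infinite A" using small_universe unfolding small_universe_def by blast
  obtain f :: "nat \<Rightarrow> 'u" where f: "inj f" "range f \<subseteq> A"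
    using A(2) infinite_countable_subset by blast
  then have "UNIV = inv_into UNIV f ` range f" by (simp add: image_image)
  moreover have "range f \<in> U" using A(1) f(2) mem_subset by blast
  ultimately show ?thesis unfolding small_def by blast
qed

lemma small_nat: "small U (N :: nat set)"
  using small_UNIV_nat small_subset by blast

lemma small_singleton: "small U {x}"
  using small_image[OF small_nat[of "{0}"], of "\<lambda>_. x"] by simp

lemma small_lists:
  assumes "small U A"
  shows "small U (lists A)"
proof -
  have "small U {xs \<in> lists A. length xs = n}" for n
  proof (induction n)
    case 0
    have "{xs \<in> lists A. length xs = 0} = {[]}" by auto
    then show ?case by (simp add: small_singleton)
  next
    case (Suc n)
    have "{xs \<in> lists A. length xs = Suc n} = (\<lambda>(x, xs). x # xs) ` (A \<times> {xs \<in> lists A. length xs = n})"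
      by (auto simp: length_Suc_conv image_iff)
    then show ?case using Suc assms by (simp add: small_image small_Sigma)
  qed
  then have "small U (\<Union>n\<in>UNIV. {xs \<in> lists A. length xs = n})"
    by (intro small_UN small_nat)
  moreover have "(\<Union>n\<in>UNIV. {xs \<in> lists A. length xs = n}) = lists A" by auto
  ultimately show ?thesis by simp
qed

lemma small_index:
  assumes "small U B"
  obtains I d where "I \<in> U" and "d ` I = B"
  using assms unfolding small_def by blast

lemma small_encoding:
  assumes "small U B"
  shows "\<exists>e :: 'b \<Rightarrow> 'u. inj_on e B \<and> e ` B \<in> U"
proof -
  obtain I d where I: "I \<in> U" and d: "d ` I = B" using assms small_index by blast
  have "inv_into I d ` B \<subseteq> I"
    unfolding d[symmetric] by (auto simp: inv_into_into)
  then have "inv_into I d ` B \<in> U" using I mem_subset by blast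
  moreover have "inj_on (inv_into I d) B" by (rule inj_on_inv_into) (simp add: d)
  ultimately show ?thesis by blast
qed

end

section \<open>Direct limits of abelian groups\<close>

text \<open>A direct system of groups together with compatible homomorphisms into a group \<open>H\<close>. It serves
for the underlying groups of modules, for the values of a functor and for systems of submodules.\<close>

locale group_cocone =
  fixes I :: "'i set" and leq :: "'i \<Rightarrow> 'i \<Rightarrow> bool"
    and G :: "'i \<Rightarrow> ('b, 'x) monoid_scheme" and t :: "'i \<Rightarrow> 'i \<Rightarrow> 'b \<Rightarrow> 'b"
    and H :: "('c, 'y) monoid_scheme" and f :: "'i \<Rightarrow> 'b \<Rightarrow> 'c"
  assumes directed: "directed_set I leq"
    and group_source: "i \<in> I \<Longrightarrow> group (G i)"
    and transition: "i \<in> I \<Longrightarrow> j \<in> I \<Longrightarrow> leq i j \<Longrightarrow> t i j \<in> hom (G i) (G j)"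
    and transition_refl: "i \<in> I \<Longrightarrow> x \<in> carrier (G i) \<Longrightarrow> t i i x = x"
    and transition_trans:
      "i \<in> I \<Longrightarrow> j \<in> I \<Longrightarrow> k \<in> I \<Longrightarrow> leq i j \<Longrightarrow> leq j k \<Longrightarrow> x \<in> carrier (G i) \<Longrightarrow> t j k (t i j x) = t i k x"
    and group_target: "group H"
    and leg: "i \<in> I \<Longrightarrow> f i \<in> hom (G i) H"
    and leg_transition: "i \<in> I \<Longrightarrow> j \<in> I \<Longrightarrow> leq i j \<Longrightarrow> x \<in> carrier (G i) \<Longrightarrow> f j (t i j x) = f i x"
begin

lemma upper_bound: "i \<in> I \<Longrightarrow> j \<in> I \<Longrightarrow> \<exists>k\<in>I. leq i k \<and> leq j k"
  using directed unfolding directed_set_def by blast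

lemma leq_refl: "i \<in> I \<Longrightarrow> leq i i"
  using directed unfolding directed_set_def reflp_on_def by blast

lemma leq_trans: "i \<in> I \<Longrightarrow> j \<in> I \<Longrightarrow> k \<in> I \<Longrightarrow> leq i j \<Longrightarrow> leq j k \<Longrightarrow> leq i k"
  using directed unfolding directed_set_def transp_on_def by blast

lemma transition_closed: "i \<in> I \<Longrightarrow> j \<in> I \<Longrightarrow> leq i j \<Longrightarrow> x \<in> carrier (G i) \<Longrightarrow> t i j x \<in> carrier (G j)"
  using transition by (rule hom_in_carrier)

lemma leg_closed: "i \<in> I \<Longrightarrow> x \<in> carrier (G i) \<Longrightarrow> f i x \<in> carrier H"
  using leg by (rule hom_in_carrier)

abbreviation points :: "('i \<times> 'b) set"
  where "points \<equiv> SIGMA i:I. carrier (G i)"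

abbreviation rel :: "(('i \<times> 'b) \<times> ('i \<times> 'b)) set"
  where "rel \<equiv> limit_rel I leq G t"

lemma mem_rel:
  "((i, x), (j, y)) \<in> rel \<longleftrightarrow> i \<in> I \<and> j \<in> I \<and> x \<in> carrier (G i) \<and> y \<in> carrier (G j) \<and>
    (\<exists>k\<in>I. leq i k \<and> leq j k \<and> t i k x = t j k y)"
  by (auto simp: limit_rel_def)

lemma rel_leg: "((i, x), (j, y)) \<in> rel \<Longrightarrow> f i x = f j y"
  unfolding mem_rel by (metis leg_transition)

lemma equiv_rel: "equiv points rel"
proof (rule equivI)
  show "rel \<subseteq> points \<times> points" by (auto simp: limit_rel_def)
  show "refl_on points rel"
    by (rule refl_onI) (auto simp: mem_rel intro!: bexI leq_refl)
  show "sym rel" by (rule symI) (auto simp: limit_rel_def, metis)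
  show "trans rel"
  proof (rule transI, safe)
    fix i x j y k z
    assume "((i, x), (j, y)) \<in> rel" "((j, y), (k, z)) \<in> rel"
    then obtain a b where
      *: "i \<in> I" "j \<in> I" "k \<in> I" "x \<in> carrier (G i)" "y \<in> carrier (G j)" "z \<in> carrier (G k)"
      and a: "a \<in> I" "leq i a" "leq j a" "t i a x = t j a y"
      and b: "b \<in> I" "leq j b" "leq k b" "t j b y = t k b z"
      unfolding mem_rel by auto
    obtain c where c: "c \<in> I" "leq a c" "leq b c" using upper_bound a(1) b(1) by blast
    have "t i c x = t a c (t i a x)" using * a(1-3) c by (simp add: transition_trans)
    also have "\<dots> = t a c (t j a y)" by (simp only: a(4))
    also have "\<dots> = t j c y" using * a(1-3) c by (simp add: transition_trans)
    also have "\<dots> = t b c (t j b y)" using * b(1-3) c by (simp add: transition_trans)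
    also have "\<dots> = t b c (t k b z)" by (simp only: b(4))
    also have "\<dots> = t k c z" using * b(1-3) c by (simp add: transition_trans)
    finally show "((i, x), (k, z)) \<in> rel"
      unfolding mem_rel using * a b c leq_trans by metis
  qed
qed

lemma limit_map_const:
  assumes "A \<noteq> {}" and "\<And>i x. (i, x) \<in> A \<Longrightarrow> f i x = c"
  shows "limit_map f A = c"
proof -
  have "(\<lambda>(i, x). f i x) ` A = {c}" using assms by force
  then show ?thesis by (simp add: limit_map_def)
qed

lemma limit_map_class:
  assumes "i \<in> I" and "x \<in> carrier (G i)"
  shows "limit_map f (rel `` {(i, x)}) = f i x"
proof (rule limit_map_const)
  show "rel `` {(i, x)} \<noteq> {}" using equiv_class_self[OF equiv_rel] assms by blast
qed (auto dest: rel_leg)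

lemma mem_limit: "A \<in> carrier (direct_limit I leq G t) \<longleftrightarrow> (\<exists>i\<in>I. \<exists>x\<in>carrier (G i). A = rel `` {(i, x)})"
  by (auto simp: direct_limit_def quotient_def)

text \<open>The product in the direct limit is the saturation of the set of all possible products of
representatives. The legs take the same value on all of these, which is therefore the value of
the induced map.\<close>

lemma limit_map_hom: "limit_map f \<in> hom (direct_limit I leq G t) H"
proof (rule homI)
  fix A assume "A \<in> carrier (direct_limit I leq G t)"
  then show "limit_map f A \<in> carrier H"
    unfolding mem_limit by (auto simp: limit_map_class leg_closed)
next
  fix A B assume "A \<in> carrier (direct_limit I leq G t)" "B \<in> carrier (direct_limit I leq G t)"
  then obtain i x j y where
    A: "i \<in> I" "x \<in> carrier (G i)" "A = rel `` {(i, x)}" and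
    B: "j \<in> I" "y \<in> carrier (G j)" "B = rel `` {(j, y)}"
    unfolding mem_limit by auto
  define products where "products = {(k, t i k x \<otimes>\<^bsub>G k\<^esub> t j k y) | i x j y k.
          (i, x) \<in> A \<and> (j, y) \<in> B \<and> k \<in> I \<and> leq i k \<and> leq j k}"
  have mult: "A \<otimes>\<^bsub>direct_limit I leq G t\<^esub> B = rel `` products"
    by (simp add: direct_limit_def products_def)
  have products: "k \<in> I \<and> z \<in> carrier (G k) \<and> f k z = f i x \<otimes>\<^bsub>H\<^esub> f j y" if kz: "(k, z) \<in> products" for k z
  proof -
    obtain i' x' j' y' where *: "((i, x), (i', x')) \<in> rel" "((j, y), (j', y')) \<in> rel"
      "k \<in> I" "leq i' k" "leq j' k" "z = t i' k x' \<otimes>\<^bsub>G k\<^esub> t j' k y'"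
      using kz A(3) B(3) unfolding products_def by auto
    then have **: "i' \<in> I" "j' \<in> I" "x' \<in> carrier (G i')" "y' \<in> carrier (G j')" by (auto simp: mem_rel)
    interpret group "G k" using group_source * by blast
    have "f k z = f k (t i' k x') \<otimes>\<^bsub>H\<^esub> f k (t j' k y')"
      using * ** leg[OF *(3)] transition_closed by (simp add: hom_mult)
    also have "\<dots> = f i x \<otimes>\<^bsub>H\<^esub> f j y" using * ** by (simp add: leg_transition rel_leg)
    finally show ?thesis using * ** by (simp add: transition_closed)
  qed
  have const: "f l w = f i x \<otimes>\<^bsub>H\<^esub> f j y" if "(l, w) \<in> rel `` products" for l w
    using that products rel_leg by fastforce
  obtain k where k: "k \<in> I" "leq i k" "leq j k" using upper_bound A B by blast
  have "(k, t i k x \<otimes>\<^bsub>G k\<^esub> t j k y) \<in> products"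
    unfolding products_def using k A B equiv_class_self[OF equiv_rel] by blast
  moreover from this have "(k, t i k x \<otimes>\<^bsub>G k\<^esub> t j k y) \<in> points" using products by auto
  ultimately have "(k, t i k x \<otimes>\<^bsub>G k\<^esub> t j k y) \<in> rel `` products"
    using equiv_class_self[OF equiv_rel] by blast
  then have "limit_map f (rel `` products) = f i x \<otimes>\<^bsub>H\<^esub> f j y"
    using const by (intro limit_map_const) auto
  then show "limit_map f (A \<otimes>\<^bsub>direct_limit I leq G t\<^esub> B) = limit_map f A \<otimes>\<^bsub>H\<^esub> limit_map f B"
    unfolding mult using A B by (simp add: limit_map_class)
qed

text \<open>For injectivity it suffices that elements of the kernel of a leg die at a later index, since two
elements can be moved to a common index and divided there.\<close>

lemma limit_iso_iff:
  "limit_map f \<in> iso (direct_limit I leq G t) H \<longleftrightarrow>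
    (\<forall>y\<in>carrier H. \<exists>i\<in>I. \<exists>x\<in>carrier (G i). f i x = y) \<and>
    (\<forall>i\<in>I. \<forall>x\<in>carrier (G i). f i x = \<one>\<^bsub>H\<^esub> \<longrightarrow> (\<exists>j\<in>I. leq i j \<and> t i j x = \<one>\<^bsub>G j\<^esub>))"
  (is "?iso \<longleftrightarrow> ?surj \<and> ?ker")
proof
  assume ?iso
  then have bij: "bij_betw (limit_map f) (carrier (direct_limit I leq G t)) (carrier H)"
    by (simp add: iso_def)
  have ?surj
  proof
    fix y assume "y \<in> carrier H"
    then obtain A where A: "A \<in> carrier (direct_limit I leq G t)" "limit_map f A = y"
      using bij by (metis bij_betw_imp_surj_on imageE)
    then obtain i x where "i \<in> I" "x \<in> carrier (G i)" "A = rel `` {(i, x)}" unfolding mem_limit by blast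
    then show "\<exists>i\<in>I. \<exists>x\<in>carrier (G i). f i x = y" using A(2) limit_map_class by metis
  qed
  moreover have ?ker
  proof (intro ballI impI)
    fix i x assume i: "i \<in> I" "x \<in> carrier (G i)" "f i x = \<one>\<^bsub>H\<^esub>"
    have one: "\<one>\<^bsub>G i\<^esub> \<in> carrier (G i)" using group_source[OF i(1)] by (simp add: group.is_monoid)
    have "f i \<one>\<^bsub>G i\<^esub> = \<one>\<^bsub>H\<^esub>" using hom_one[OF leg group_source group_target] i(1) by blast
    then have "limit_map f (rel `` {(i, x)}) = limit_map f (rel `` {(i, \<one>\<^bsub>G i\<^esub>)})"
      using i one by (simp add: limit_map_class)
    moreover have "rel `` {(i, x)} \<in> carrier (direct_limit I leq G t)"
      "rel `` {(i, \<one>\<^bsub>G i\<^esub>)} \<in> carrier (direct_limit I leq G t)"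
      unfolding mem_limit using i one by blast+
    ultimately have "rel `` {(i, x)} = rel `` {(i, \<one>\<^bsub>G i\<^esub>)}"
      using bij by (meson bij_betw_imp_inj_on inj_onD)
    then have "((i, x), (i, \<one>\<^bsub>G i\<^esub>)) \<in> rel"
      using eq_equiv_class[OF _ equiv_rel] i one by blast
    then obtain k where k: "k \<in> I" "leq i k" "t i k x = t i k \<one>\<^bsub>G i\<^esub>" unfolding mem_rel by blast
    moreover have "t i k \<one>\<^bsub>G i\<^esub> = \<one>\<^bsub>G k\<^esub>" using hom_one[OF transition] group_source i k by blast
    ultimately show "\<exists>j\<in>I. leq i j \<and> t i j x = \<one>\<^bsub>G j\<^esub>" by metis
  qed
  ultimately show "?surj \<and> ?ker" ..
next
  assume R: "?surj \<and> ?ker"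
  have "inj_on (limit_map f) (carrier (direct_limit I leq G t))"
  proof (rule inj_onI)
    fix A B assume "A \<in> carrier (direct_limit I leq G t)" "B \<in> carrier (direct_limit I leq G t)"
      and eq: "limit_map f A = limit_map f B"
    then obtain i x j y where
      A: "i \<in> I" "x \<in> carrier (G i)" "A = rel `` {(i, x)}" and
      B: "j \<in> I" "y \<in> carrier (G j)" "B = rel `` {(j, y)}"
      unfolding mem_limit by auto
    have f_eq: "f i x = f j y" using eq A B by (simp add: limit_map_class)
    \<comment> \<open>At a common index \<open>k\<close> the quotient of the two elements lies in the kernel of \<open>f k\<close>.\<close>
    obtain k where k: "k \<in> I" "leq i k" "leq j k" using upper_bound A B by blast
    interpret K: group "G k" using group_source k by blast
    interpret f_k: group_hom "G k" H "f k"
      using leg[OF k(1)] group_target by (simp add: group_hom_def group_hom_axioms_def K.is_group)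
    define u v where "u = t i k x" and "v = t j k y"
    have uv: "u \<in> carrier (G k)" "v \<in> carrier (G k)" and f_uv: "f k u = f k v"
      using A B k f_eq by (auto simp: u_def v_def transition_closed leg_transition)
    have "f k (u \<otimes>\<^bsub>G k\<^esub> inv\<^bsub>G k\<^esub> v) = \<one>\<^bsub>H\<^esub>" using uv f_uv by simp
    then obtain l where l: "l \<in> I" "leq k l" "t k l (u \<otimes>\<^bsub>G k\<^esub> inv\<^bsub>G k\<^esub> v) = \<one>\<^bsub>G l\<^esub>"
      using R k uv by (meson K.inv_closed K.m_closed)
    interpret t_kl: group_hom "G k" "G l" "t k l"
      using transition[OF k(1) l(1,2)] group_source[OF l(1)]
      by (simp add: group_hom_def group_hom_axioms_def K.is_group)
    have "t k l u \<otimes>\<^bsub>G l\<^esub> inv\<^bsub>G l\<^esub> (t k l v) = \<one>\<^bsub>G l\<^esub>" using uv l(3) by simp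
    then have "t k l u = t k l v"
      using uv t_kl.hom_closed by (metis t_kl.H.inv_closed t_kl.H.inv_equality t_kl.H.inv_inv)
    then have "t i l x = t j l y"
      using A B k l by (simp add: u_def v_def transition_trans)
    then have "((i, x), (j, y)) \<in> rel"
      unfolding mem_rel using A B k l leq_trans by blast
    then show "A = B" unfolding A(3) B(3) by (rule equiv_class_eq[OF equiv_rel])
  qed
  moreover have "limit_map f ` carrier (direct_limit I leq G t) = carrier H"
  proof
    show "limit_map f ` carrier (direct_limit I leq G t) \<subseteq> carrier H"
      using limit_map_hom by (auto simp: hom_def)
    show "carrier H \<subseteq> limit_map f ` carrier (direct_limit I leq G t)"
    proof
      fix y assume "y \<in> carrier H"
      then obtain i x where "i \<in> I" "x \<in> carrier (G i)" "f i x = y" using R by blast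
      then show "y \<in> limit_map f ` carrier (direct_limit I leq G t)"
        using limit_map_class mem_limit by (metis image_eqI)
    qed
  qed
  ultimately show ?iso using limit_map_hom by (simp add: iso_def bij_betw_def)
qed

end

section \<open>Linear maps, submodules and quotients\<close>

context left_module
begin

lemma smult_l_null: "x \<in> carrier M \<Longrightarrow> \<zero>\<^bsub>R\<^esub> \<odot>\<^bsub>M\<^esub> x = \<zero>\<^bsub>M\<^esub>"
  using smult_l_distr[of "\<zero>\<^bsub>R\<^esub>" "\<zero>\<^bsub>R\<^esub>" x] smult_closed[of "\<zero>\<^bsub>R\<^esub>" x] M.add.l_cancel_one by simp

lemma smult_r_null: "a \<in> carrier R \<Longrightarrow> a \<odot>\<^bsub>M\<^esub> \<zero>\<^bsub>M\<^esub> = \<zero>\<^bsub>M\<^esub>"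
  using smult_r_distr[of a "\<zero>\<^bsub>M\<^esub>" "\<zero>\<^bsub>M\<^esub>"] smult_closed[of a "\<zero>\<^bsub>M\<^esub>"] M.add.l_cancel_one by simp

lemma smult_minus_one:
  assumes "x \<in> carrier M"
  shows "(\<ominus>\<^bsub>R\<^esub> \<one>\<^bsub>R\<^esub>) \<odot>\<^bsub>M\<^esub> x = \<ominus>\<^bsub>M\<^esub> x"
proof -
  have "(\<ominus>\<^bsub>R\<^esub> \<one>\<^bsub>R\<^esub>) \<odot>\<^bsub>M\<^esub> x \<oplus>\<^bsub>M\<^esub> x = (\<ominus>\<^bsub>R\<^esub> \<one>\<^bsub>R\<^esub> \<oplus>\<^bsub>R\<^esub> \<one>\<^bsub>R\<^esub>) \<odot>\<^bsub>M\<^esub> x"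
    using assms by (simp add: smult_l_distr smult_one)
  also have "\<dots> = \<zero>\<^bsub>M\<^esub>" using assms by (simp add: R.l_neg smult_l_null)
  finally show ?thesis using assms smult_closed M.minus_equality by (metis R.a_inv_closed R.one_closed)
qed

lemma group_add: "group (add_monoid M)"
  by (rule M.a_group)

end

lemma left_moduleI:
  assumes "ring R" and "abelian_group M"
    and "\<And>a x. a \<in> carrier R \<Longrightarrow> x \<in> carrier M \<Longrightarrow> a \<odot>\<^bsub>M\<^esub> x \<in> carrier M"
    and "\<And>a b x. a \<in> carrier R \<Longrightarrow> b \<in> carrier R \<Longrightarrow> x \<in> carrier M \<Longrightarrow>
        (a \<oplus>\<^bsub>R\<^esub> b) \<odot>\<^bsub>M\<^esub> x = a \<odot>\<^bsub>M\<^esub> x \<oplus>\<^bsub>M\<^esub> b \<odot>\<^bsub>M\<^esub> x"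
    and "\<And>a x y. a \<in> carrier R \<Longrightarrow> x \<in> carrier M \<Longrightarrow> y \<in> carrier M \<Longrightarrow>
        a \<odot>\<^bsub>M\<^esub> (x \<oplus>\<^bsub>M\<^esub> y) = a \<odot>\<^bsub>M\<^esub> x \<oplus>\<^bsub>M\<^esub> a \<odot>\<^bsub>M\<^esub> y"
    and "\<And>a b x. a \<in> carrier R \<Longrightarrow> b \<in> carrier R \<Longrightarrow> x \<in> carrier M \<Longrightarrow>
        (a \<otimes>\<^bsub>R\<^esub> b) \<odot>\<^bsub>M\<^esub> x = a \<odot>\<^bsub>M\<^esub> (b \<odot>\<^bsub>M\<^esub> x)"
    and "\<And>x. x \<in> carrier M \<Longrightarrow> \<one>\<^bsub>R\<^esub> \<odot>\<^bsub>M\<^esub> x = x"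
  shows "left_module R M"
  using assms by (simp add: left_module_def left_module_axioms_def)

lemma linI:
  assumes "\<And>x. x \<in> carrier S \<Longrightarrow> h x \<in> carrier T"
    and "\<And>x y. x \<in> carrier S \<Longrightarrow> y \<in> carrier S \<Longrightarrow> h (x \<oplus>\<^bsub>S\<^esub> y) = h x \<oplus>\<^bsub>T\<^esub> h y"
    and "\<And>a x. a \<in> carrier R \<Longrightarrow> x \<in> carrier S \<Longrightarrow> h (a \<odot>\<^bsub>S\<^esub> x) = a \<odot>\<^bsub>T\<^esub> h x"
  shows "h \<in> lin R S T"
  using assms by (simp add: lin_def hom_def)

lemma lin_closed: "h \<in> lin R S T \<Longrightarrow> x \<in> carrier S \<Longrightarrow> h x \<in> carrier T"
  by (auto simp: lin_def hom_def)

lemma lin_add: "h \<in> lin R S T \<Longrightarrow> x \<in> carrier S \<Longrightarrow> y \<in> carrier S \<Longrightarrow> h (x \<oplus>\<^bsub>S\<^esub> y) = h x \<oplus>\<^bsub>T\<^esub> h y"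
  by (auto simp: lin_def hom_def)

lemma lin_smult: "h \<in> lin R S T \<Longrightarrow> a \<in> carrier R \<Longrightarrow> x \<in> carrier S \<Longrightarrow> h (a \<odot>\<^bsub>S\<^esub> x) = a \<odot>\<^bsub>T\<^esub> h x"
  by (auto simp: lin_def)

lemma lin_hom: "h \<in> lin R S T \<Longrightarrow> h \<in> hom (add_monoid S) (add_monoid T)"
  by (simp add: lin_def)

lemma lin_zero:
  assumes "left_module R S" and "left_module R T" and "h \<in> lin R S T"
  shows "h \<zero>\<^bsub>S\<^esub> = \<zero>\<^bsub>T\<^esub>"
  using hom_one[OF lin_hom[OF assms(3)]] assms(1,2)[THEN left_module.group_add] by simp

lemma lin_uminus:
  assumes "left_module R S" and "left_module R T" and "h \<in> lin R S T" and "x \<in> carrier S"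
  shows "h (\<ominus>\<^bsub>S\<^esub> x) = \<ominus>\<^bsub>T\<^esub> h x"
proof -
  interpret S: left_module R S by fact
  interpret T: left_module R T by fact
  show ?thesis
    using assms(3,4) by (simp add: S.smult_minus_one[symmetric] T.smult_minus_one[symmetric] lin_smult lin_closed)
qed

lemma lin_minus:
  assumes "left_module R S" and "left_module R T" and "h \<in> lin R S T" and "x \<in> carrier S" "y \<in> carrier S"
  shows "h (x \<ominus>\<^bsub>S\<^esub> y) = h x \<ominus>\<^bsub>T\<^esub> h y"
proof -
  interpret S: left_module R S by fact
  show ?thesis using assms by (simp add: a_minus_def lin_add lin_uminus)
qed

lemma lin_ident: "(\<lambda>x. x) \<in> lin R S S"
  by (rule linI) simp_all

lemma lin_comp: "g \<in> lin R S T \<Longrightarrow> h \<in> lin R T V \<Longrightarrow> h \<circ> g \<in> lin R S V"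
  by (rule linI) (simp_all add: lin_closed lin_add lin_smult)

lemma lin_cong:
  assumes "left_module R S" and "h \<in> lin R S T" and "\<And>x. x \<in> carrier S \<Longrightarrow> h' x = h x"
  shows "h' \<in> lin R S T"
proof -
  interpret S: left_module R S by fact
  show ?thesis using assms(2,3) by (intro linI) (simp_all add: lin_closed lin_add lin_smult S.smult_closed)
qed

lemma lin_restrict:
  assumes "left_module R S" and "h \<in> lin R S T"
  shows "restrict h (carrier S) \<in> lin R S T"
  using assms by (rule lin_cong) simp

lemma lin_zero_map:
  assumes "left_module R T"
  shows "(\<lambda>x. \<zero>\<^bsub>T\<^esub>) \<in> lin R S T"
proof -
  interpret T: left_module R T by fact
  show ?thesis by (rule linI) (simp_all add: T.smult_r_null)
qed

lemma lin_add_map: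
  assumes "left_module R T" and g: "g \<in> lin R S T" and h: "h \<in> lin R S T"
  shows "(\<lambda>x. g x \<oplus>\<^bsub>T\<^esub> h x) \<in> lin R S T"
proof -
  interpret T: left_module R T by fact
  show ?thesis
    using lin_closed[OF g] lin_closed[OF h]
    by (intro linI) (simp_all add: lin_add[OF g] lin_add[OF h] lin_smult[OF g] lin_smult[OF h]
        T.smult_r_distr T.M.a_ac)
qed

lemma lin_uminus_map:
  assumes "left_module R T" and g: "g \<in> lin R S T"
  shows "(\<lambda>x. \<ominus>\<^bsub>T\<^esub> g x) \<in> lin R S T"
proof -
  interpret T: left_module R T by fact
  have smult: "\<ominus>\<^bsub>T\<^esub> (a \<odot>\<^bsub>T\<^esub> y) = a \<odot>\<^bsub>T\<^esub> (\<ominus>\<^bsub>T\<^esub> y)" if "a \<in> carrier R" "y \<in> carrier T" for a y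
  proof (rule T.M.minus_equality)
    have "a \<odot>\<^bsub>T\<^esub> (\<ominus>\<^bsub>T\<^esub> y) \<oplus>\<^bsub>T\<^esub> a \<odot>\<^bsub>T\<^esub> y = a \<odot>\<^bsub>T\<^esub> (\<ominus>\<^bsub>T\<^esub> y \<oplus>\<^bsub>T\<^esub> y)"
      using that by (simp add: T.smult_r_distr)
    also have "\<dots> = \<zero>\<^bsub>T\<^esub>" using that by (simp add: T.M.l_neg T.smult_r_null)
    finally show "a \<odot>\<^bsub>T\<^esub> (\<ominus>\<^bsub>T\<^esub> y) \<oplus>\<^bsub>T\<^esub> a \<odot>\<^bsub>T\<^esub> y = \<zero>\<^bsub>T\<^esub>" .
  qed (use that in \<open>simp_all add: T.smult_closed\<close>)
  show ?thesis
    using lin_closed[OF g]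
    by (intro linI) (simp_all add: lin_add[OF g] lin_smult[OF g] T.M.minus_add smult)
qed

text \<open>The module axioms are equations, hence pass to the image of a map that respects the operations, once
inverses have been found there.\<close>

lemma left_module_image:
  assumes "left_module R N" and carrier: "carrier B = q ` carrier N"
    and zero: "q \<zero>\<^bsub>N\<^esub> = \<zero>\<^bsub>B\<^esub>"
    and add: "\<And>x y. x \<in> carrier N \<Longrightarrow> y \<in> carrier N \<Longrightarrow> q x \<oplus>\<^bsub>B\<^esub> q y = q (x \<oplus>\<^bsub>N\<^esub> y)"
    and smult: "\<And>a x. a \<in> carrier R \<Longrightarrow> x \<in> carrier N \<Longrightarrow> a \<odot>\<^bsub>B\<^esub> q x = q (a \<odot>\<^bsub>N\<^esub> x)"
  shows "left_module R B"
proof -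
  interpret N: left_module R N by fact
  have neg: "\<exists>y\<in>carrier N. q (x \<oplus>\<^bsub>N\<^esub> y) = q \<zero>\<^bsub>N\<^esub>" if "x \<in> carrier N" for x
    using that N.M.r_neg by (intro bexI[of _ "\<ominus>\<^bsub>N\<^esub> x"]) simp_all
  have "abelian_group B"
    by (rule abelian_groupI)
      (auto simp: carrier add zero[symmetric] N.M.a_ac intro: neg)
  then show ?thesis
    by (intro left_moduleI)
      (auto simp: N.R.ring_axioms carrier add smult N.smult_closed N.smult_l_distr N.smult_r_distr
        N.smult_assoc1 N.smult_one)
qed

definition left_submodule :: "('r, 'x) ring_scheme \<Rightarrow> ('r, 'u, 'm) module_scheme \<Rightarrow> 'u set \<Rightarrow> bool"
  where "left_submodule R N K \<longleftrightarrow> K \<subseteq> carrier N \<and> \<zero>\<^bsub>N\<^esub> \<in> K \<and>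
    (\<forall>x\<in>K. \<forall>y\<in>K. x \<oplus>\<^bsub>N\<^esub> y \<in> K) \<and> (\<forall>a\<in>carrier R. \<forall>x\<in>K. a \<odot>\<^bsub>N\<^esub> x \<in> K)"

lemma left_submodule_minus:
  assumes "left_module R N" and K: "left_submodule R N K" and "x \<in> K" "y \<in> K"
  shows "x \<ominus>\<^bsub>N\<^esub> y \<in> K"
proof -
  interpret N: left_module R N by fact
  have "y \<in> carrier N" using K assms(4) by (auto simp: left_submodule_def)
  then have "\<ominus>\<^bsub>N\<^esub> y = (\<ominus>\<^bsub>R\<^esub> \<one>\<^bsub>R\<^esub>) \<odot>\<^bsub>N\<^esub> y" by (simp add: N.smult_minus_one)
  also have "\<dots> \<in> K" using K assms(4) by (simp add: left_submodule_def)
  finally show ?thesis using K assms(3) by (simp add: left_submodule_def a_minus_def)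
qed

lemma left_submodule_module:
  assumes "left_module R N" and K: "left_submodule R N K"
  shows "left_module R (N\<lparr>carrier := K\<rparr>)"
proof -
  interpret N: left_module R N by fact
  have sub: "x \<in> carrier N" if "x \<in> K" for x using K that by (auto simp: left_submodule_def)
  have neg: "\<exists>y\<in>K. y \<oplus>\<^bsub>N\<^esub> x = \<zero>\<^bsub>N\<^esub>" if "x \<in> K" for x
  proof
    show "\<zero>\<^bsub>N\<^esub> \<ominus>\<^bsub>N\<^esub> x \<in> K"
      using that K by (intro left_submodule_minus[OF assms]) (auto simp: left_submodule_def)
    show "\<zero>\<^bsub>N\<^esub> \<ominus>\<^bsub>N\<^esub> x \<oplus>\<^bsub>N\<^esub> x = \<zero>\<^bsub>N\<^esub>" using sub[OF that] by (simp add: a_minus_def N.M.l_neg)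
  qed
  have "abelian_group (N\<lparr>carrier := K\<rparr>)"
    using K neg by (intro abelian_groupI) (auto simp: left_submodule_def N.M.a_ac sub)
  then show ?thesis
    using K by (intro left_moduleI)
      (auto simp: N.R.ring_axioms left_submodule_def sub N.smult_l_distr N.smult_r_distr N.smult_assoc1
        N.smult_one)
qed

lemma left_submodule_image:
  assumes "left_module R N" and "left_module R T" and h: "h \<in> lin R N T"
  shows "left_submodule R T (h ` carrier N)"
proof -
  interpret N: left_module R N by fact
  show ?thesis
    unfolding left_submodule_def
  proof (intro conjI ballI; (elim imageE)?)
    show "h ` carrier N \<subseteq> carrier T" using h by (auto simp: lin_closed)
    show "\<zero>\<^bsub>T\<^esub> \<in> h ` carrier N" using lin_zero[OF assms] N.M.zero_closed by (metis image_eqI)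
  qed (auto simp: lin_add[OF h, symmetric] lin_smult[OF h, symmetric] N.smult_closed)
qed

lemma left_submodule_kernel:
  assumes "left_module R N" and "left_module R T" and h: "h \<in> lin R N T"
  shows "left_submodule R N {x \<in> carrier N. h x = \<zero>\<^bsub>T\<^esub>}"
proof -
  interpret N: left_module R N by fact
  interpret T: left_module R T by fact
  show ?thesis
    unfolding left_submodule_def
    by (auto simp: lin_zero[OF assms] lin_add[OF h] lin_smult[OF h] N.smult_closed T.smult_r_null)
qed

definition generated :: "('r, 'x) ring_scheme \<Rightarrow> ('r, 'u, 'm) module_scheme \<Rightarrow> 'u set \<Rightarrow> 'u set"
  where "generated R N Y = \<Inter>{K. left_submodule R N K \<and> Y \<subseteq> K}"

lemma generated_subset: "Y \<subseteq> generated R N Y"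
  by (auto simp: generated_def)

lemma generated_least: "left_submodule R N K \<Longrightarrow> Y \<subseteq> K \<Longrightarrow> generated R N Y \<subseteq> K"
  by (auto simp: generated_def)

lemma generated_mono: "Y \<subseteq> Z \<Longrightarrow> generated R N Y \<subseteq> generated R N Z"
  by (auto simp: generated_def)

lemma left_submodule_generated:
  assumes "left_module R N" and "Y \<subseteq> carrier N"
  shows "left_submodule R N (generated R N Y)"
proof -
  interpret N: left_module R N by fact
  have "left_submodule R N (carrier N)" by (simp add: left_submodule_def N.smult_closed)
  then have "generated R N Y \<subseteq> carrier N" using assms(2) by (rule generated_least)
  then show ?thesis by (auto simp: left_submodule_def generated_def)
qed

text \<open>The carrier of a quotient module must be a subset of \<open>'u\<close>, so the quotient consists of one chosen
representative of each coset.\<close>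

definition rep :: "('r, 'u, 'm) module_scheme \<Rightarrow> 'u set \<Rightarrow> 'u \<Rightarrow> 'u"
  where "rep N K x = (SOME y. y \<in> carrier N \<and> x \<ominus>\<^bsub>N\<^esub> y \<in> K)"

definition quotient_module :: "('r, 'u) module \<Rightarrow> 'u set \<Rightarrow> ('r, 'u) module"
  where "quotient_module N K =
    N\<lparr>carrier := rep N K ` carrier N, zero := rep N K \<zero>\<^bsub>N\<^esub>,
      add := (\<lambda>x y. rep N K (x \<oplus>\<^bsub>N\<^esub> y)), smult := (\<lambda>a x. rep N K (a \<odot>\<^bsub>N\<^esub> x))\<rparr>"

locale submodule_quotient = N?: left_module R N
  for R :: "('r, 'x) ring_scheme" and N :: "('r, 'u) module" +
  fixes K :: "'u set"
  assumes submodule: "left_submodule R N K"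
begin

lemma rep: "x \<in> carrier N \<Longrightarrow> rep N K x \<in> carrier N \<and> x \<ominus>\<^bsub>N\<^esub> rep N K x \<in> K"
  unfolding rep_def
proof (rule someI[of _ x], safe)
  assume "x \<in> carrier N"
  then have "x \<ominus>\<^bsub>N\<^esub> x = \<zero>\<^bsub>N\<^esub>" by (simp add: a_minus_def N.M.r_neg)
  then show "x \<ominus>\<^bsub>N\<^esub> x \<in> K" using submodule by (simp add: left_submodule_def)
qed

lemma rep_closed: "x \<in> carrier N \<Longrightarrow> rep N K x \<in> carrier N"
  using rep by blast

lemma rep_eqI:
  assumes "x \<in> carrier N" "y \<in> carrier N" and "x \<ominus>\<^bsub>N\<^esub> y \<in> K"
  shows "rep N K x = rep N K y"
proof -
  have "x \<ominus>\<^bsub>N\<^esub> z \<in> K \<longleftrightarrow> y \<ominus>\<^bsub>N\<^esub> z \<in> K" if z: "z \<in> carrier N" for z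
  proof
    assume "x \<ominus>\<^bsub>N\<^esub> z \<in> K"
    then have "(x \<ominus>\<^bsub>N\<^esub> z) \<ominus>\<^bsub>N\<^esub> (x \<ominus>\<^bsub>N\<^esub> y) \<in> K"
      using left_submodule_minus[OF N.left_module_axioms submodule] assms(3) by blast
    moreover have "(x \<ominus>\<^bsub>N\<^esub> z) \<ominus>\<^bsub>N\<^esub> (x \<ominus>\<^bsub>N\<^esub> y) = y \<ominus>\<^bsub>N\<^esub> z"
      using assms(1,2) z
      by (simp add: a_minus_def N.M.minus_add N.M.a_ac N.M.r_neg1 N.M.r_neg2)
    ultimately show "y \<ominus>\<^bsub>N\<^esub> z \<in> K" by simp
  next
    assume "y \<ominus>\<^bsub>N\<^esub> z \<in> K"
    then have "(x \<ominus>\<^bsub>N\<^esub> y) \<oplus>\<^bsub>N\<^esub> (y \<ominus>\<^bsub>N\<^esub> z) \<in> K"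
      using submodule assms(3) by (simp add: left_submodule_def)
    moreover have "(x \<ominus>\<^bsub>N\<^esub> y) \<oplus>\<^bsub>N\<^esub> (y \<ominus>\<^bsub>N\<^esub> z) = x \<ominus>\<^bsub>N\<^esub> z"
      using assms(1,2) z by (simp add: a_minus_def N.M.a_ac N.M.r_neg1 N.M.r_neg2)
    ultimately show "x \<ominus>\<^bsub>N\<^esub> z \<in> K" by simp
  qed
  then show ?thesis unfolding rep_def by (metis (lifting))
qed

lemma rep_rep: "x \<in> carrier N \<Longrightarrow> rep N K (rep N K x) = rep N K x"
  using rep rep_eqI by metis

lemma rep_add:
  assumes "x \<in> carrier N" "y \<in> carrier N"
  shows "rep N K (rep N K x \<oplus>\<^bsub>N\<^esub> rep N K y) = rep N K (x \<oplus>\<^bsub>N\<^esub> y)"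
proof (rule sym, rule rep_eqI)
  have "(x \<ominus>\<^bsub>N\<^esub> rep N K x) \<oplus>\<^bsub>N\<^esub> (y \<ominus>\<^bsub>N\<^esub> rep N K y) \<in> K"
    using submodule rep assms by (simp add: left_submodule_def)
  moreover have "(x \<ominus>\<^bsub>N\<^esub> rep N K x) \<oplus>\<^bsub>N\<^esub> (y \<ominus>\<^bsub>N\<^esub> rep N K y) =
      (x \<oplus>\<^bsub>N\<^esub> y) \<ominus>\<^bsub>N\<^esub> (rep N K x \<oplus>\<^bsub>N\<^esub> rep N K y)"
    using assms by (simp add: a_minus_def rep_closed N.M.minus_add N.M.a_ac)
  ultimately show "(x \<oplus>\<^bsub>N\<^esub> y) \<ominus>\<^bsub>N\<^esub> (rep N K x \<oplus>\<^bsub>N\<^esub> rep N K y) \<in> K" by simp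
qed (use assms rep_closed in simp_all)

lemma rep_smult:
  assumes "a \<in> carrier R" "x \<in> carrier N"
  shows "rep N K (a \<odot>\<^bsub>N\<^esub> rep N K x) = rep N K (a \<odot>\<^bsub>N\<^esub> x)"
proof (rule sym, rule rep_eqI)
  have "a \<odot>\<^bsub>N\<^esub> (x \<ominus>\<^bsub>N\<^esub> rep N K x) \<in> K"
    using submodule rep assms by (simp add: left_submodule_def)
  moreover have "a \<odot>\<^bsub>N\<^esub> (\<ominus>\<^bsub>N\<^esub> rep N K x) = \<ominus>\<^bsub>N\<^esub> (a \<odot>\<^bsub>N\<^esub> rep N K x)"
    using lin_smult[OF lin_uminus_map[OF N.left_module_axioms lin_ident] assms(1) rep_closed[OF assms(2)]]
    by simp
  then have "a \<odot>\<^bsub>N\<^esub> (x \<ominus>\<^bsub>N\<^esub> rep N K x) = a \<odot>\<^bsub>N\<^esub> x \<ominus>\<^bsub>N\<^esub> a \<odot>\<^bsub>N\<^esub> rep N K x"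
    using assms by (simp add: a_minus_def rep_closed N.smult_r_distr)
  ultimately show "a \<odot>\<^bsub>N\<^esub> x \<ominus>\<^bsub>N\<^esub> a \<odot>\<^bsub>N\<^esub> rep N K x \<in> K" by simp
qed (use assms rep_closed N.smult_closed in simp_all)

lemma quotient_left_module: "left_module R (quotient_module N K)"
  by (rule left_module_image[OF N.left_module_axioms, of _ "rep N K"])
    (simp_all add: quotient_module_def rep_add rep_smult)

lemma rep_lin: "rep N K \<in> lin R N (quotient_module N K)"
  by (rule linI) (simp_all add: quotient_module_def rep_add rep_smult)

lemma mem_quotient: "x \<in> carrier (quotient_module N K) \<Longrightarrow> x \<in> carrier N \<and> rep N K x = x"
  by (auto simp: quotient_module_def rep_closed rep_rep)

text \<open>A linear map that vanishes on \<open>K\<close> takes the same value on an element and on its representative, so it is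
its own factorization through the quotient.\<close>

lemma kills_rep:
  assumes "left_module R T" and h: "h \<in> lin R N T" and kills: "\<And>x. x \<in> K \<Longrightarrow> h x = \<zero>\<^bsub>T\<^esub>"
    and x: "x \<in> carrier N"
  shows "h (rep N K x) = h x"
proof -
  interpret T: left_module R T by fact
  have "h x \<ominus>\<^bsub>T\<^esub> h (rep N K x) = \<zero>\<^bsub>T\<^esub>"
    using kills rep[OF x] x lin_minus[OF N.left_module_axioms assms(1) h] by metis
  then show ?thesis
    using lin_closed[OF h] x rep_closed[OF x] T.M.add.inv_equality T.M.minus_minus
    by (metis T.M.a_inv_closed a_minus_def)
qed

lemma kills_lin_quotient:
  assumes "left_module R T" and h: "h \<in> lin R N T" and kills: "\<And>x. x \<in> K \<Longrightarrow> h x = \<zero>\<^bsub>T\<^esub>"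
  shows "h \<in> lin R (quotient_module N K) T"
proof (rule linI)
  fix x assume "x \<in> carrier (quotient_module N K)"
  then have x: "x \<in> carrier N" using mem_quotient by blast
  then show "h x \<in> carrier T" using h lin_closed by metis
  show "h (a \<odot>\<^bsub>quotient_module N K\<^esub> x) = a \<odot>\<^bsub>T\<^esub> h x" if "a \<in> carrier R" for a
    using that x by (simp add: quotient_module_def kills_rep[OF assms] N.smult_closed lin_smult[OF h])
  show "h (x \<oplus>\<^bsub>quotient_module N K\<^esub> y) = h x \<oplus>\<^bsub>T\<^esub> h y" if "y \<in> carrier (quotient_module N K)" for y
    using that[THEN mem_quotient] x
    by (simp add: quotient_module_def kills_rep[OF assms] lin_add[OF h])
qed

end

section \<open>Direct limits and products of modules\<close>

locale module_universe = small_sets U + ring R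
  for U :: "'u set set" and R :: "'u ring" +
  assumes carrier_small: "carrier R \<in> U"
begin

lemma Mods_module: "S \<in> Mods U R \<Longrightarrow> left_module R S"
  by (simp add: Mods_def)

lemma Mods_small: "S \<in> Mods U R \<Longrightarrow> small U (carrier S)"
  by (simp add: Mods_def small_mem)

lemma ModsI: "left_module R S \<Longrightarrow> small U (carrier S) \<Longrightarrow> S \<in> Mods U R"
  by (simp add: Mods_def mem_small)

lemma module_group_cocone:
  assumes "direct_system U R I leq S s" and "L \<in> Mods U R" and "\<forall>i\<in>I. f i \<in> lin R (S i) L"
    and "\<forall>i\<in>I. \<forall>j\<in>I. leq i j \<longrightarrow> (\<forall>x\<in>carrier (S i). f j (s i j x) = f i x)"
  shows "group_cocone I leq (\<lambda>i. add_monoid (S i)) s (add_monoid L) f"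
proof (rule group_cocone.intro)
  show "s i j \<in> hom (add_monoid (S i)) (add_monoid (S j))" if "i \<in> I" "j \<in> I" "leq i j" for i j
    using assms(1) that by (intro lin_hom[of _ R]) (simp add: direct_system_def)
qed (use assms in \<open>auto simp: direct_system_def intro: lin_hom left_module.group_add[OF Mods_module]\<close>)

lemma is_direct_limit_iff:
  "is_direct_limit U R I leq S s L f \<longleftrightarrow>
    direct_system U R I leq S s \<and> L \<in> Mods U R \<and> (\<forall>i\<in>I. f i \<in> lin R (S i) L) \<and>
    (\<forall>i\<in>I. \<forall>j\<in>I. leq i j \<longrightarrow> (\<forall>x\<in>carrier (S i). f j (s i j x) = f i x)) \<and>
    (\<forall>y\<in>carrier L. \<exists>i\<in>I. \<exists>x\<in>carrier (S i). f i x = y) \<and>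
    (\<forall>i\<in>I. \<forall>x\<in>carrier (S i). f i x = \<zero>\<^bsub>L\<^esub> \<longrightarrow> (\<exists>j\<in>I. leq i j \<and> s i j x = \<zero>\<^bsub>S j\<^esub>))"
  using group_cocone.limit_iso_iff[OF module_group_cocone[of I leq S s L f]]
  unfolding is_direct_limit_def by (auto; meson)

end

text \<open>A direct limit of modules, with its defining isomorphism translated into the elementwise conditions
\<open>leg_surj\<close> and \<open>leg_kernel\<close>.\<close>

locale module_limit = module_universe U R
  for U :: "'u set set" and R :: "'u ring" +
  fixes I :: "'i set" and leq S s L f
  assumes limit: "is_direct_limit U R I leq S s L f"
begin

lemma
  shows system: "direct_system U R I leq S s"
    and target: "L \<in> Mods U R"
    and source: "i \<in> I \<Longrightarrow> S i \<in> Mods U R"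
    and leg: "i \<in> I \<Longrightarrow> f i \<in> lin R (S i) L"
    and transition: "i \<in> I \<Longrightarrow> j \<in> I \<Longrightarrow> leq i j \<Longrightarrow> s i j \<in> lin R (S i) (S j)"
    and transition_refl: "i \<in> I \<Longrightarrow> x \<in> carrier (S i) \<Longrightarrow> s i i x = x"
    and transition_trans: "i \<in> I \<Longrightarrow> j \<in> I \<Longrightarrow> k \<in> I \<Longrightarrow> leq i j \<Longrightarrow> leq j k \<Longrightarrow> x \<in> carrier (S i) \<Longrightarrow>
      s j k (s i j x) = s i k x"
    and leg_transition: "i \<in> I \<Longrightarrow> j \<in> I \<Longrightarrow> leq i j \<Longrightarrow> x \<in> carrier (S i) \<Longrightarrow> f j (s i j x) = f i x"
    and leg_surj: "y \<in> carrier L \<Longrightarrow> \<exists>i\<in>I. \<exists>x\<in>carrier (S i). f i x = y"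
    and leg_kernel: "i \<in> I \<Longrightarrow> x \<in> carrier (S i) \<Longrightarrow> f i x = \<zero>\<^bsub>L\<^esub> \<Longrightarrow> \<exists>j\<in>I. leq i j \<and> s i j x = \<zero>\<^bsub>S j\<^esub>"
  using limit unfolding is_direct_limit_iff direct_system_def by auto

lemma nonempty: "\<exists>i. i \<in> I"
  using system by (auto simp: direct_system_def directed_set_def)

lemma leq_refl: "i \<in> I \<Longrightarrow> leq i i"
  using system by (auto simp: direct_system_def directed_set_def reflp_on_def)

lemma leq_trans: "i \<in> I \<Longrightarrow> j \<in> I \<Longrightarrow> k \<in> I \<Longrightarrow> leq i j \<Longrightarrow> leq j k \<Longrightarrow> leq i k"
  using system unfolding direct_system_def directed_set_def transp_on_def by blast

lemma upper_bound: "i \<in> I \<Longrightarrow> j \<in> I \<Longrightarrow> \<exists>k\<in>I. leq i k \<and> leq j k"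
  using system by (auto simp: direct_system_def directed_set_def)

lemma push:
  assumes "i \<in> I" "j \<in> I" "leq i j" and h: "h \<in> lin R A (S i)"
  shows "s i j \<circ> h \<in> lin R A (S j)" and "x \<in> carrier A \<Longrightarrow> f j ((s i j \<circ> h) x) = f i (h x)"
  using assms(1-3) by (auto simp: leg_transition lin_closed[OF h] intro!: lin_comp[OF h] transition)

end

context module_universe
begin

lemma product_separates:
  assumes P: "is_product U R I S P p" and "z \<in> carrier P" "w \<in> carrier P" and "\<And>i. i \<in> I \<Longrightarrow> p i z = p i w"
  shows "z = w"
proof -
  have "product_map I p z = product_map I p w" using assms(4) by (auto simp: product_map_def)
  then show ?thesis
    using assms(1-3) unfolding is_product_def iso_def bij_betw_def by (auto dest: inj_onD)
qed

text \<open>The universal property of the product: a lift is found pointwise, and it is linear since the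
projections separate points.\<close>

lemma product_lift:
  assumes P: "is_product U R I S P p" and A: "A \<in> Mods U R" and g: "\<And>i. i \<in> I \<Longrightarrow> g i \<in> lin R A (S i)"
  shows "\<exists>h\<in>lin R A P. \<forall>i\<in>I. \<forall>x\<in>carrier A. p i (h x) = g i x"
proof -
  interpret A: left_module R A using A by (rule Mods_module)
  have "P \<in> Mods U R" using P by (simp add: is_product_def)
  then interpret P: left_module R P by (rule Mods_module)
  have p: "p i \<in> lin R P (S i)" if "i \<in> I" for i using P that by (simp add: is_product_def)
  have bij: "bij_betw (product_map I p) (carrier P) (\<Pi>\<^sub>E i\<in>I. carrier (S i))"
    using P by (simp add: is_product_def iso_def product_group_def)
  have "\<exists>z\<in>carrier P. \<forall>i\<in>I. p i z = g i x" if x: "x \<in> carrier A" for x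
  proof -
    have "(\<lambda>i\<in>I. g i x) \<in> (\<Pi>\<^sub>E i\<in>I. carrier (S i))" using g x lin_closed by fastforce
    then obtain z where z: "z \<in> carrier P" "product_map I p z = (\<lambda>i\<in>I. g i x)"
      using bij by (metis bij_betw_imp_surj_on imageE)
    have "p i z = g i x" if "i \<in> I" for i
      using fun_cong[OF z(2), of i] that by (simp add: product_map_def)
    then show ?thesis using z(1) by blast
  qed
  then have "\<exists>h. \<forall>x\<in>carrier A. h x \<in> carrier P \<and> (\<forall>i\<in>I. p i (h x) = g i x)"
    by (intro bchoice) blast
  then obtain h where h: "\<And>x. x \<in> carrier A \<Longrightarrow> h x \<in> carrier P"
    and ph: "\<And>x i. x \<in> carrier A \<Longrightarrow> i \<in> I \<Longrightarrow> p i (h x) = g i x"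
    by blast
  have "h \<in> lin R A P"
  proof (rule linI)
    show "h (x \<oplus>\<^bsub>A\<^esub> y) = h x \<oplus>\<^bsub>P\<^esub> h y" if "x \<in> carrier A" "y \<in> carrier A" for x y
      by (rule product_separates[OF P])
        (use that h in \<open>simp_all add: ph lin_add[OF p] lin_add[OF g]\<close>)
    show "h (a \<odot>\<^bsub>A\<^esub> x) = a \<odot>\<^bsub>P\<^esub> h x" if "a \<in> carrier R" "x \<in> carrier A" for a x
      by (rule product_separates[OF P])
        (use that h in \<open>simp_all add: ph lin_smult[OF p] lin_smult[OF g] A.smult_closed P.smult_closed\<close>)
  qed (rule h)
  then show ?thesis using ph by blast
qed

section \<open>Biproducts\<close>

definition zero_module :: "('u, 'u) module"
  where "zero_module = \<lparr>carrier = {undefined}, monoid.mult = (\<lambda>x y. undefined), one = undefined,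
    ring.zero = undefined, ring.add = (\<lambda>x y. undefined), smult = (\<lambda>a x. undefined)\<rparr>"

definition regular_module :: "('u, 'u) module"
  where "regular_module = \<lparr>carrier = carrier R, monoid.mult = monoid.mult R, one = \<one>\<^bsub>R\<^esub>,
    ring.zero = \<zero>\<^bsub>R\<^esub>, ring.add = ring.add R, smult = monoid.mult R\<rparr>"

definition biproduct :: "('u, 'u) module \<Rightarrow> ('u, 'u) module \<Rightarrow> ('u, 'u) module"
  where "biproduct A B = A\<lparr>carrier := pair ` (carrier A \<times> carrier B), ring.zero := pair (\<zero>\<^bsub>A\<^esub>, \<zero>\<^bsub>B\<^esub>),
    ring.add := (\<lambda>z w. pair (fst (unpair z) \<oplus>\<^bsub>A\<^esub> fst (unpair w), snd (unpair z) \<oplus>\<^bsub>B\<^esub> snd (unpair w))),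
    smult := (\<lambda>a z. pair (a \<odot>\<^bsub>A\<^esub> fst (unpair z), a \<odot>\<^bsub>B\<^esub> snd (unpair z)))\<rparr>"

lemma zero_module_Mods: "zero_module \<in> Mods U R"
proof -
  have "abelian_group zero_module" by (rule abelian_groupI) (simp_all add: zero_module_def)
  then have "left_module R zero_module"
    by (intro left_moduleI) (simp_all add: ring_axioms zero_module_def)
  then show ?thesis by (rule ModsI) (simp add: zero_module_def small_singleton)
qed

lemma regular_module_Mods: "regular_module \<in> Mods U R"
proof -
  have "abelian_group regular_module"
    by (rule abelian_groupI) (auto simp: regular_module_def a_ac intro: bexI[of "\<lambda>y. y \<oplus>\<^bsub>R\<^esub> _ = \<zero>\<^bsub>R\<^esub>", OF l_neg a_inv_closed])
  then have "left_module R regular_module"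
    by (intro left_moduleI) (simp_all add: ring_axioms regular_module_def l_distr r_distr m_assoc)
  then show ?thesis
    by (rule ModsI) (simp add: regular_module_def carrier_small small_mem)
qed

lemma biproduct_Mods:
  assumes A: "A \<in> Mods U R" and B: "B \<in> Mods U R"
  shows "biproduct A B \<in> Mods U R"
proof -
  interpret A: left_module R A using A by (rule Mods_module)
  interpret B: left_module R B using B by (rule Mods_module)
  have neg: "\<exists>w\<in>carrier (biproduct A B). w \<oplus>\<^bsub>biproduct A B\<^esub> z = \<zero>\<^bsub>biproduct A B\<^esub>"
    if "z \<in> carrier (biproduct A B)" for z
    using that
    by (intro bexI[of _ "pair (\<ominus>\<^bsub>A\<^esub> fst (unpair z), \<ominus>\<^bsub>B\<^esub> snd (unpair z))"])
      (auto simp: biproduct_def A.M.l_neg B.M.l_neg)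
  have "abelian_group (biproduct A B)"
  proof (rule abelian_groupI)
    show "\<exists>w\<in>carrier (biproduct A B). w \<oplus>\<^bsub>biproduct A B\<^esub> z = \<zero>\<^bsub>biproduct A B\<^esub>"
      if "z \<in> carrier (biproduct A B)" for z
      using that by (rule neg)
  qed (auto simp: biproduct_def A.M.a_ac B.M.a_ac)
  then have "left_module R (biproduct A B)"
    by (intro left_moduleI)
      (auto simp: ring_axioms biproduct_def A.smult_closed B.smult_closed A.smult_l_distr
        B.smult_l_distr A.smult_r_distr B.smult_r_distr A.smult_assoc1 B.smult_assoc1
        A.smult_one B.smult_one)
  moreover have "small U (carrier (biproduct A B))"
    by (simp add: biproduct_def small_image small_Sigma A B Mods_small)
  ultimately show ?thesis by (rule ModsI)
qed

lemma biproduct_carrier: "pair (a, b) \<in> carrier (biproduct A B) \<longleftrightarrow> a \<in> carrier A \<and> b \<in> carrier B"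
  by (auto simp: biproduct_def)

lemma biproduct_cases:
  assumes "z \<in> carrier (biproduct A B)"
  obtains a b where "a \<in> carrier A" "b \<in> carrier B" "z = pair (a, b)"
  using assms by (auto simp: biproduct_def)

abbreviation proj1 :: "'u \<Rightarrow> 'u" where "proj1 z \<equiv> fst (unpair z)"
abbreviation proj2 :: "'u \<Rightarrow> 'u" where "proj2 z \<equiv> snd (unpair z)"

lemma proj1_lin: "proj1 \<in> lin R (biproduct A B) A"
  by (rule linI) (auto simp: biproduct_def)

lemma proj2_lin: "proj2 \<in> lin R (biproduct A B) B"
  by (rule linI) (auto simp: biproduct_def)

lemma inj1_lin:
  assumes "B \<in> Mods U R"
  shows "(\<lambda>a. pair (a, \<zero>\<^bsub>B\<^esub>)) \<in> lin R A (biproduct A B)"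
proof -
  interpret B: left_module R B using assms by (rule Mods_module)
  show ?thesis by (rule linI) (auto simp: biproduct_def B.smult_r_null)
qed

lemma inj2_lin:
  assumes "A \<in> Mods U R"
  shows "(\<lambda>b. pair (\<zero>\<^bsub>A\<^esub>, b)) \<in> lin R B (biproduct A B)"
proof -
  interpret A: left_module R A using assms by (rule Mods_module)
  show ?thesis by (rule linI) (auto simp: biproduct_def A.smult_r_null)
qed

lemma copair_lin:
  assumes "T \<in> Mods U R" and g: "g \<in> lin R A T" and h: "h \<in> lin R B T"
  shows "(\<lambda>z. g (proj1 z) \<oplus>\<^bsub>T\<^esub> h (proj2 z)) \<in> lin R (biproduct A B) T"
  using lin_add_map[OF Mods_module[OF assms(1)] lin_comp[OF proj1_lin g] lin_comp[OF proj2_lin h]]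
  by (simp add: comp_def)

lemma biproduct_split:
  assumes A: "A \<in> Mods U R" and B: "B \<in> Mods U R" and T: "T \<in> Mods U R"
    and k: "k \<in> lin R (biproduct A B) T" and "a \<in> carrier A" "b \<in> carrier B"
  shows "k (pair (a, b)) = k (pair (a, \<zero>\<^bsub>B\<^esub>)) \<oplus>\<^bsub>T\<^esub> k (pair (\<zero>\<^bsub>A\<^esub>, b))"
proof -
  interpret A: left_module R A using A by (rule Mods_module)
  interpret B: left_module R B using B by (rule Mods_module)
  have "pair (a, b) = pair (a, \<zero>\<^bsub>B\<^esub>) \<oplus>\<^bsub>biproduct A B\<^esub> pair (\<zero>\<^bsub>A\<^esub>, b)"
    using assms(5,6) by (simp add: biproduct_def)
  then show ?thesis using assms(5,6) by (simp add: lin_add[OF k] biproduct_carrier)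
qed

end

section \<open>Finitely presented modules\<close>

lemma (in left_module) minus_null: "x \<in> carrier M \<Longrightarrow> x \<ominus>\<^bsub>M\<^esub> \<zero>\<^bsub>M\<^esub> = x"
  using M.add.inv_one by (simp add: a_minus_def)

context module_limit
begin

text \<open>Each of finitely many elements vanishes at some later index; directedness gives a common one.\<close>

lemma kill_finite:
  assumes "finite Y" and i: "i \<in> I" and h: "h \<in> lin R N (S i)"
    and "\<And>y. y \<in> Y \<Longrightarrow> y \<in> carrier N \<and> f i (h y) = \<zero>\<^bsub>L\<^esub>"
  shows "\<exists>j\<in>I. leq i j \<and> (\<forall>y\<in>Y. s i j (h y) = \<zero>\<^bsub>S j\<^esub>)"
  using assms(1,4)
proof (induction Y)
  case empty
  then show ?case using i leq_refl by blast
next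
  case (insert y Y)
  then obtain j where j: "j \<in> I" "leq i j" "\<forall>y\<in>Y. s i j (h y) = \<zero>\<^bsub>S j\<^esub>" by auto
  obtain k where k: "k \<in> I" "leq i k" "s i k (h y) = \<zero>\<^bsub>S k\<^esub>"
    using insert.prems[of y] leg_kernel[OF i] lin_closed[OF h] by auto
  obtain l where l: "l \<in> I" "leq j l" "leq k l" using upper_bound j k by blast
  have "s i l (h z) = \<zero>\<^bsub>S l\<^esub>" if "z \<in> insert y Y" for z
  proof -
    have hz: "h z \<in> carrier (S i)" using that insert.prems lin_closed[OF h] by blast
    have zero: "s m l \<zero>\<^bsub>S m\<^esub> = \<zero>\<^bsub>S l\<^esub>" if "m \<in> I" "leq m l" for m
      using that l(1) by (intro lin_zero[OF Mods_module Mods_module transition] source)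
    show ?thesis
    proof (cases "z = y")
      case True
      then show ?thesis
        using transition_trans[OF i k(1) l(1) k(2) l(3) hz] k zero l by simp
    next
      case False
      then show ?thesis
        using that transition_trans[OF i j(1) l(1) j(2) l(2) hz] j zero l by simp
    qed
  qed
  then show ?case using l j leq_trans[OF i j(1) l(1) j(2) l(2)] by blast
qed

end

context module_universe
begin

text \<open>The restriction identifies linear maps that agree on the carrier of \<open>A\<close>, so that \<open>Hom(A, T)\<close> can be small.\<close>

definition homs :: "('u, 'u) module \<Rightarrow> ('u, 'u) module \<Rightarrow> ('u \<Rightarrow> 'u) set"
  where "homs A T = (\<lambda>g. restrict g (carrier A)) ` lin R A T"

definition hom_preserves_limit where
  "hom_preserves_limit A I leq S s L f \<longleftrightarrow>
    (\<forall>g\<in>lin R A L. \<exists>i\<in>I. \<exists>h\<in>lin R A (S i). \<forall>x\<in>carrier A. f i (h x) = g x) \<and>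
    (\<forall>i\<in>I. \<forall>h\<in>lin R A (S i). (\<forall>x\<in>carrier A. f i (h x) = \<zero>\<^bsub>L\<^esub>) \<longrightarrow>
      (\<exists>j\<in>I. leq i j \<and> (\<forall>x\<in>carrier A. s i j (h x) = \<zero>\<^bsub>S j\<^esub>)))"

text \<open>Finite presentation is expressed by the preservation of direct limits by \<open>Hom(A, -)\<close>, the form in which
it is used. The smallness of the sets \<open>Hom(A, T)\<close> makes \<open>Hom(A, -)\<close> a functor with small values;
it is included because a small universe need not be closed under function spaces.\<close>

definition finitely_presented :: "('u, 'u) module \<Rightarrow> bool"
  where "finitely_presented A \<longleftrightarrow> A \<in> Mods U R \<and> (\<forall>T\<in>Mods U R. small U (homs A T)) \<and>
    (\<forall>I\<in>U. \<forall>leq S s L f. is_direct_limit U R I leq S s L f \<longrightarrow> hom_preserves_limit A I leq S s L f)"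

lemma finitely_presentedI:
  assumes "A \<in> Mods U R" and "\<And>T. T \<in> Mods U R \<Longrightarrow> small U (homs A T)"
    and surj: "\<And>I leq S s L f g. I \<in> U \<Longrightarrow> module_limit U R I leq S s L f \<Longrightarrow> g \<in> lin R A L \<Longrightarrow>
      \<exists>i\<in>I. \<exists>h\<in>lin R A (S i). \<forall>x\<in>carrier A. f i (h x) = g x"
    and ker: "\<And>I leq S s L f i h. I \<in> U \<Longrightarrow> module_limit U R I leq S s L f \<Longrightarrow> i \<in> I \<Longrightarrow>
      h \<in> lin R A (S i) \<Longrightarrow> \<forall>x\<in>carrier A. f i (h x) = \<zero>\<^bsub>L\<^esub> \<Longrightarrow>
      \<exists>j\<in>I. leq i j \<and> (\<forall>x\<in>carrier A. s i j (h x) = \<zero>\<^bsub>S j\<^esub>)"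
  shows "finitely_presented A"
proof -
  have "hom_preserves_limit A I leq S s L f" if "I \<in> U" "is_direct_limit U R I leq S s L f" for I leq S s L f
  proof -
    have lim: "module_limit U R I leq S s L f"
      using that(2) by (intro module_limit.intro module_universe_axioms module_limit_axioms.intro)
    show ?thesis
      unfolding hom_preserves_limit_def
      by (intro conjI ballI impI; (rule surj[OF that(1) lim] | rule ker[OF that(1) lim]); assumption)
  qed
  then show ?thesis using assms(1,2) by (simp add: finitely_presented_def)
qed

lemma finitely_presentedD:
  assumes "finitely_presented A"
  shows "A \<in> Mods U R" and "T \<in> Mods U R \<Longrightarrow> small U (homs A T)"
    and "I \<in> U \<Longrightarrow> is_direct_limit U R I leq S s L f \<Longrightarrow> g \<in> lin R A L \<Longrightarrow>
      \<exists>i\<in>I. \<exists>h\<in>lin R A (S i). \<forall>x\<in>carrier A. f i (h x) = g x"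
    and "I \<in> U \<Longrightarrow> is_direct_limit U R I leq S s L f \<Longrightarrow> i \<in> I \<Longrightarrow>
      h \<in> lin R A (S i) \<Longrightarrow> \<forall>x\<in>carrier A. f i (h x) = \<zero>\<^bsub>L\<^esub> \<Longrightarrow>
      \<exists>j\<in>I. leq i j \<and> (\<forall>x\<in>carrier A. s i j (h x) = \<zero>\<^bsub>S j\<^esub>)"
proof -
  show "A \<in> Mods U R" and "T \<in> Mods U R \<Longrightarrow> small U (homs A T)"
    using assms by (simp_all add: finitely_presented_def)
  assume "I \<in> U" "is_direct_limit U R I leq S s L f"
  then have "hom_preserves_limit A I leq S s L f" using assms by (simp add: finitely_presented_def)
  then show "g \<in> lin R A L \<Longrightarrow> \<exists>i\<in>I. \<exists>h\<in>lin R A (S i). \<forall>x\<in>carrier A. f i (h x) = g x"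
    and "i \<in> I \<Longrightarrow> h \<in> lin R A (S i) \<Longrightarrow> \<forall>x\<in>carrier A. f i (h x) = \<zero>\<^bsub>L\<^esub> \<Longrightarrow>
      \<exists>j\<in>I. leq i j \<and> (\<forall>x\<in>carrier A. s i j (h x) = \<zero>\<^bsub>S j\<^esub>)"
    unfolding hom_preserves_limit_def by blast+
qed

lemma finitely_presented_zero: "finitely_presented zero_module"
proof (rule finitely_presentedI)
  show "zero_module \<in> Mods U R" by (rule zero_module_Mods)
  have zero: "g x = \<zero>\<^bsub>T\<^esub>" if "T \<in> Mods U R" "g \<in> lin R zero_module T" "x \<in> carrier zero_module" for g T x
    using lin_zero[OF Mods_module[OF zero_module_Mods] Mods_module[OF that(1)] that(2)] that(3)
    by (simp add: zero_module_def)
  show "small U (homs zero_module T)" if T: "T \<in> Mods U R" for T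
  proof (rule small_subset[OF small_singleton])
    show "homs zero_module T \<subseteq> {restrict (\<lambda>x. \<zero>\<^bsub>T\<^esub>) (carrier zero_module)}"
      using zero[OF T] by (auto simp: homs_def restrict_def)
  qed
  fix I leq S s L f assume "I \<in> U" and lim: "module_limit U R I leq S s L f"
  interpret lim: module_limit U R I leq S s L f by (rule lim)
  {
    fix g assume g: "g \<in> lin R zero_module L"
    obtain i where i: "i \<in> I" using lim.nonempty by blast
    have "f i \<zero>\<^bsub>S i\<^esub> = \<zero>\<^bsub>L\<^esub>"
      using i by (intro lin_zero[OF Mods_module Mods_module lim.leg] lim.source lim.target)
    then show "\<exists>i\<in>I. \<exists>h\<in>lin R zero_module (S i). \<forall>x\<in>carrier zero_module. f i (h x) = g x"
      using i zero[OF lim.target g] lin_zero_map[OF Mods_module[OF lim.source[OF i]]]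
      by (intro bexI[of _ i] bexI[of _ "\<lambda>x. \<zero>\<^bsub>S i\<^esub>"]) simp_all
  }
  fix i h assume i: "i \<in> I" and h: "h \<in> lin R zero_module (S i)"
  have "s i i (h x) = \<zero>\<^bsub>S i\<^esub>" if "x \<in> carrier zero_module" for x
    using lim.transition_refl[OF i lin_closed[OF h that]] zero[OF lim.source[OF i] h that] by simp
  then show "\<exists>j\<in>I. leq i j \<and> (\<forall>x\<in>carrier zero_module. s i j (h x) = \<zero>\<^bsub>S j\<^esub>)"
    using i lim.leq_refl by blast
qed

lemma regular_lin:
  assumes "T \<in> Mods U R" and "t \<in> carrier T"
  shows "(\<lambda>r. r \<odot>\<^bsub>T\<^esub> t) \<in> lin R regular_module T"
proof -
  interpret T: left_module R T using assms(1) by (rule Mods_module)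
  show ?thesis
    using assms(2)
    by (intro linI) (simp_all add: regular_module_def T.smult_closed T.smult_l_distr T.smult_assoc1)
qed

lemma regular_lin_eq:
  assumes "g \<in> lin R regular_module T" and "r \<in> carrier R"
  shows "g r = r \<odot>\<^bsub>T\<^esub> g \<one>\<^bsub>R\<^esub>"
  using lin_smult[OF assms, of "\<one>\<^bsub>R\<^esub>"] assms(2) by (simp add: regular_module_def)

text \<open>\<open>Hom(R, T)\<close> is \<open>T\<close>, via evaluation at \<open>1\<close>.\<close>

lemma finitely_presented_regular: "finitely_presented regular_module"
proof (rule finitely_presentedI)
  show "regular_module \<in> Mods U R" by (rule regular_module_Mods)
  have one: "\<one>\<^bsub>R\<^esub> \<in> carrier regular_module" by (simp add: regular_module_def)
  have carrier: "carrier regular_module = carrier R" by (simp add: regular_module_def)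
  show "small U (homs regular_module T)" if T: "T \<in> Mods U R" for T
  proof (rule small_subset[OF small_image[OF Mods_small[OF T]]])
    show "homs regular_module T \<subseteq> (\<lambda>t. restrict (\<lambda>r. r \<odot>\<^bsub>T\<^esub> t) (carrier R)) ` carrier T"
    proof
      fix k assume "k \<in> homs regular_module T"
      then obtain g where g: "g \<in> lin R regular_module T" "k = restrict g (carrier R)"
        by (auto simp: homs_def carrier)
      have "k = restrict (\<lambda>r. r \<odot>\<^bsub>T\<^esub> g \<one>\<^bsub>R\<^esub>) (carrier R)"
        unfolding g(2) using regular_lin_eq[OF g(1)] by (rule restrict_ext)
      then show "k \<in> (\<lambda>t. restrict (\<lambda>r. r \<odot>\<^bsub>T\<^esub> t) (carrier R)) ` carrier T"
        using lin_closed[OF g(1) one] by blast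
    qed
  qed
  fix I leq S s L f assume "I \<in> U" and lim: "module_limit U R I leq S s L f"
  interpret lim: module_limit U R I leq S s L f by (rule lim)
  {
    fix g assume g: "g \<in> lin R regular_module L"
    obtain i t where i: "i \<in> I" and t: "t \<in> carrier (S i)" "f i t = g \<one>\<^bsub>R\<^esub>"
      using lim.leg_surj[OF lin_closed[OF g one]] by blast
    have "f i (r \<odot>\<^bsub>S i\<^esub> t) = g r" if "r \<in> carrier regular_module" for r
      using that t lin_smult[OF lim.leg[OF i]] regular_lin_eq[OF g, of r] by (simp add: carrier)
    then show "\<exists>i\<in>I. \<exists>h\<in>lin R regular_module (S i). \<forall>x\<in>carrier regular_module. f i (h x) = g x"
      using i regular_lin[OF lim.source[OF i] t(1)]
      by (intro bexI[of _ i] bexI[of _ "\<lambda>r. r \<odot>\<^bsub>S i\<^esub> t"]) auto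
  }
  fix i h assume i: "i \<in> I" and h: "h \<in> lin R regular_module (S i)"
    and fh: "\<forall>x\<in>carrier regular_module. f i (h x) = \<zero>\<^bsub>L\<^esub>"
  obtain j where j: "j \<in> I" "leq i j" "s i j (h \<one>\<^bsub>R\<^esub>) = \<zero>\<^bsub>S j\<^esub>"
    using lim.leg_kernel[OF i lin_closed[OF h one]] fh one by blast
  have "s i j (h x) = \<zero>\<^bsub>S j\<^esub>" if "x \<in> carrier regular_module" for x
    using that j regular_lin_eq[OF h, of x] lin_smult[OF lim.transition[OF i j(1,2)]] lin_closed[OF h one]
      left_module.smult_r_null[OF Mods_module[OF lim.source[OF j(1)]]]
    by (simp add: carrier)
  then show "\<exists>j\<in>I. leq i j \<and> (\<forall>x\<in>carrier regular_module. s i j (h x) = \<zero>\<^bsub>S j\<^esub>)"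
    using j by blast
qed

text \<open>\<open>Hom(A \<oplus> B, T)\<close> is \<open>Hom(A, T) \<times> Hom(B, T)\<close>; an upper bound of two indices serves both components.\<close>

lemma finitely_presented_biproduct:
  assumes A: "finitely_presented A" and B: "finitely_presented B"
  shows "finitely_presented (biproduct A B)"
proof (rule finitely_presentedI)
  note A' = finitely_presentedD[OF A] and B' = finitely_presentedD[OF B]
  show "biproduct A B \<in> Mods U R" using A'(1) B'(1) by (rule biproduct_Mods)
  interpret A: left_module R A using A'(1) by (rule Mods_module)
  interpret B: left_module R B using B'(1) by (rule Mods_module)
  note split = biproduct_split[OF A'(1) B'(1)]
  note inj1 = lin_comp[OF inj1_lin[OF B'(1)]] and inj2 = lin_comp[OF inj2_lin[OF A'(1)]]
  show "small U (homs (biproduct A B) T)" if T: "T \<in> Mods U R" for T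
  proof (rule small_subset)
    let ?join = "\<lambda>(g, h). restrict (\<lambda>z. g (proj1 z) \<oplus>\<^bsub>T\<^esub> h (proj2 z)) (carrier (biproduct A B))"
    show "small U (?join ` (homs A T \<times> homs B T))"
      using A'(2) B'(2) T by (intro small_image small_Sigma)
    show "homs (biproduct A B) T \<subseteq> ?join ` (homs A T \<times> homs B T)"
    proof
      fix k assume "k \<in> homs (biproduct A B) T"
      then obtain g where g: "g \<in> lin R (biproduct A B) T" "k = restrict g (carrier (biproduct A B))"
        by (auto simp: homs_def)
      let ?g1 = "restrict (g \<circ> (\<lambda>a. pair (a, \<zero>\<^bsub>B\<^esub>))) (carrier A)"
      let ?g2 = "restrict (g \<circ> (\<lambda>b. pair (\<zero>\<^bsub>A\<^esub>, b))) (carrier B)"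
      have "k = ?join (?g1, ?g2)"
        unfolding g(2) prod.case
      proof (rule restrict_ext)
        fix z assume "z \<in> carrier (biproduct A B)"
        then obtain a b where "a \<in> carrier A" "b \<in> carrier B" "z = pair (a, b)"
          by (rule biproduct_cases)
        then show "g z = ?g1 (proj1 z) \<oplus>\<^bsub>T\<^esub> ?g2 (proj2 z)"
          using split[OF T g(1), of a b] by simp
      qed
      moreover have "?g1 \<in> homs A T" "?g2 \<in> homs B T"
        unfolding homs_def using inj1[OF g(1)] inj2[OF g(1)] by blast+
      ultimately show "k \<in> ?join ` (homs A T \<times> homs B T)" by blast
    qed
  qed
  fix I leq S s L f assume I: "I \<in> U" and lim: "module_limit U R I leq S s L f"
  interpret lim: module_limit U R I leq S s L f by (rule lim)
  {
    fix g assume g: "g \<in> lin R (biproduct A B) L"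
    obtain i h where i: "i \<in> I" and h: "h \<in> lin R A (S i)"
      and fh: "\<forall>a\<in>carrier A. f i (h a) = g (pair (a, \<zero>\<^bsub>B\<^esub>))"
      using A'(3)[OF I lim.limit inj1[OF g]] by auto
    obtain j k where j: "j \<in> I" and k: "k \<in> lin R B (S j)"
      and fk: "\<forall>b\<in>carrier B. f j (k b) = g (pair (\<zero>\<^bsub>A\<^esub>, b))"
      using B'(3)[OF I lim.limit inj2[OF g]] by auto
    obtain l where l: "l \<in> I" "leq i l" "leq j l" using lim.upper_bound i j by blast
    note hl = lim.push[OF i l(1,2) h] and kl = lim.push[OF j l(1,3) k]
    let ?u = "\<lambda>z. (s i l \<circ> h) (proj1 z) \<oplus>\<^bsub>S l\<^esub> (s j l \<circ> k) (proj2 z)"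
    have "f l (?u z) = g z" if z: "z \<in> carrier (biproduct A B)" for z
    proof -
      obtain a b where ab: "a \<in> carrier A" "b \<in> carrier B" "z = pair (a, b)"
        using z by (rule biproduct_cases)
      have "f l (?u z) = f l ((s i l \<circ> h) a) \<oplus>\<^bsub>L\<^esub> f l ((s j l \<circ> k) b)"
        using ab lin_add[OF lim.leg[OF l(1)] lin_closed[OF hl(1) ab(1)] lin_closed[OF kl(1) ab(2)]]
        by simp
      also have "\<dots> = g z"
        using ab fh fk hl(2)[OF ab(1)] kl(2)[OF ab(2)] split[OF lim.target g ab(1,2)] by simp
      finally show ?thesis .
    qed
    moreover have "?u \<in> lin R (biproduct A B) (S l)"
      using lim.source[OF l(1)] hl(1) kl(1) by (rule copair_lin)
    ultimately show "\<exists>i\<in>I. \<exists>h\<in>lin R (biproduct A B) (S i). \<forall>x\<in>carrier (biproduct A B). f i (h x) = g x"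
      using l(1) by (intro bexI[of _ l] bexI[of _ ?u]) auto
  }
  fix i h assume i: "i \<in> I" and h: "h \<in> lin R (biproduct A B) (S i)"
    and fh: "\<forall>x\<in>carrier (biproduct A B). f i (h x) = \<zero>\<^bsub>L\<^esub>"
  let ?h1 = "h \<circ> (\<lambda>a. pair (a, \<zero>\<^bsub>B\<^esub>))" and ?h2 = "h \<circ> (\<lambda>b. pair (\<zero>\<^bsub>A\<^esub>, b))"
  obtain j where j: "j \<in> I" "leq i j" "\<forall>a\<in>carrier A. s i j (?h1 a) = \<zero>\<^bsub>S j\<^esub>"
    using A'(4)[OF I lim.limit i inj1[OF h]] fh by (auto simp: biproduct_carrier)
  obtain k where k: "k \<in> I" "leq i k" "\<forall>b\<in>carrier B. s i k (?h2 b) = \<zero>\<^bsub>S k\<^esub>"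
    using B'(4)[OF I lim.limit i inj2[OF h]] fh by (auto simp: biproduct_carrier)
  obtain l where l: "l \<in> I" "leq j l" "leq k l" using lim.upper_bound j k by blast
  have il: "leq i l" using lim.leq_trans i j l by blast
  have zero: "s m l \<zero>\<^bsub>S m\<^esub> = \<zero>\<^bsub>S l\<^esub>" if "m \<in> I" "leq m l" for m
    using that l(1) by (intro lin_zero[OF Mods_module Mods_module lim.transition] lim.source)
  interpret Sl: left_module R "S l" using lim.source[OF l(1)] by (rule Mods_module)
  have "s i l (h z) = \<zero>\<^bsub>S l\<^esub>" if z: "z \<in> carrier (biproduct A B)" for z
  proof -
    obtain a b where ab: "a \<in> carrier A" "b \<in> carrier B" "z = pair (a, b)"
      using z by (rule biproduct_cases)
    have a: "s i l (?h1 a) = \<zero>\<^bsub>S l\<^esub>"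
      using lim.transition_trans[OF i j(1) l(1) j(2) l(2) lin_closed[OF inj1[OF h] ab(1)]] j l zero ab(1)
      by simp
    have b: "s i l (?h2 b) = \<zero>\<^bsub>S l\<^esub>"
      using lim.transition_trans[OF i k(1) l(1) k(2) l(3) lin_closed[OF inj2[OF h] ab(2)]] k l zero ab(2)
      by simp
    show ?thesis
      using a b ab(3) split[OF lim.source[OF i] h ab(1,2)]
        lin_add[OF lim.transition[OF i l(1) il] lin_closed[OF inj1[OF h] ab(1)] lin_closed[OF inj2[OF h] ab(2)]]
      by simp
  qed
  then show "\<exists>j\<in>I. leq i j \<and> (\<forall>x\<in>carrier (biproduct A B). s i j (h x) = \<zero>\<^bsub>S j\<^esub>)"
    using l(1) il by blast
qed

lemma quotient_Mods:
  assumes N: "N \<in> Mods U R" and K: "left_submodule R N K"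
  shows "quotient_module N K \<in> Mods U R"
proof -
  interpret Q: submodule_quotient R N K
    using Mods_module[OF N] K by (simp add: submodule_quotient_def submodule_quotient_axioms_def)
  show ?thesis
    by (rule ModsI[OF Q.quotient_left_module])
      (simp add: quotient_module_def small_image Mods_small N)
qed

text \<open>Lift a map out of the quotient to a map \<open>N \<rightarrow> S\<^sub>i\<close>. It kills the finitely many generators in \<open>Y\<close> in the limit,
hence at some later index, where it factors through the quotient.\<close>

lemma finitely_presented_quotient:
  assumes N: "finitely_presented N" and Y: "finite Y" "Y \<subseteq> carrier N"
  shows "finitely_presented (quotient_module N (generated R N Y))"
proof (rule finitely_presentedI)
  note N' = finitely_presentedD[OF N]
  interpret N: left_module R N using N'(1) by (rule Mods_module)
  define K where "K = generated R N Y"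
  define Q where "Q = quotient_module N K"
  have K: "left_submodule R N K"
    unfolding K_def using Y by (intro left_submodule_generated N.left_module_axioms)
  interpret Q: submodule_quotient R N K by unfold_locales (rule K)
  note q = Q.rep_lin[folded Q_def] and mem_Q = Q.mem_quotient[folded Q_def]
  have q_surj: "\<exists>y\<in>carrier N. x = rep N K y" if "x \<in> carrier Q" for x
    using that by (auto simp: Q_def quotient_module_def)
  show "quotient_module N (generated R N Y) \<in> Mods U R"
    using quotient_Mods[OF N'(1) K] by (simp add: K_def)
  show "small U (homs (quotient_module N (generated R N Y)) T)" if T: "T \<in> Mods U R" for T
  proof (rule small_subset[OF small_image[OF N'(2)[OF T]]], fold K_def Q_def)
    show "homs Q T \<subseteq> (\<lambda>g. restrict g (carrier Q)) ` homs N T"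
    proof
      fix k assume "k \<in> homs Q T"
      then obtain g where g: "g \<in> lin R Q T" "k = restrict g (carrier Q)" by (auto simp: homs_def)
      \<comment> \<open>Elements of the quotient are representatives, which \<open>rep N K\<close> fixes.\<close>
      have "k = restrict (restrict (g \<circ> rep N K) (carrier N)) (carrier Q)"
        unfolding g(2) using mem_Q by (intro restrict_ext) simp
      moreover have "restrict (g \<circ> rep N K) (carrier N) \<in> homs N T"
        using lin_comp[OF q g(1)] by (auto simp: homs_def)
      ultimately show "k \<in> (\<lambda>g. restrict g (carrier Q)) ` homs N T" by blast
    qed
  qed
  fix I leq S s L f assume I: "I \<in> U" and lim: "module_limit U R I leq S s L f"
  interpret lim: module_limit U R I leq S s L f by (rule lim)
  {
    fix g assume "g \<in> lin R (quotient_module N (generated R N Y)) L"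
    then have g: "g \<in> lin R Q L" by (simp add: Q_def K_def)
    note gq = lin_comp[OF q g]
    obtain i h where i: "i \<in> I" and h: "h \<in> lin R N (S i)"
      and fh: "\<forall>x\<in>carrier N. f i (h x) = g (rep N K x)"
      using N'(3)[OF I lim.limit gq] by auto
    have "g (rep N K y) = \<zero>\<^bsub>L\<^esub>" if "y \<in> Y" for y
    proof -
      have "y \<in> K" using that generated_subset[of Y R N] by (auto simp: K_def)
      then have "rep N K y = rep N K \<zero>\<^bsub>N\<^esub>"
        using Y that by (intro Q.rep_eqI) (auto simp: N.minus_null)
      then show ?thesis
        using lin_zero[OF N.left_module_axioms Mods_module[OF lim.target] gq] by simp
    qed
    then have "f i (h y) = \<zero>\<^bsub>L\<^esub>" if "y \<in> Y" for y using that fh Y by auto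
    then obtain j where j: "j \<in> I" "leq i j" "\<forall>y\<in>Y. s i j (h y) = \<zero>\<^bsub>S j\<^esub>"
      using lim.kill_finite[OF Y(1) i h] Y by blast
    note hj = lim.push[OF i j(1,2) h]
    have Sj: "left_module R (S j)" using lim.source[OF j(1)] by (rule Mods_module)
    have "K \<subseteq> {x \<in> carrier N. (s i j \<circ> h) x = \<zero>\<^bsub>S j\<^esub>}"
      unfolding K_def using Y j(3)
      by (intro generated_least left_submodule_kernel[OF N.left_module_axioms Sj hj(1)]) auto
    then have "s i j \<circ> h \<in> lin R Q (S j)"
      unfolding Q_def by (intro Q.kills_lin_quotient[OF Sj hj(1)]) blast
    moreover have "f j ((s i j \<circ> h) x) = g x" if "x \<in> carrier Q" for x
      using hj(2) fh mem_Q[OF that] by simp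
    ultimately show "\<exists>i\<in>I. \<exists>h\<in>lin R (quotient_module N (generated R N Y)) (S i).
        \<forall>x\<in>carrier (quotient_module N (generated R N Y)). f i (h x) = g x"
      unfolding Q_def K_def using j(1) by (intro bexI[of _ j] bexI[of _ "s i j \<circ> h"]) auto
  }
  fix i h assume i: "i \<in> I" and "h \<in> lin R (quotient_module N (generated R N Y)) (S i)"
    and "\<forall>x\<in>carrier (quotient_module N (generated R N Y)). f i (h x) = \<zero>\<^bsub>L\<^esub>"
  then have h: "h \<in> lin R Q (S i)" and fh: "\<forall>x\<in>carrier Q. f i (h x) = \<zero>\<^bsub>L\<^esub>"
    by (simp_all add: Q_def K_def)
  obtain j where j: "j \<in> I" "leq i j" "\<forall>x\<in>carrier N. s i j (h (rep N K x)) = \<zero>\<^bsub>S j\<^esub>"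
    using N'(4)[OF I lim.limit i lin_comp[OF q h]] fh lin_closed[OF q] by auto
  have "s i j (h x) = \<zero>\<^bsub>S j\<^esub>" if "x \<in> carrier Q" for x
    using j(3) mem_Q[OF that] by metis
  then show "\<exists>j\<in>I. leq i j \<and> (\<forall>x\<in>carrier (quotient_module N (generated R N Y)). s i j (h x) = \<zero>\<^bsub>S j\<^esub>)"
    using j by (auto simp: Q_def K_def)
qed

primrec free_module :: "nat \<Rightarrow> ('u, 'u) module"
  where "free_module 0 = zero_module"
  | "free_module (Suc n) = biproduct regular_module (free_module n)"

lemma finitely_presented_free: "finitely_presented (free_module n)"
  by (induction n)
    (simp_all add: finitely_presented_zero finitely_presented_biproduct finitely_presented_regular)

lemma free_Mods: "free_module n \<in> Mods U R"
  using finitely_presented_free by (rule finitely_presentedD)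

section \<open>Every module is a direct limit of finitely presented ones\<close>

lemma exists_free_cover:
  assumes T: "T \<in> Mods U R"
  shows "set xs \<subseteq> carrier T \<Longrightarrow> \<exists>n. \<exists>\<phi>\<in>lin R (free_module n) T. set xs \<subseteq> \<phi> ` carrier (free_module n)"
proof (induction xs)
  case Nil
  then show ?case using lin_zero_map[OF Mods_module[OF T]] by auto
next
  case (Cons x xs)
  interpret T: left_module R T using T by (rule Mods_module)
  obtain n \<phi> where \<phi>: "\<phi> \<in> lin R (free_module n) T" "set xs \<subseteq> \<phi> ` carrier (free_module n)"
    using Cons by auto
  interpret F: left_module R "free_module n" by (rule Mods_module[OF free_Mods])
  \<comment> \<open>The new summand sends its generator \<open>1\<close> to \<open>x\<close>.\<close>
  define \<psi> where "\<psi> = (\<lambda>z. proj1 z \<odot>\<^bsub>T\<^esub> x \<oplus>\<^bsub>T\<^esub> \<phi> (proj2 z))"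
  have x: "x \<in> carrier T" using Cons.prems by simp
  have "\<psi> \<in> lin R (free_module (Suc n)) T"
    unfolding \<psi>_def free_module.simps by (rule copair_lin[OF T regular_lin[OF T x] \<phi>(1)])
  moreover have "\<phi> \<zero>\<^bsub>free_module n\<^esub> = \<zero>\<^bsub>T\<^esub>"
    by (rule lin_zero[OF F.left_module_axioms T.left_module_axioms \<phi>(1)])
  then have "\<psi> (pair (\<one>\<^bsub>R\<^esub>, \<zero>\<^bsub>free_module n\<^esub>)) = x"
    using x by (simp add: \<psi>_def T.smult_one)
  then have "x \<in> \<psi> ` carrier (free_module (Suc n))"
    by (intro image_eqI[of _ _ "pair (\<one>\<^bsub>R\<^esub>, \<zero>\<^bsub>free_module n\<^esub>)"])
      (simp_all add: biproduct_carrier regular_module_def)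
  moreover have "y \<in> \<psi> ` carrier (free_module (Suc n))" if y: "y \<in> set xs" for y
  proof -
    obtain z where z: "z \<in> carrier (free_module n)" "y = \<phi> z"
      using subsetD[OF \<phi>(2) y] by (rule imageE)
    then have "\<psi> (pair (\<zero>\<^bsub>R\<^esub>, z)) = y"
      using x lin_closed[OF \<phi>(1)] by (simp add: \<psi>_def T.smult_l_null)
    then show ?thesis
      using z(1)
      by (intro image_eqI[of _ _ "pair (\<zero>\<^bsub>R\<^esub>, z)"]) (simp_all add: biproduct_carrier regular_module_def)
  qed
  ultimately show ?case by (intro exI[of _ "Suc n"] bexI[of _ \<psi>]) auto
qed

lemma fg_submodule_Mods:
  assumes S: "S \<in> Mods U R" and Y: "Y \<subseteq> carrier S"
  shows "S\<lparr>carrier := generated R S Y\<rparr> \<in> Mods U R"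
proof (rule ModsI)
  have K: "left_submodule R S (generated R S Y)"
    using Mods_module[OF S] Y by (rule left_submodule_generated)
  show "left_module R (S\<lparr>carrier := generated R S Y\<rparr>)"
    using Mods_module[OF S] K by (rule left_submodule_module)
  show "small U (carrier (S\<lparr>carrier := generated R S Y\<rparr>))"
    using small_subset[OF Mods_small[OF S]] K by (simp add: left_submodule_def)
qed

text \<open>Cover the generators inside the submodule that they generate: the image of the cover is a submodule
that contains the generators, hence is everything.\<close>

lemma generated_cover:
  assumes S: "S \<in> Mods U R" and xs: "set xs \<subseteq> carrier S"
  shows "\<exists>n. \<exists>\<phi>\<in>lin R (free_module n) (S\<lparr>carrier := generated R S (set xs)\<rparr>).
    \<phi> ` carrier (free_module n) = generated R S (set xs)"
proof -
  let ?T = "S\<lparr>carrier := generated R S (set xs)\<rparr>"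
  have T: "?T \<in> Mods U R" using S xs by (rule fg_submodule_Mods)
  obtain n \<phi> where \<phi>: "\<phi> \<in> lin R (free_module n) ?T" "set xs \<subseteq> \<phi> ` carrier (free_module n)"
    using exists_free_cover[OF T, of xs] generated_subset[of "set xs" R S] by auto
  have "left_submodule R S (generated R S (set xs))"
    using Mods_module[OF S] xs by (rule left_submodule_generated)
  moreover have "left_submodule R ?T (\<phi> ` carrier (free_module n))"
    using free_Mods T \<phi>(1) by (intro left_submodule_image Mods_module)
  ultimately have "left_submodule R S (\<phi> ` carrier (free_module n))"
    by (auto simp: left_submodule_def)
  then have "generated R S (set xs) \<subseteq> \<phi> ` carrier (free_module n)" using \<phi>(2) by (rule generated_least)
  moreover have "\<phi> ` carrier (free_module n) \<subseteq> generated R S (set xs)"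
    using lin_closed[OF \<phi>(1)] by auto
  ultimately show ?thesis using \<phi>(1) by blast
qed

text \<open>Finite subsets of a small set are indexed by lists, which form a small set. The decoding \<open>d\<close> carries
the index set, a subset of \<open>'u\<close>, onto these lists. The order on the indices is only a preorder.\<close>

lemma directed_set_lists:
  assumes "d ` I = lists B"
  shows "directed_set I (\<lambda>i j. set (d i) \<subseteq> set (d j))"
  unfolding directed_set_def
proof (intro conjI ballI)
  show "I \<noteq> {}" using assms by auto
  fix i j assume "i \<in> I" "j \<in> I"
  then have "d i @ d j \<in> d ` I" unfolding assms using assms by auto
  then obtain k where "k \<in> I" "d k = d i @ d j" by force
  then show "\<exists>k\<in>I. set (d i) \<subseteq> set (d k) \<and> set (d j) \<subseteq> set (d k)" by (intro bexI[of _ k]) auto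
qed (auto simp: reflp_on_def transp_on_def)

lemma limit_of_generated_submodules:
  assumes S: "S \<in> Mods U R" and d: "d ` I = lists (carrier S)"
  shows "is_direct_limit U R I (\<lambda>i j. set (d i) \<subseteq> set (d j))
    (\<lambda>i. S\<lparr>carrier := generated R S (set (d i))\<rparr>) (\<lambda>i j x. x) S (\<lambda>i x. x)"
  unfolding is_direct_limit_iff direct_system_def
proof (intro conjI ballI impI)
  have mem: "set (d i) \<subseteq> carrier S" if "i \<in> I" for i using d that by blast
  have sub: "left_submodule R S (generated R S (set (d i)))" if "i \<in> I" for i
    using left_submodule_generated[OF Mods_module[OF S] mem[OF that]] .
  show "directed_set I (\<lambda>i j. set (d i) \<subseteq> set (d j))" using d by (rule directed_set_lists)
  show "S \<in> Mods U R" by (rule S)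
  show "S\<lparr>carrier := generated R S (set (d i))\<rparr> \<in> Mods U R" if "i \<in> I" for i
    using S mem[OF that] by (rule fg_submodule_Mods)
  show "(\<lambda>x. x) \<in> lin R (S\<lparr>carrier := generated R S (set (d i))\<rparr>) (S\<lparr>carrier := generated R S (set (d j))\<rparr>)"
    if "set (d i) \<subseteq> set (d j)" for i j
    using generated_mono[OF that] by (intro linI) auto
  show "(\<lambda>x. x) \<in> lin R (S\<lparr>carrier := generated R S (set (d i))\<rparr>) S" if "i \<in> I" for i
    using sub[OF that] by (intro linI) (auto simp: left_submodule_def)
  show "\<exists>i\<in>I. \<exists>x\<in>carrier (S\<lparr>carrier := generated R S (set (d i))\<rparr>). x = y" if "y \<in> carrier S" for y
  proof -
    have "[y] \<in> d ` I" unfolding d using that by simp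
    then obtain i where "i \<in> I" "d i = [y]" by force
    then show ?thesis using generated_subset[of "{y}"] by (intro bexI[of _ i]) auto
  qed
  show "\<exists>j\<in>I. set (d i) \<subseteq> set (d j) \<and> x = \<zero>\<^bsub>S\<lparr>carrier := generated R S (set (d j))\<rparr>\<^esub>"
    if "i \<in> I" "x = \<zero>\<^bsub>S\<^esub>" for i x
    using that by (intro bexI[of _ i]) simp_all
qed auto

text \<open>With representatives as elements of the quotients, the map to the limit \<open>T\<close> is \<open>\<phi>\<close> itself for every index, and
the transition maps choose a new representative. An element of the kernel of \<open>\<phi>\<close> vanishes once
it is added to the list of relations.\<close>

lemma limit_of_quotients:
  assumes N: "N \<in> Mods U R" and T: "T \<in> Mods U R" and \<phi>: "\<phi> \<in> lin R N T"
    and surj: "\<phi> ` carrier N = carrier T"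
    and d: "d ` I = lists {x \<in> carrier N. \<phi> x = \<zero>\<^bsub>T\<^esub>}"
  shows "is_direct_limit U R I (\<lambda>i j. set (d i) \<subseteq> set (d j))
    (\<lambda>i. quotient_module N (generated R N (set (d i)))) (\<lambda>i j. rep N (generated R N (set (d j)))) T (\<lambda>i. \<phi>)"
  unfolding is_direct_limit_iff direct_system_def
proof (intro conjI ballI impI)
  define K where "K i = generated R N (set (d i))" for i
  define Q where "Q i = quotient_module N (K i)" for i
  note defs = Q_def[symmetric] K_def[symmetric]
  interpret N: left_module R N using N by (rule Mods_module)
  interpret T: left_module R T using T by (rule Mods_module)
  have mem: "set (d i) \<subseteq> {x \<in> carrier N. \<phi> x = \<zero>\<^bsub>T\<^esub>}" if "i \<in> I" for i using d that by blast
  then have sub: "left_submodule R N (K i)" if "i \<in> I" for i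
    unfolding K_def using that by (intro left_submodule_generated N.left_module_axioms) blast
  have K_ker: "K i \<subseteq> {x \<in> carrier N. \<phi> x = \<zero>\<^bsub>T\<^esub>}" if "i \<in> I" for i
    unfolding K_def using mem[OF that]
    by (intro generated_least left_submodule_kernel N.left_module_axioms T.left_module_axioms \<phi>)
  have quot: "submodule_quotient R N (K i)" if "i \<in> I" for i
    using sub[OF that] N.left_module_axioms
    by (simp add: submodule_quotient_def submodule_quotient_axioms_def)
  have Q: "Q i \<in> Mods U R" if "i \<in> I" for i
    unfolding Q_def using N sub[OF that] by (rule quotient_Mods)
  note rep_lin = submodule_quotient.rep_lin[OF quot, folded Q_def]
    and mem_Q = submodule_quotient.mem_quotient[OF quot, folded Q_def]
  have rep_kills: "rep N (K j) x = \<zero>\<^bsub>Q j\<^esub>" if "x \<in> K j" "j \<in> I" for x j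
  proof -
    have "x \<in> carrier N" using sub[OF that(2)] that(1) by (auto simp: left_submodule_def)
    moreover from this have "x \<ominus>\<^bsub>N\<^esub> \<zero>\<^bsub>N\<^esub> = x" by (rule N.minus_null)
    ultimately have "rep N (K j) x = rep N (K j) \<zero>\<^bsub>N\<^esub>"
      using that by (intro submodule_quotient.rep_eqI[OF quot]) simp_all
    then show ?thesis by (simp add: Q_def quotient_module_def)
  qed
  have trans: "rep N (K j) \<in> lin R (Q i) (Q j)"
    and trans_rep: "x \<in> carrier N \<Longrightarrow> rep N (K j) (rep N (K i) x) = rep N (K j) x"
    if "i \<in> I" "j \<in> I" "set (d i) \<subseteq> set (d j)" for i j x
  proof -
    have "rep N (K j) x = \<zero>\<^bsub>Q j\<^esub>" if "x \<in> K i" for x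
    proof (rule rep_kills)
      show "x \<in> K j" using generated_mono[OF \<open>set (d i) \<subseteq> set (d j)\<close>, of R N] that by (auto simp: K_def)
    qed (rule \<open>j \<in> I\<close>)
    note * = quot[OF \<open>i \<in> I\<close>] Mods_module[OF Q[OF \<open>j \<in> I\<close>]] rep_lin[OF \<open>j \<in> I\<close>] this
    show "rep N (K j) \<in> lin R (Q i) (Q j)"
      unfolding Q_def[of i] using * by (rule submodule_quotient.kills_lin_quotient)
    show "rep N (K j) (rep N (K i) x) = rep N (K j) x" if "x \<in> carrier N"
      using * that by (rule submodule_quotient.kills_rep)
  qed
  have \<phi>_rep: "\<phi> (rep N (K i) x) = \<phi> x" if "i \<in> I" "x \<in> carrier N" for i x
    using that K_ker by (intro submodule_quotient.kills_rep[OF quot T.left_module_axioms \<phi>]) auto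
  show "directed_set I (\<lambda>i j. set (d i) \<subseteq> set (d j))" using d by (rule directed_set_lists)
  show "T \<in> Mods U R" by (rule T)
  show "quotient_module N (generated R N (set (d i))) \<in> Mods U R" if "i \<in> I" for i
    using Q[OF that] unfolding Q_def K_def .
  show "rep N (generated R N (set (d j))) \<in> lin R (quotient_module N (generated R N (set (d i))))
      (quotient_module N (generated R N (set (d j))))" if "i \<in> I" "j \<in> I" "set (d i) \<subseteq> set (d j)" for i j
    using trans[OF that] unfolding Q_def K_def .
  show "\<phi> \<in> lin R (quotient_module N (generated R N (set (d i)))) T" if "i \<in> I" for i
    unfolding K_def[symmetric] using K_ker[OF that]
    by (intro submodule_quotient.kills_lin_quotient[OF quot[OF that] T.left_module_axioms \<phi>]) auto
  fix i assume i: "i \<in> I"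
  {
    fix x assume "x \<in> carrier (quotient_module N (generated R N (set (d i))))"
    then have x: "x \<in> carrier N" "rep N (K i) x = x"
      using mem_Q[OF i] by (auto simp: Q_def K_def)
    show "rep N (generated R N (set (d i))) x = x" using x(2) by (simp add: K_def)
    show "\<phi> (rep N (generated R N (set (d j))) x) = \<phi> x" if "j \<in> I" for j
      using \<phi>_rep[OF that x(1)] by (simp add: K_def)
    show "rep N (generated R N (set (d k))) (rep N (generated R N (set (d j))) x) =
        rep N (generated R N (set (d k))) x"
      if "j \<in> I" "k \<in> I" "set (d i) \<subseteq> set (d j) \<and> set (d j) \<subseteq> set (d k)" for j k
      using trans_rep[of j k x] that x(1) by (simp add: K_def)
    show "\<exists>j\<in>I. set (d i) \<subseteq> set (d j) \<and>
        rep N (generated R N (set (d j))) x = \<zero>\<^bsub>quotient_module N (generated R N (set (d j)))\<^esub>"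
      if "\<phi> x = \<zero>\<^bsub>T\<^esub>"
    proof -
      have "x # d i \<in> d ` I" unfolding d using x(1) that mem[OF i] by auto
      then obtain j where j: "j \<in> I" "d j = x # d i" by force
      have "x \<in> K j" using generated_subset[of "set (d j)"] j(2) by (auto simp: K_def)
      then show ?thesis
        using j rep_kills[OF _ j(1)] by (intro bexI[of _ j]) (auto simp: K_def Q_def)
    qed
  }
next
  interpret N: left_module R N using N by (rule Mods_module)
  fix y assume "y \<in> carrier T"
  then obtain x where x: "x \<in> carrier N" "y = \<phi> x" using surj by blast
  have "[] \<in> d ` I" unfolding d by simp
  then obtain i where i: "i \<in> I" "d i = []" by force
  interpret Q: submodule_quotient R N "generated R N (set (d i))"
    using N.left_module_axioms left_submodule_generated[OF N.left_module_axioms, of "set (d i)"] i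
    by (simp add: submodule_quotient_def submodule_quotient_axioms_def)
  have "generated R N (set (d i)) \<subseteq> {x \<in> carrier N. \<phi> x = \<zero>\<^bsub>T\<^esub>}"
    using i by (intro generated_least left_submodule_kernel N.left_module_axioms Mods_module[OF T] \<phi>) auto
  then have "\<phi> (rep N (generated R N (set (d i))) x) = y"
    using x by (subst Q.kills_rep[OF Mods_module[OF T] \<phi>]) auto
  then show "\<exists>i\<in>I. \<exists>x\<in>carrier (quotient_module N (generated R N (set (d i)))). \<phi> x = y"
    using i(1) lin_closed[OF Q.rep_lin x(1)] by blast
qed

text \<open>A small set of finitely presented modules that contains enough of them to reach all elements of a
functor that preserves direct limits.\<close>

definition presented_modules :: "('u, 'u) module set"
  where "presented_modules = (\<Union>n. (\<lambda>ys. quotient_module (free_module n) (generated R (free_module n) (set ys))) `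
    lists (carrier (free_module n)))"

lemma small_presented_modules: "small U presented_modules"
  unfolding presented_modules_def
  by (intro small_UN small_nat small_image small_lists Mods_small free_Mods)

lemma presented_modules_finitely_presented: "A \<in> presented_modules \<Longrightarrow> finitely_presented A"
  unfolding presented_modules_def
  by (auto intro!: finitely_presented_quotient finitely_presented_free)

end

section \<open>Additive functors\<close>

locale additive_functor = module_universe U R
  for U :: "'u set set" and R :: "'u ring" +
  fixes M :: "('u, 'u) rfunctor"
  assumes rmodule: "rmodule U R M"
begin

lemma obj_comm_group: "S \<in> Mods U R \<Longrightarrow> comm_group (obj M S)"
  and obj_small: "S \<in> Mods U R \<Longrightarrow> carrier (obj M S) \<in> U"
  using rmodule by (simp_all add: rmodule_def)

lemmas arr_hom = rmodule[unfolded rmodule_def, THEN conjunct2, THEN conjunct1, rule_format]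

lemma arr_cong:
  assumes "S \<in> Mods U R" "T \<in> Mods U R" "f \<in> lin R S T" "g \<in> lin R S T"
    and "\<And>x. x \<in> carrier S \<Longrightarrow> f x = g x" and "y \<in> carrier (obj M S)"
  shows "arr M S T f y = arr M S T g y"
  using rmodule[unfolded rmodule_def, THEN conjunct2, THEN conjunct2, THEN conjunct1, rule_format, of S T f g y] assms by blast

lemmas arr_ident = rmodule[unfolded rmodule_def, THEN conjunct2, THEN conjunct2, THEN conjunct2, THEN conjunct1, rule_format]

lemmas arr_comp = rmodule[unfolded rmodule_def, THEN conjunct2, THEN conjunct2, THEN conjunct2, THEN conjunct2, THEN conjunct1, rule_format, symmetric]

lemmas arr_add = rmodule[unfolded rmodule_def, THEN conjunct2, THEN conjunct2, THEN conjunct2, THEN conjunct2, THEN conjunct2, rule_format]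

lemma obj_group: "S \<in> Mods U R \<Longrightarrow> group (obj M S)"
  using obj_comm_group by (rule comm_group.axioms)

lemma arr_closed: "S \<in> Mods U R \<Longrightarrow> T \<in> Mods U R \<Longrightarrow> f \<in> lin R S T \<Longrightarrow> x \<in> carrier (obj M S) \<Longrightarrow>
    arr M S T f x \<in> carrier (obj M T)"
  by (rule hom_in_carrier[OF arr_hom])

lemma arr_one: "S \<in> Mods U R \<Longrightarrow> T \<in> Mods U R \<Longrightarrow> f \<in> lin R S T \<Longrightarrow> arr M S T f \<one>\<^bsub>obj M S\<^esub> = \<one>\<^bsub>obj M T\<^esub>"
  using hom_one[OF arr_hom obj_group obj_group] .

lemma arr_mult: "S \<in> Mods U R \<Longrightarrow> T \<in> Mods U R \<Longrightarrow> f \<in> lin R S T \<Longrightarrow> x \<in> carrier (obj M S) \<Longrightarrow>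
    y \<in> carrier (obj M S) \<Longrightarrow> arr M S T f (x \<otimes>\<^bsub>obj M S\<^esub> y) = arr M S T f x \<otimes>\<^bsub>obj M T\<^esub> arr M S T f y"
  by (rule hom_mult[OF arr_hom])

text \<open>Additivity forces \<open>M 0 + M 0 = M 0\<close>.\<close>

lemma arr_zero:
  assumes S: "S \<in> Mods U R" and T: "T \<in> Mods U R" and y: "y \<in> carrier (obj M S)"
  shows "arr M S T (\<lambda>x. \<zero>\<^bsub>T\<^esub>) y = \<one>\<^bsub>obj M T\<^esub>"
proof -
  interpret T: left_module R T using T by (rule Mods_module)
  interpret G: group "obj M T" using T by (rule obj_group)
  have zero: "(\<lambda>x. \<zero>\<^bsub>T\<^esub>) \<in> lin R S T" by (rule lin_zero_map[OF T.left_module_axioms])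
  have "arr M S T (\<lambda>x. \<zero>\<^bsub>T\<^esub>) y \<otimes>\<^bsub>obj M T\<^esub> arr M S T (\<lambda>x. \<zero>\<^bsub>T\<^esub>) y = arr M S T (\<lambda>x. \<zero>\<^bsub>T\<^esub> \<oplus>\<^bsub>T\<^esub> \<zero>\<^bsub>T\<^esub>) y"
    by (rule arr_add[OF S T zero zero y, symmetric])
  then have "arr M S T (\<lambda>x. \<zero>\<^bsub>T\<^esub>) y \<otimes>\<^bsub>obj M T\<^esub> arr M S T (\<lambda>x. \<zero>\<^bsub>T\<^esub>) y = arr M S T (\<lambda>x. \<zero>\<^bsub>T\<^esub>) y"
    by (simp only: T.M.l_zero[OF T.M.zero_closed])
  then show ?thesis
    by (rule G.l_cancel_one[OF arr_closed[OF S T zero y] arr_closed[OF S T zero y], THEN iffD1])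
qed

lemma functor_cocone:
  assumes "module_limit U R I leq S s L f"
  shows "group_cocone I leq (\<lambda>i. obj M (S i)) (\<lambda>i j. arr M (S i) (S j) (s i j)) (obj M L)
    (\<lambda>i. arr M (S i) L (f i))"
proof -
  interpret lim: module_limit U R I leq S s L f by fact
  show ?thesis
  proof (rule group_cocone.intro)
    show "directed_set I leq" using lim.system by (simp add: direct_system_def)
    show "arr M (S i) (S i) (s i i) x = x" if "i \<in> I" "x \<in> carrier (obj M (S i))" for i x
    proof -
      have "arr M (S i) (S i) (s i i) x = arr M (S i) (S i) (\<lambda>x. x) x"
        using that lim.leq_refl lim.transition_refl
        by (intro arr_cong lim.source lim.transition lin_ident) auto
      then show ?thesis using that lim.source by (simp add: arr_ident)
    qed
    show "arr M (S j) (S k) (s j k) (arr M (S i) (S j) (s i j) x) = arr M (S i) (S k) (s i k) x"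
      if "i \<in> I" "j \<in> I" "k \<in> I" "leq i j" "leq j k" "x \<in> carrier (obj M (S i))" for i j k x
    proof -
      have ik: "leq i k" using that lim.leq_trans by blast
      note lin = lim.transition[OF that(1,2,4)] lim.transition[OF that(2,3,5)]
      have "arr M (S j) (S k) (s j k) (arr M (S i) (S j) (s i j) x) = arr M (S i) (S k) (s j k \<circ> s i j) x"
        using that lin by (intro arr_comp lim.source)
      also have "\<dots> = arr M (S i) (S k) (s i k) x"
        using that ik lim.transition_trans
        by (intro arr_cong lim.source lin_comp[OF lin] lim.transition) auto
      finally show ?thesis .
    qed
    show "arr M (S j) L (f j) (arr M (S i) (S j) (s i j) x) = arr M (S i) L (f i) x"
      if "i \<in> I" "j \<in> I" "leq i j" "x \<in> carrier (obj M (S i))" for i j x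
    proof -
      note lin = lim.transition[OF that(1-3)] lim.leg[OF that(2)]
      have "arr M (S j) L (f j) (arr M (S i) (S j) (s i j) x) = arr M (S i) L (f j \<circ> s i j) x"
        using that lin by (intro arr_comp lim.source lim.target)
      also have "\<dots> = arr M (S i) L (f i) x"
        using that lim.leg_transition
        by (intro arr_cong lim.source lim.target lin_comp[OF lin] lim.leg) auto
      finally show ?thesis .
    qed
  qed (auto intro: obj_group arr_hom lim.source lim.target lim.leg lim.transition)
qed

end

context module_universe
begin

definition limit_surjective where
  "limit_surjective M I S L f \<longleftrightarrow>
    (\<forall>y\<in>carrier (obj M L). \<exists>i\<in>I. \<exists>x\<in>carrier (obj M (S i)). arr M (S i) L (f i) x = y)"

definition limit_injective where
  "limit_injective M I leq S s L f \<longleftrightarrow>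
    (\<forall>i\<in>I. \<forall>x\<in>carrier (obj M (S i)). arr M (S i) L (f i) x = \<one>\<^bsub>obj M L\<^esub> \<longrightarrow>
      (\<exists>j\<in>I. leq i j \<and> arr M (S i) (S j) (s i j) x = \<one>\<^bsub>obj M (S j)\<^esub>))"

definition product_injective where
  "product_injective M I S P p \<longleftrightarrow>
    (\<forall>x\<in>carrier (obj M P). (\<forall>i\<in>I. arr M P (S i) (p i) x = \<one>\<^bsub>obj M (S i)\<^esub>) \<longrightarrow> x = \<one>\<^bsub>obj M P\<^esub>)"

definition product_surjective where
  "product_surjective M I S P p \<longleftrightarrow>
    (\<forall>y. (\<forall>i\<in>I. y i \<in> carrier (obj M (S i))) \<longrightarrow>
      (\<exists>x\<in>carrier (obj M P). \<forall>i\<in>I. arr M P (S i) (p i) x = y i))"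

lemma is_direct_limit_module_limit:
  "is_direct_limit U R I leq S s L f \<longleftrightarrow> module_limit U R I leq S s L f"
  using module_limit.intro[OF module_universe_axioms module_limit_axioms.intro] module_limit.limit
  by blast

end

context additive_functor
begin

text \<open>An instance of \<open>limit_iso_iff\<close>: a functor carries direct systems of modules to direct systems of groups.\<close>

lemma preserves_direct_limits_iff:
  "preserves_direct_limits U R M \<longleftrightarrow>
    (\<forall>I\<in>U. \<forall>leq S s L f. module_limit U R I leq S s L f \<longrightarrow>
      limit_surjective M I S L f \<and> limit_injective M I leq S s L f)"
proof -
  have "limit_map (\<lambda>i. arr M (S i) L (f i))
        \<in> iso (direct_limit I leq (\<lambda>i. obj M (S i)) (\<lambda>i j. arr M (S i) (S j) (s i j))) (obj M L) \<longleftrightarrow>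
      limit_surjective M I S L f \<and> limit_injective M I leq S s L f"
    if "module_limit U R I leq S s L f" for I :: "'u set" and leq S s L f
    unfolding limit_surjective_def limit_injective_def
    by (rule group_cocone.limit_iso_iff[OF functor_cocone[OF that]])
  then show ?thesis
    unfolding preserves_direct_limits_def is_direct_limit_module_limit by meson
qed

lemma product_map_inj_iff:
  assumes P: "is_product U R I S P p"
  shows "inj_on (product_map I (\<lambda>i. arr M P (S i) (p i))) (carrier (obj M P)) \<longleftrightarrow>
    product_injective M I S P p"
proof -
  have mods: "P \<in> Mods U R" "\<And>i. i \<in> I \<Longrightarrow> S i \<in> Mods U R" "\<And>i. i \<in> I \<Longrightarrow> p i \<in> lin R P (S i)"
    using P by (auto simp: is_product_def)
  interpret GP: group "obj M P" using mods(1) by (rule obj_group)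
  have eq: "product_map I (\<lambda>i. arr M P (S i) (p i)) x = product_map I (\<lambda>i. arr M P (S i) (p i)) y \<longleftrightarrow>
      (\<forall>i\<in>I. arr M P (S i) (p i) x = arr M P (S i) (p i) y)" for x y
    by (auto simp: product_map_def fun_eq_iff restrict_def)
  show ?thesis
  proof
    assume inj: "inj_on (product_map I (\<lambda>i. arr M P (S i) (p i))) (carrier (obj M P))"
    show "product_injective M I S P p"
      unfolding product_injective_def
    proof (intro ballI impI)
      fix x assume x: "x \<in> carrier (obj M P)" "\<forall>i\<in>I. arr M P (S i) (p i) x = \<one>\<^bsub>obj M (S i)\<^esub>"
      have "\<forall>i\<in>I. arr M P (S i) (p i) x = arr M P (S i) (p i) \<one>\<^bsub>obj M P\<^esub>"
        using x(2) mods by (simp add: arr_one)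
      then show "x = \<one>\<^bsub>obj M P\<^esub>"
        using x(1) by (intro inj_onD[OF inj]) (simp_all only: eq GP.one_closed)
    qed
  next
    assume inj: "product_injective M I S P p"
    show "inj_on (product_map I (\<lambda>i. arr M P (S i) (p i))) (carrier (obj M P))"
    proof (rule inj_onI, unfold eq)
      fix x y assume x: "x \<in> carrier (obj M P)" and y: "y \<in> carrier (obj M P)"
        and xy: "\<forall>i\<in>I. arr M P (S i) (p i) x = arr M P (S i) (p i) y"
      have "arr M P (S i) (p i) (x \<otimes>\<^bsub>obj M P\<^esub> inv\<^bsub>obj M P\<^esub> y) = \<one>\<^bsub>obj M (S i)\<^esub>" if i: "i \<in> I" for i
      proof -
        interpret h: group_hom "obj M P" "obj M (S i)" "arr M P (S i) (p i)"
          using mods i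
          by (simp add: group_hom_def group_hom_axioms_def obj_group arr_hom)
        show ?thesis using x y xy i by simp
      qed
      then have "x \<otimes>\<^bsub>obj M P\<^esub> inv\<^bsub>obj M P\<^esub> y = \<one>\<^bsub>obj M P\<^esub>"
        using inj x y unfolding product_injective_def by simp
      then show "x = y" using x y by (metis GP.inv_closed GP.inv_equality GP.inv_inv)
    qed
  qed
qed

lemma product_map_iso_iff:
  assumes P: "is_product U R I S P p"
  shows "product_map I (\<lambda>i. arr M P (S i) (p i)) \<in> iso (obj M P) (product_group I (\<lambda>i. obj M (S i))) \<longleftrightarrow>
    product_injective M I S P p \<and> product_surjective M I S P p"
proof -
  let ?h = "product_map I (\<lambda>i. arr M P (S i) (p i))"
  have mods: "P \<in> Mods U R" "\<And>i. i \<in> I \<Longrightarrow> S i \<in> Mods U R" "\<And>i. i \<in> I \<Longrightarrow> p i \<in> lin R P (S i)"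
    using P by (auto simp: is_product_def)
  have hom: "?h \<in> hom (obj M P) (product_group I (\<lambda>i. obj M (S i)))"
    by (rule homI)
      (auto simp: product_map_def product_group_def mods arr_closed arr_mult cong: restrict_cong)
  have "?h ` carrier (obj M P) = (\<Pi>\<^sub>E i\<in>I. carrier (obj M (S i))) \<longleftrightarrow> product_surjective M I S P p"
  proof
    assume surj: "?h ` carrier (obj M P) = (\<Pi>\<^sub>E i\<in>I. carrier (obj M (S i)))"
    show "product_surjective M I S P p"
      unfolding product_surjective_def
    proof (intro allI impI)
      fix y assume "\<forall>i\<in>I. y i \<in> carrier (obj M (S i))"
      then have "restrict y I \<in> ?h ` carrier (obj M P)" unfolding surj by auto
      then obtain x where x: "x \<in> carrier (obj M P)" "restrict y I = ?h x" by blast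
      have "arr M P (S i) (p i) x = y i" if "i \<in> I" for i
        using fun_cong[OF x(2), of i] that by (simp add: product_map_def)
      then show "\<exists>x\<in>carrier (obj M P). \<forall>i\<in>I. arr M P (S i) (p i) x = y i" using x(1) by blast
    qed
  next
    assume surj: "product_surjective M I S P p"
    show "?h ` carrier (obj M P) = (\<Pi>\<^sub>E i\<in>I. carrier (obj M (S i)))"
    proof
      show "?h ` carrier (obj M P) \<subseteq> (\<Pi>\<^sub>E i\<in>I. carrier (obj M (S i)))"
        by (auto simp: product_map_def mods arr_closed)
      show "(\<Pi>\<^sub>E i\<in>I. carrier (obj M (S i))) \<subseteq> ?h ` carrier (obj M P)"
      proof
        fix y assume y: "y \<in> (\<Pi>\<^sub>E i\<in>I. carrier (obj M (S i)))"
        then have "\<forall>i\<in>I. y i \<in> carrier (obj M (S i))" by auto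
        then obtain x where x: "x \<in> carrier (obj M P)" "\<forall>i\<in>I. arr M P (S i) (p i) x = y i"
          using surj unfolding product_surjective_def by blast
        have "?h x = y"
        proof (rule ext)
          show "?h x i = y i" for i
            using x(2) PiE_arb[OF y, of i] by (simp add: product_map_def)
        qed
        then show "y \<in> ?h ` carrier (obj M P)" using x(1) by blast
      qed
    qed
  qed
  then show ?thesis
    using hom product_map_inj_iff[OF P] by (simp add: iso_def bij_betw_def)
qed

lemma Mittag_Leffler_iff:
  "Mittag_Leffler_module U R M \<longleftrightarrow> preserves_direct_limits U R M \<and>
    (\<forall>I\<in>U. \<forall>S P p. is_product U R I S P p \<longrightarrow> product_injective M I S P p)"
  by (simp add: Mittag_Leffler_module_def rmodule product_map_inj_iff cong: imp_cong)

lemma FP_iff: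
  "FP_module U R M \<longleftrightarrow> Mittag_Leffler_module U R M \<and>
    (\<forall>I\<in>U. \<forall>S P p. is_product U R I S P p \<longrightarrow> product_surjective M I S P p)"
  unfolding FP_module_def Mittag_Leffler_iff preserves_products_def
  by (simp add: rmodule product_map_iso_iff cong: imp_cong) blast

end

section \<open>Subfunctors\<close>

text \<open>Kernels and images are both given by subsets of the values of a functor, with the inherited operations and maps.\<close>

definition subfunctor :: "('r, 'u) rfunctor \<Rightarrow> (('r, 'u) module \<Rightarrow> 'u set) \<Rightarrow> ('r, 'u) rfunctor"
  where "subfunctor M C = \<lparr>obj = (\<lambda>S. (obj M S)\<lparr>carrier := C S\<rparr>), arr = arr M\<rparr>"

lemma subfunctor_simps [simp]:
  "carrier (obj (subfunctor M C) S) = C S"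
  "\<one>\<^bsub>obj (subfunctor M C) S\<^esub> = \<one>\<^bsub>obj M S\<^esub>"
  "monoid.mult (obj (subfunctor M C) S) = monoid.mult (obj M S)"
  "arr (subfunctor M C) = arr M"
  by (simp_all add: subfunctor_def)

locale functor_with_subfunctor = additive_functor U R M
  for U :: "'u set set" and R :: "'u ring" and M :: "('u, 'u) rfunctor" +
  fixes C :: "('u, 'u) module \<Rightarrow> 'u set"
  assumes subgroup: "S \<in> Mods U R \<Longrightarrow> subgroup (C S) (obj M S)"
    and stable: "S \<in> Mods U R \<Longrightarrow> T \<in> Mods U R \<Longrightarrow> f \<in> lin R S T \<Longrightarrow> x \<in> C S \<Longrightarrow> arr M S T f x \<in> C T"
begin

lemma mem_obj: "S \<in> Mods U R \<Longrightarrow> x \<in> C S \<Longrightarrow> x \<in> carrier (obj M S)"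
  using subgroup subgroup.mem_carrier by metis

lemma subfunctor_rmodule: "rmodule U R (subfunctor M C)"
  unfolding rmodule_def
proof (intro conjI ballI impI)
  fix S assume S: "S \<in> Mods U R"
  interpret comm_group "obj M S" using S by (rule obj_comm_group)
  show "comm_group (obj (subfunctor M C) S)"
  proof (rule group.group_comm_groupI)
    show "group (obj (subfunctor M C) S)"
      using subgroup_imp_group[OF subgroup[OF S]] by (simp add: subfunctor_def)
  qed (simp add: m_comm mem_obj[OF S])
  show "carrier (obj (subfunctor M C) S) \<in> U"
    using mem_obj[OF S] by (intro mem_subset[OF obj_small[OF S]]) auto
qed (auto simp: mem_obj hom_def stable arr_mult arr_ident arr_comp[symmetric] arr_add intro: arr_cong)

lemma rsubmodule_subfunctor: "rsubmodule U R (subfunctor M C) M"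
  using subfunctor_rmodule by (auto simp: rsubmodule_def rmorphism_def mem_obj hom_def)

lemma rsubmodule_subfunctors:
  assumes "functor_with_subfunctor U R M D" and "\<And>S. S \<in> Mods U R \<Longrightarrow> C S \<subseteq> D S"
  shows "rsubmodule U R (subfunctor M C) (subfunctor M D)"
  using subfunctor_rmodule assms(2) by (auto simp: rsubmodule_def rmorphism_def hom_def)

text \<open>Injectivity of the comparison maps passes to subfunctors, so only surjectivity has to be supplied.\<close>

lemma subfunctor_FP:
  assumes mittag: "Mittag_Leffler_module U R M"
    and limits: "\<And>I leq S s L f y. I \<in> U \<Longrightarrow> module_limit U R I leq S s L f \<Longrightarrow> y \<in> C L \<Longrightarrow>
      \<exists>i\<in>I. \<exists>x\<in>C (S i). arr M (S i) L (f i) x = y"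
    and products: "\<And>I S P p y. I \<in> U \<Longrightarrow> is_product U R I S P p \<Longrightarrow> (\<And>i. i \<in> I \<Longrightarrow> y i \<in> C (S i)) \<Longrightarrow>
      \<exists>x\<in>C P. \<forall>i\<in>I. arr M P (S i) (p i) x = y i"
  shows "FP_module U R (subfunctor M C)"
proof -
  interpret sub: additive_functor U R "subfunctor M C"
    by unfold_locales (rule subfunctor_rmodule)
  have "limit_surjective (subfunctor M C) I S L f \<and> limit_injective (subfunctor M C) I leq S s L f"
    if "I \<in> U" and lim: "module_limit U R I leq S s L f" for I leq S s L f
  proof
    show "limit_surjective (subfunctor M C) I S L f"
      using limits[OF that] by (simp add: limit_surjective_def)
    have "limit_injective M I leq S s L f"
      using mittag that by (auto simp: Mittag_Leffler_iff preserves_direct_limits_iff)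
    then show "limit_injective (subfunctor M C) I leq S s L f"
      using mem_obj[OF module_limit.source[OF lim]] by (auto simp: limit_injective_def)
  qed
  moreover have "product_injective (subfunctor M C) I S P p \<and> product_surjective (subfunctor M C) I S P p"
    if "I \<in> U" and P: "is_product U R I S P p" for I S P p
  proof
    have "P \<in> Mods U R" using P by (simp add: is_product_def)
    moreover have "product_injective M I S P p" using mittag that by (simp add: Mittag_Leffler_iff)
    ultimately show "product_injective (subfunctor M C) I S P p"
      using mem_obj by (auto simp: product_injective_def)
    show "product_surjective (subfunctor M C) I S P p"
      using products[OF that] by (simp add: product_surjective_def)
  qed
  ultimately show ?thesis
    by (simp add: sub.FP_iff sub.Mittag_Leffler_iff sub.preserves_direct_limits_iff)
qed

end

section \<open>Elements come from finitely presented modules\<close>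

context additive_functor
begin

text \<open>Preservation of direct limits is used twice: \<open>x\<close> comes from a finitely generated submodule of \<open>S\<close>,
and from there, writing this submodule as a limit of quotients of a free module, from one of these quotients.\<close>

lemma element_from_presented:
  assumes limits: "preserves_direct_limits U R M" and S: "S \<in> Mods U R" and x: "x \<in> carrier (obj M S)"
  shows "\<exists>A\<in>presented_modules. \<exists>a\<in>carrier (obj M A). \<exists>g\<in>lin R A S. arr M A S g a = x"
proof -
  have surj: "limit_surjective M I S L f" if "I \<in> U" "is_direct_limit U R I leq S s L f"
    for I :: "'u set" and leq S s L f
    using limits that by (auto simp: preserves_direct_limits_iff is_direct_limit_module_limit)
  obtain I d where I: "I \<in> U" "d ` I = lists (carrier S)"
    using small_index[OF small_lists[OF Mods_small[OF S]]] by blast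
  let ?T = "\<lambda>i. S\<lparr>carrier := generated R S (set (d i))\<rparr>"
  obtain i y where i: "i \<in> I" and y: "y \<in> carrier (obj M (?T i))" "arr M (?T i) S (\<lambda>x. x) y = x"
    using surj[OF I(1) limit_of_generated_submodules[OF S I(2)]] x
    unfolding limit_surjective_def by blast
  have di: "set (d i) \<subseteq> carrier S" using i I(2) by blast
  have T: "?T i \<in> Mods U R" using S di by (rule fg_submodule_Mods)
  have incl: "(\<lambda>x. x) \<in> lin R (?T i) S"
    using is_direct_limit_iff[THEN iffD1, OF limit_of_generated_submodules[OF S I(2)]] i by blast
  obtain n \<phi> where \<phi>: "\<phi> \<in> lin R (free_module n) (?T i)"
    "\<phi> ` carrier (free_module n) = generated R S (set (d i))"
    using generated_cover[OF S di] by blast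
  obtain J e where J: "J \<in> U" "e ` J = lists {x \<in> carrier (free_module n). \<phi> x = \<zero>\<^bsub>?T i\<^esub>}"
  proof (rule small_index[OF small_lists])
    show "small U {x \<in> carrier (free_module n). \<phi> x = \<zero>\<^bsub>?T i\<^esub>}"
      using Mods_small[OF free_Mods] by (rule small_subset) auto
  qed
  let ?Q = "\<lambda>j. quotient_module (free_module n) (generated R (free_module n) (set (e j)))"
  have lim: "is_direct_limit U R J (\<lambda>i j. set (e i) \<subseteq> set (e j)) ?Q
      (\<lambda>i j. rep (free_module n) (generated R (free_module n) (set (e j)))) (?T i) (\<lambda>i. \<phi>)"
    using \<phi> by (intro limit_of_quotients[OF free_Mods T _ _ J(2)]) simp_all
  then obtain j a where j: "j \<in> J" and a: "a \<in> carrier (obj M (?Q j))" "arr M (?Q j) (?T i) \<phi> a = y"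
    using surj[OF J(1) lim] y(1) unfolding limit_surjective_def by blast
  have "e j \<in> lists (carrier (free_module n))" using j J(2) by auto
  then have A: "?Q j \<in> presented_modules" unfolding presented_modules_def by blast
  have Q: "?Q j \<in> Mods U R" and \<phi>Q: "\<phi> \<in> lin R (?Q j) (?T i)"
    using lim j unfolding is_direct_limit_iff direct_system_def by blast+
  have "arr M (?Q j) S ((\<lambda>x. x) \<circ> \<phi>) a = x"
    using arr_comp[OF Q T S \<phi>Q incl a(1)] a(2) y(2) by simp
  then show ?thesis using A a(1) lin_comp[OF \<phi>Q incl] by blast
qed

text \<open>The image in \<open>M S\<close> of the natural map \<open>Hom(A, -) \<rightarrow> M\<close> that corresponds to \<open>a \<in> M A\<close> by the Yoneda lemma.\<close>

definition orbit :: "('u, 'u) module \<Rightarrow> 'u \<Rightarrow> ('u, 'u) module \<Rightarrow> 'u set"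
  where "orbit A a S = (\<lambda>g. arr M A S g a) ` lin R A S"

lemma orbit_subfunctor:
  assumes A: "A \<in> Mods U R" and a: "a \<in> carrier (obj M A)"
  shows "functor_with_subfunctor U R M (orbit A a)"
proof (intro functor_with_subfunctor.intro functor_with_subfunctor_axioms.intro additive_functor_axioms)
  fix S assume S: "S \<in> Mods U R"
  interpret S: left_module R S using S by (rule Mods_module)
  interpret G: group "obj M S" using S by (rule obj_group)
  note zero = lin_zero_map[OF S.left_module_axioms] and uminus = lin_uminus_map[OF S.left_module_axioms]
    and plus = lin_add_map[OF S.left_module_axioms]
  show "subgroup (orbit A a S) (obj M S)"
  proof (rule G.subgroupI)
    show "orbit A a S \<subseteq> carrier (obj M S)"
      using arr_closed[OF A S _ a] by (auto simp: orbit_def)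
    show "orbit A a S \<noteq> {}" using zero by (auto simp: orbit_def)
    fix x assume "x \<in> orbit A a S"
    then obtain g where g: "g \<in> lin R A S" "x = arr M A S g a" by (auto simp: orbit_def)
    let ?g' = "\<lambda>z. \<ominus>\<^bsub>S\<^esub> g z"
    have sum: "(\<lambda>z. ?g' z \<oplus>\<^bsub>S\<^esub> g z) \<in> lin R A S" using uminus[OF g(1)] g(1) by (rule plus)
    have "arr M A S ?g' a \<otimes>\<^bsub>obj M S\<^esub> x = arr M A S (\<lambda>z. ?g' z \<oplus>\<^bsub>S\<^esub> g z) a"
      unfolding g(2) using arr_add[OF A S uminus[OF g(1)] g(1) a] by simp
    also have "\<dots> = arr M A S (\<lambda>z. \<zero>\<^bsub>S\<^esub>) a"
      using lin_closed[OF g(1)] by (intro arr_cong[OF A S sum zero _ a]) (simp add: S.M.l_neg)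
    also have "\<dots> = \<one>\<^bsub>obj M S\<^esub>" using A S a by (rule arr_zero)
    finally have "inv\<^bsub>obj M S\<^esub> x = arr M A S ?g' a"
      using arr_closed[OF A S uminus[OF g(1)] a] arr_closed[OF A S g(1) a] g(2)
      by (intro G.inv_equality) auto
    then show "inv\<^bsub>obj M S\<^esub> x \<in> orbit A a S" using uminus[OF g(1)] by (auto simp: orbit_def)
    fix y assume "y \<in> orbit A a S"
    then obtain h where h: "h \<in> lin R A S" "y = arr M A S h a" by (auto simp: orbit_def)
    have "x \<otimes>\<^bsub>obj M S\<^esub> y = arr M A S (\<lambda>z. g z \<oplus>\<^bsub>S\<^esub> h z) a"
      unfolding g(2) h(2) using arr_add[OF A S g(1) h(1) a] by simp
    then show "x \<otimes>\<^bsub>obj M S\<^esub> y \<in> orbit A a S" using plus[OF g(1) h(1)] by (auto simp: orbit_def)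
  qed
next
  fix S T f x assume S: "S \<in> Mods U R" and T: "T \<in> Mods U R" and f: "f \<in> lin R S T"
    and "x \<in> orbit A a S"
  then obtain g where g: "g \<in> lin R A S" "x = arr M A S g a" by (auto simp: orbit_def)
  then have "arr M S T f x = arr M A T (f \<circ> g) a" using arr_comp[OF A S T g(1) f a] by simp
  then show "arr M S T f x \<in> orbit A a T" using lin_comp[OF g(1) f] by (auto simp: orbit_def)
qed

text \<open>Surjectivity of the comparison maps is inherited from \<open>Hom(A, -)\<close>: maps into a direct limit factor through a
stage, as \<open>A\<close> is finitely presented, and families of maps into the factors combine to a map into
the product.\<close>

lemma orbit_FP:
  assumes mittag: "Mittag_Leffler_module U R M"
    and A: "finitely_presented A" and a: "a \<in> carrier (obj M A)"
  shows "FP_module U R (subfunctor M (orbit A a))"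
proof -
  note A' = finitely_presentedD[OF A]
  interpret functor_with_subfunctor U R M "orbit A a"
    using A'(1) a by (rule orbit_subfunctor)
  show ?thesis
  proof (rule subfunctor_FP[OF mittag])
    fix I leq S s L f y
    assume I: "I \<in> U" and lim: "module_limit U R I leq S s L f" and "y \<in> orbit A a L"
    interpret lim: module_limit U R I leq S s L f by (rule lim)
    obtain g where g: "g \<in> lin R A L" "y = arr M A L g a"
      using \<open>y \<in> orbit A a L\<close> by (auto simp: orbit_def)
    obtain i h where i: "i \<in> I" and h: "h \<in> lin R A (S i)" "\<forall>x\<in>carrier A. f i (h x) = g x"
      using A'(3)[OF I lim.limit g(1)] by blast
    have "arr M (S i) L (f i) (arr M A (S i) h a) = arr M A L (f i \<circ> h) a"
      using A'(1) lim.source[OF i] lim.target h(1) lim.leg[OF i] a by (rule arr_comp)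
    also have "\<dots> = y"
      unfolding g(2) using h(2)
      by (intro arr_cong[OF A'(1) lim.target lin_comp[OF h(1) lim.leg[OF i]] g(1) _ a]) simp
    finally show "\<exists>i\<in>I. \<exists>x\<in>orbit A a (S i). arr M (S i) L (f i) x = y"
      using i h(1) by (auto simp: orbit_def)
  next
    fix I S P p y
    assume I: "I \<in> U" and P: "is_product U R I S P p" and y: "\<And>i. i \<in> I \<Longrightarrow> y i \<in> orbit A a (S i)"
    have mods: "P \<in> Mods U R" "\<And>i. i \<in> I \<Longrightarrow> S i \<in> Mods U R" "\<And>i. i \<in> I \<Longrightarrow> p i \<in> lin R P (S i)"
      using P by (auto simp: is_product_def)
    have "\<exists>g. \<forall>i\<in>I. g i \<in> lin R A (S i) \<and> y i = arr M A (S i) (g i) a"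
      using y by (intro bchoice) (auto simp: orbit_def)
    then obtain g where g: "\<And>i. i \<in> I \<Longrightarrow> g i \<in> lin R A (S i)" "\<And>i. i \<in> I \<Longrightarrow> y i = arr M A (S i) (g i) a"
      by blast
    obtain h where h: "h \<in> lin R A P" "\<forall>i\<in>I. \<forall>x\<in>carrier A. p i (h x) = g i x"
      using product_lift[OF P A'(1) g(1)] by blast
    have "arr M P (S i) (p i) (arr M A P h a) = y i" if i: "i \<in> I" for i
    proof -
      have "arr M P (S i) (p i) (arr M A P h a) = arr M A (S i) (p i \<circ> h) a"
        using A'(1) mods(1) mods(2)[OF i] h(1) mods(3)[OF i] a by (rule arr_comp)
      also have "\<dots> = y i"
        unfolding g(2)[OF i] using h(2) i
        by (intro arr_cong[OF A'(1) mods(2)[OF i] lin_comp[OF h(1) mods(3)[OF i]] g(1)[OF i] _ a]) simp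
      finally show ?thesis .
    qed
    then show "\<exists>x\<in>orbit A a P. \<forall>i\<in>I. arr M P (S i) (p i) x = y i"
      using h(1) by (intro bexI[of _ "arr M A P h a"]) (auto simp: orbit_def)
  qed
qed

lemma orbit_mono:
  assumes A: "A \<in> Mods U R" and a: "a \<in> carrier (obj M A)" and B: "B \<in> Mods U R" and S: "S \<in> Mods U R"
    and "b \<in> orbit A a B"
  shows "orbit B b S \<subseteq> orbit A a S"
proof -
  interpret functor_with_subfunctor U R M "orbit A a" using A a by (rule orbit_subfunctor)
  show ?thesis using stable[OF B S] assms(5) by (auto simp: orbit_def[of B])
qed

text \<open>Both images lie in that of the element \<open>c = a + b\<close> of \<open>M (A \<oplus> B)\<close>, since the projections of the biproduct
carry \<open>c\<close> back to \<open>a\<close> and \<open>b\<close>. The biproduct need not belong to the chosen small set of modules,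
but \<open>c\<close> comes from a member \<open>E\<close> of it.\<close>

lemma orbits_directed:
  assumes limits: "preserves_direct_limits U R M"
    and A: "A \<in> Mods U R" "a \<in> carrier (obj M A)" and B: "B \<in> Mods U R" "b \<in> carrier (obj M B)"
  shows "\<exists>E\<in>presented_modules. \<exists>e\<in>carrier (obj M E).
    (\<forall>S\<in>Mods U R. orbit A a S \<subseteq> orbit E e S) \<and> (\<forall>S\<in>Mods U R. orbit B b S \<subseteq> orbit E e S)"
proof -
  let ?D = "biproduct A B"
  have D: "?D \<in> Mods U R" using A(1) B(1) by (rule biproduct_Mods)
  interpret A: left_module R A using A(1) by (rule Mods_module)
  interpret B: left_module R B using B(1) by (rule Mods_module)
  interpret GA: group "obj M A" using A(1) by (rule obj_group)
  interpret GB: group "obj M B" using B(1) by (rule obj_group)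
  interpret GD: group "obj M ?D" using D by (rule obj_group)
  let ?i1 = "\<lambda>a. pair (a, \<zero>\<^bsub>B\<^esub>)" and ?i2 = "\<lambda>b. pair (\<zero>\<^bsub>A\<^esub>, b)"
  note lin = inj1_lin[OF B(1), of A] inj2_lin[OF A(1), of B]
  define c where "c = arr M A ?D ?i1 a \<otimes>\<^bsub>obj M ?D\<^esub> arr M B ?D ?i2 b"
  have ab: "arr M A ?D ?i1 a \<in> carrier (obj M ?D)" "arr M B ?D ?i2 b \<in> carrier (obj M ?D)"
    using arr_closed[OF A(1) D lin(1) A(2)] arr_closed[OF B(1) D lin(2) B(2)] by auto
  then have c: "c \<in> carrier (obj M ?D)" by (simp add: c_def)
  have "arr M ?D A proj1 c = arr M A A (proj1 \<circ> ?i1) a \<otimes>\<^bsub>obj M A\<^esub> arr M B A (proj1 \<circ> ?i2) b"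
    unfolding c_def using arr_mult[OF D A(1) proj1_lin ab]
      arr_comp[OF A(1) D A(1) lin(1) proj1_lin A(2)] arr_comp[OF B(1) D A(1) lin(2) proj1_lin B(2)]
    by simp
  also have "\<dots> = a"
    using arr_ident[OF A] arr_zero[OF B(1) A(1) B(2)] A(2) by (simp add: comp_def)
  finally have a: "a \<in> orbit ?D c A" using proj1_lin by (auto simp: orbit_def)
  have "arr M ?D B proj2 c = arr M A B (proj2 \<circ> ?i1) a \<otimes>\<^bsub>obj M B\<^esub> arr M B B (proj2 \<circ> ?i2) b"
    unfolding c_def using arr_mult[OF D B(1) proj2_lin ab]
      arr_comp[OF A(1) D B(1) lin(1) proj2_lin A(2)] arr_comp[OF B(1) D B(1) lin(2) proj2_lin B(2)]
    by simp
  also have "\<dots> = b"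
    using arr_ident[OF B] arr_zero[OF A(1) B(1) A(2)] B(2) by (simp add: comp_def)
  finally have b: "b \<in> orbit ?D c B" using proj2_lin by (auto simp: orbit_def)
  obtain E e where E: "E \<in> presented_modules" "e \<in> carrier (obj M E)" and "c \<in> orbit E e ?D"
    using element_from_presented[OF limits D c] by (auto simp: orbit_def)
  moreover have "E \<in> Mods U R"
    using presented_modules_finitely_presented[OF E(1)] by (rule finitely_presentedD)
  ultimately have "orbit ?D c S \<subseteq> orbit E e S" if "S \<in> Mods U R" for S
    using orbit_mono[OF _ _ D that] by blast
  moreover have "orbit A a S \<subseteq> orbit ?D c S" "orbit B b S \<subseteq> orbit ?D c S" if "S \<in> Mods U R" for S
    using orbit_mono[OF D c A(1) that a] orbit_mono[OF D c B(1) that b] by auto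
  ultimately show ?thesis using E by blast
qed

end

section \<open>Representable functors\<close>

text \<open>The values of a functor are groups on subsets of \<open>'u\<close>. Since \<open>Hom(A, T)\<close> is small, its elements can be
coded in \<open>'u\<close>, by a coding chosen for each \<open>T\<close>; only the values on the carrier of \<open>A\<close> are
coded, so linear maps that agree there have equal codes.\<close>

locale presented_module = module_universe U R
  for U :: "'u set set" and R :: "'u ring" +
  fixes A :: "('u, 'u) module"
  assumes finitely_presented: "finitely_presented A"
begin

lemmas presented = finitely_presentedD[OF finitely_presented]

definition code :: "('u, 'u) module \<Rightarrow> ('u \<Rightarrow> 'u) \<Rightarrow> 'u"
  where "code T = (SOME e. inj_on e (homs A T) \<and> e ` homs A T \<in> U)"

definition enc :: "('u, 'u) module \<Rightarrow> ('u \<Rightarrow> 'u) \<Rightarrow> 'u"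
  where "enc T g = code T (restrict g (carrier A))"

definition dec :: "('u, 'u) module \<Rightarrow> 'u \<Rightarrow> 'u \<Rightarrow> 'u"
  where "dec T = inv_into (homs A T) (code T)"

definition hom_functor :: "('u, 'u) rfunctor"
  where "hom_functor =
    \<lparr>obj = (\<lambda>T. \<lparr>carrier = enc T ` lin R A T,
        monoid.mult = (\<lambda>c d. enc T (\<lambda>x. dec T c x \<oplus>\<^bsub>T\<^esub> dec T d x)), one = enc T (\<lambda>x. \<zero>\<^bsub>T\<^esub>)\<rparr>),
      arr = (\<lambda>T V f c. enc V (f \<circ> dec T c))\<rparr>"

lemma code:
  assumes "T \<in> Mods U R"
  shows "inj_on (code T) (homs A T)" and "code T ` homs A T \<in> U"
  using someI_ex[OF small_encoding[OF presented(2)[OF assms]]] by (simp_all add: code_def)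

lemma dec_enc:
  assumes T: "T \<in> Mods U R" and "g \<in> lin R A T"
  shows "dec T (enc T g) = restrict g (carrier A)"
  using assms(2) code(1)[OF T] unfolding dec_def enc_def
  by (intro inv_into_f_f) (auto simp: homs_def)

lemma enc_cong: "(\<And>x. x \<in> carrier A \<Longrightarrow> g x = h x) \<Longrightarrow> enc T g = enc T h"
  unfolding enc_def by (metis restrict_ext)

lemma enc_eqD:
  assumes T: "T \<in> Mods U R" and "g \<in> lin R A T" and "h \<in> lin R A T"
    and "enc T g = enc T h" and "x \<in> carrier A"
  shows "g x = h x"
  using dec_enc[OF T assms(2)] dec_enc[OF T assms(3)] assms(4,5) by (metis restrict_apply')

lemma hom_functor_carrier: "c \<in> carrier (obj hom_functor T) \<longleftrightarrow> (\<exists>g\<in>lin R A T. c = enc T g)"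
  by (auto simp: hom_functor_def)

lemma hom_functor_mult:
  assumes "T \<in> Mods U R" and "g \<in> lin R A T" and "h \<in> lin R A T"
  shows "enc T g \<otimes>\<^bsub>obj hom_functor T\<^esub> enc T h = enc T (\<lambda>x. g x \<oplus>\<^bsub>T\<^esub> h x)"
  using assms by (simp add: hom_functor_def dec_enc cong: enc_cong)

lemma hom_functor_one: "\<one>\<^bsub>obj hom_functor T\<^esub> = enc T (\<lambda>x. \<zero>\<^bsub>T\<^esub>)"
  by (simp add: hom_functor_def)

lemma hom_functor_arr:
  assumes "T \<in> Mods U R" and "g \<in> lin R A T"
  shows "arr hom_functor T V f (enc T g) = enc V (f \<circ> g)"
  using assms by (simp add: hom_functor_def dec_enc cong: enc_cong)

lemma hom_functor_comm_group:
  assumes T: "T \<in> Mods U R"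
  shows "comm_group (obj hom_functor T)"
proof -
  interpret T: left_module R T using T by (rule Mods_module)
  note plus = lin_add_map[OF T.left_module_axioms] and uminus = lin_uminus_map[OF T.left_module_axioms]
    and zero = lin_zero_map[OF T.left_module_axioms] and mult = hom_functor_mult[OF T]
  show ?thesis
  proof (rule comm_groupI)
    show "\<one>\<^bsub>obj hom_functor T\<^esub> \<in> carrier (obj hom_functor T)"
      unfolding hom_functor_carrier hom_functor_one using zero by blast
    fix c assume "c \<in> carrier (obj hom_functor T)"
    then obtain g where g: "g \<in> lin R A T" "c = enc T g" unfolding hom_functor_carrier by blast
    show "\<one>\<^bsub>obj hom_functor T\<^esub> \<otimes>\<^bsub>obj hom_functor T\<^esub> c = c"
      unfolding g(2) hom_functor_one mult[OF zero g(1)]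
      using lin_closed[OF g(1)] by (intro enc_cong) simp
    have "enc T (\<lambda>x. \<ominus>\<^bsub>T\<^esub> g x) \<otimes>\<^bsub>obj hom_functor T\<^esub> c = \<one>\<^bsub>obj hom_functor T\<^esub>"
      unfolding g(2) hom_functor_one mult[OF uminus[OF g(1)] g(1)]
      using lin_closed[OF g(1)] by (intro enc_cong) (simp add: T.M.l_neg)
    then show "\<exists>d\<in>carrier (obj hom_functor T). d \<otimes>\<^bsub>obj hom_functor T\<^esub> c = \<one>\<^bsub>obj hom_functor T\<^esub>"
      using uminus[OF g(1)]
      by (intro bexI[of _ "enc T (\<lambda>x. \<ominus>\<^bsub>T\<^esub> g x)"]) (auto simp: hom_functor_carrier)
    fix d assume "d \<in> carrier (obj hom_functor T)"
    then obtain h where h: "h \<in> lin R A T" "d = enc T h" unfolding hom_functor_carrier by blast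
    show "c \<otimes>\<^bsub>obj hom_functor T\<^esub> d \<in> carrier (obj hom_functor T)"
      unfolding g(2) h(2) mult[OF g(1) h(1)] hom_functor_carrier using plus[OF g(1) h(1)] by blast
    show "c \<otimes>\<^bsub>obj hom_functor T\<^esub> d = d \<otimes>\<^bsub>obj hom_functor T\<^esub> c"
      unfolding g(2) h(2) mult[OF g(1) h(1)] mult[OF h(1) g(1)]
      using lin_closed[OF g(1)] lin_closed[OF h(1)] by (intro enc_cong) (simp add: T.M.a_comm)
    fix e assume "e \<in> carrier (obj hom_functor T)"
    then obtain k where k: "k \<in> lin R A T" "e = enc T k" unfolding hom_functor_carrier by blast
    show "c \<otimes>\<^bsub>obj hom_functor T\<^esub> d \<otimes>\<^bsub>obj hom_functor T\<^esub> e =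
        c \<otimes>\<^bsub>obj hom_functor T\<^esub> (d \<otimes>\<^bsub>obj hom_functor T\<^esub> e)"
      unfolding g(2) h(2) k(2) mult[OF g(1) h(1)] mult[OF h(1) k(1)]
        mult[OF plus[OF g(1) h(1)] k(1)] mult[OF g(1) plus[OF h(1) k(1)]]
      using lin_closed[OF g(1)] lin_closed[OF h(1)] lin_closed[OF k(1)]
      by (intro enc_cong) (simp add: T.M.a_assoc)
  qed
qed

lemma hom_functor_rmodule: "rmodule U R hom_functor"
  unfolding rmodule_def
proof (intro conjI ballI impI)
  fix S assume S: "S \<in> Mods U R"
  show "comm_group (obj hom_functor S)" using S by (rule hom_functor_comm_group)
  have "carrier (obj hom_functor S) = code S ` homs A S"
    by (simp add: hom_functor_def homs_def enc_def image_image)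
  then show "carrier (obj hom_functor S) \<in> U" using code(2)[OF S] by simp
  show "arr hom_functor S S (\<lambda>x. x) c = c" if c: "c \<in> carrier (obj hom_functor S)" for c
  proof -
    obtain g where g: "g \<in> lin R A S" "c = enc S g" using c unfolding hom_functor_carrier by blast
    show ?thesis unfolding g(2) hom_functor_arr[OF S g(1)] by (simp add: comp_def)
  qed
  fix T assume T: "T \<in> Mods U R"
  {
    fix f assume f: "f \<in> lin R S T"
    show "arr hom_functor S T f \<in> hom (obj hom_functor S) (obj hom_functor T)"
    proof (rule homI)
      fix c assume "c \<in> carrier (obj hom_functor S)"
      then obtain g where g: "g \<in> lin R A S" "c = enc S g" unfolding hom_functor_carrier by blast
      show "arr hom_functor S T f c \<in> carrier (obj hom_functor T)"
        unfolding g(2) hom_functor_arr[OF S g(1)] hom_functor_carrier using lin_comp[OF g(1) f] by blast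
      fix d assume "d \<in> carrier (obj hom_functor S)"
      then obtain h where h: "h \<in> lin R A S" "d = enc S h" unfolding hom_functor_carrier by blast
      have plus: "(\<lambda>x. g x \<oplus>\<^bsub>S\<^esub> h x) \<in> lin R A S" using Mods_module[OF S] g(1) h(1) by (rule lin_add_map)
      show "arr hom_functor S T f (c \<otimes>\<^bsub>obj hom_functor S\<^esub> d) =
          arr hom_functor S T f c \<otimes>\<^bsub>obj hom_functor T\<^esub> arr hom_functor S T f d"
        unfolding g(2) h(2) hom_functor_mult[OF S g(1) h(1)] hom_functor_arr[OF S g(1)]
          hom_functor_arr[OF S h(1)] hom_functor_arr[OF S plus]
          hom_functor_mult[OF T lin_comp[OF g(1) f] lin_comp[OF h(1) f]]
        by (intro enc_cong) (simp add: lin_add[OF f] lin_closed[OF g(1)] lin_closed[OF h(1)])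
    qed
    show "arr hom_functor S T f c = arr hom_functor S T f' c"
      if "\<forall>x\<in>carrier S. f x = f' x" and c: "c \<in> carrier (obj hom_functor S)" for f' c
    proof -
      obtain g where g: "g \<in> lin R A S" "c = enc S g" using c unfolding hom_functor_carrier by blast
      show ?thesis
        unfolding g(2) hom_functor_arr[OF S g(1)]
        using that(1) lin_closed[OF g(1)] by (intro enc_cong) simp
    qed
    show "arr hom_functor S T (\<lambda>x. f x \<oplus>\<^bsub>T\<^esub> f' x) c =
        arr hom_functor S T f c \<otimes>\<^bsub>obj hom_functor T\<^esub> arr hom_functor S T f' c"
      if f': "f' \<in> lin R S T" and c: "c \<in> carrier (obj hom_functor S)" for f' c
    proof -
      obtain g where g: "g \<in> lin R A S" "c = enc S g" using c unfolding hom_functor_carrier by blast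
      show ?thesis
        unfolding g(2) hom_functor_arr[OF S g(1)]
          hom_functor_mult[OF T lin_comp[OF g(1) f] lin_comp[OF g(1) f']]
        by (simp add: comp_def)
    qed
    show "arr hom_functor S V (f' \<circ> f) c = arr hom_functor T V f' (arr hom_functor S T f c)"
      if c: "c \<in> carrier (obj hom_functor S)" for V f' c
    proof -
      obtain g where g: "g \<in> lin R A S" "c = enc S g" using c unfolding hom_functor_carrier by blast
      show ?thesis
        unfolding g(2) hom_functor_arr[OF S g(1)] hom_functor_arr[OF T lin_comp[OF g(1) f]]
        by (simp add: comp_assoc)
    qed
  }
qed

sublocale hom: additive_functor U R hom_functor
  by unfold_locales (rule hom_functor_rmodule)

text \<open>For direct limits this is the definition of finite presentation, for products their universal property.\<close>

lemma hom_functor_FP: "FP_module U R hom_functor"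
  unfolding hom.FP_iff hom.Mittag_Leffler_iff hom.preserves_direct_limits_iff
proof (intro conjI ballI allI impI)
  fix I and leq :: "'u \<Rightarrow> 'u \<Rightarrow> bool" and S s L f assume I: "I \<in> U" and "module_limit U R I leq S s L f"
  then interpret lim: module_limit U R I leq S s L f by simp
  show "limit_surjective hom_functor I S L f"
    unfolding limit_surjective_def
  proof
    fix c assume "c \<in> carrier (obj hom_functor L)"
    then obtain g where g: "g \<in> lin R A L" "c = enc L g" unfolding hom_functor_carrier by blast
    obtain i h where i: "i \<in> I" and h: "h \<in> lin R A (S i)" "\<forall>x\<in>carrier A. f i (h x) = g x"
      using presented(3)[OF I lim.limit g(1)] by blast
    have "arr hom_functor (S i) L (f i) (enc (S i) h) = c"
      unfolding hom_functor_arr[OF lim.source[OF i] h(1)] g(2) using h(2) by (intro enc_cong) simp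
    then show "\<exists>i\<in>I. \<exists>x\<in>carrier (obj hom_functor (S i)). arr hom_functor (S i) L (f i) x = c"
      using i h(1) hom_functor_carrier by blast
  qed
  show "limit_injective hom_functor I leq S s L f"
    unfolding limit_injective_def
  proof (intro ballI impI)
    fix i c assume i: "i \<in> I" and "c \<in> carrier (obj hom_functor (S i))"
      and one: "arr hom_functor (S i) L (f i) c = \<one>\<^bsub>obj hom_functor L\<^esub>"
    then obtain h where h: "h \<in> lin R A (S i)" "c = enc (S i) h" unfolding hom_functor_carrier by blast
    have "(f i \<circ> h) x = \<zero>\<^bsub>L\<^esub>" if "x \<in> carrier A" for x
      using one that unfolding h(2) hom_functor_arr[OF lim.source[OF i] h(1)] hom_functor_one
      by (rule enc_eqD[OF lim.target lin_comp[OF h(1) lim.leg[OF i]] lin_zero_map[OF Mods_module[OF lim.target]]])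
    then obtain j where j: "j \<in> I" "leq i j" "\<forall>x\<in>carrier A. s i j (h x) = \<zero>\<^bsub>S j\<^esub>"
      using presented(4)[OF I lim.limit i h(1)] by auto
    have "arr hom_functor (S i) (S j) (s i j) c = \<one>\<^bsub>obj hom_functor (S j)\<^esub>"
      unfolding h(2) hom_functor_arr[OF lim.source[OF i] h(1)] hom_functor_one
      using j(3) by (intro enc_cong) simp
    then show "\<exists>j\<in>I. leq i j \<and> arr hom_functor (S i) (S j) (s i j) c = \<one>\<^bsub>obj hom_functor (S j)\<^esub>"
      using j by blast
  qed
next
  fix I :: "'u set" and S P p assume P: "is_product U R I S P p"
  then have mods: "P \<in> Mods U R" "\<And>i. i \<in> I \<Longrightarrow> S i \<in> Mods U R" "\<And>i. i \<in> I \<Longrightarrow> p i \<in> lin R P (S i)"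
    by (auto simp: is_product_def)
  interpret P: left_module R P using mods(1) by (rule Mods_module)
  show "product_injective hom_functor I S P p"
    unfolding product_injective_def
  proof (intro ballI impI)
    fix c assume "c \<in> carrier (obj hom_functor P)"
      and one: "\<forall>i\<in>I. arr hom_functor P (S i) (p i) c = \<one>\<^bsub>obj hom_functor (S i)\<^esub>"
    then obtain g where g: "g \<in> lin R A P" "c = enc P g" unfolding hom_functor_carrier by blast
    have "p i (g x) = p i \<zero>\<^bsub>P\<^esub>" if i: "i \<in> I" and x: "x \<in> carrier A" for i x
    proof -
      have "(p i \<circ> g) x = \<zero>\<^bsub>S i\<^esub>"
      proof (rule enc_eqD[OF mods(2)[OF i] lin_comp[OF g(1) mods(3)[OF i]]
            lin_zero_map[OF Mods_module[OF mods(2)[OF i]]] _ x])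
        show "enc (S i) (p i \<circ> g) = enc (S i) (\<lambda>x. \<zero>\<^bsub>S i\<^esub>)"
          using one i unfolding g(2) hom_functor_arr[OF mods(1) g(1)] hom_functor_one by blast
      qed
      then show ?thesis
        using lin_zero[OF P.left_module_axioms Mods_module[OF mods(2)[OF i]] mods(3)[OF i]] by simp
    qed
    then have "g x = \<zero>\<^bsub>P\<^esub>" if "x \<in> carrier A" for x
      using that by (intro product_separates[OF P lin_closed[OF g(1)] P.zero_closed])
    then show "c = \<one>\<^bsub>obj hom_functor P\<^esub>"
      unfolding g(2) hom_functor_one by (rule enc_cong)
  qed
  show "product_surjective hom_functor I S P p"
    unfolding product_surjective_def
  proof (intro allI impI)
    fix c assume "\<forall>i\<in>I. c i \<in> carrier (obj hom_functor (S i))"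
    then have "\<exists>g. \<forall>i\<in>I. g i \<in> lin R A (S i) \<and> c i = enc (S i) (g i)"
      unfolding hom_functor_carrier by (intro bchoice) blast
    then obtain g where g: "\<And>i. i \<in> I \<Longrightarrow> g i \<in> lin R A (S i)" "\<And>i. i \<in> I \<Longrightarrow> c i = enc (S i) (g i)"
      by blast
    obtain h where h: "h \<in> lin R A P" "\<forall>i\<in>I. \<forall>x\<in>carrier A. p i (h x) = g i x"
      using product_lift[OF P presented(1) g(1)] by blast
    have "arr hom_functor P (S i) (p i) (enc P h) = c i" if "i \<in> I" for i
      unfolding hom_functor_arr[OF mods(1) h(1)] g(2)[OF that]
      using h(2) that by (intro enc_cong) simp
    then show "\<exists>x\<in>carrier (obj hom_functor P). \<forall>i\<in>I. arr hom_functor P (S i) (p i) x = c i"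
      using h(1) hom_functor_carrier by blast
  qed
qed

text \<open>The natural map \<open>Hom(A, -) \<rightarrow> M\<close>, \<open>g \<mapsto> M g a\<close>.\<close>

definition yoneda :: "('u, 'u) rfunctor \<Rightarrow> 'u \<Rightarrow> ('u, 'u) module \<Rightarrow> 'u \<Rightarrow> 'u"
  where "yoneda M a T c = arr M A T (dec T c) a"

lemma yoneda_enc:
  assumes "additive_functor U R M" and a: "a \<in> carrier (obj M A)" and T: "T \<in> Mods U R" and g: "g \<in> lin R A T"
  shows "yoneda M a T (enc T g) = arr M A T g a"
proof -
  interpret M: additive_functor U R M by fact
  have "left_module R A" using presented(1) by (rule Mods_module)
  then show ?thesis
    unfolding yoneda_def dec_enc[OF T g]
    by (intro M.arr_cong presented(1) T lin_restrict g a) simp_all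
qed

lemma yoneda_rmorphism:
  assumes M: "additive_functor U R M" and a: "a \<in> carrier (obj M A)"
  shows "rmorphism U R hom_functor M (yoneda M a)"
proof -
  interpret M: additive_functor U R M by (rule M)
  note enc = yoneda_enc[OF M a]
  show ?thesis
    unfolding rmorphism_def
  proof (intro conjI ballI)
    fix S assume S: "S \<in> Mods U R"
    show "yoneda M a S \<in> hom (obj hom_functor S) (obj M S)"
    proof (rule homI)
      fix c assume "c \<in> carrier (obj hom_functor S)"
      then obtain g where g: "g \<in> lin R A S" "c = enc S g" unfolding hom_functor_carrier by blast
      show "yoneda M a S c \<in> carrier (obj M S)"
        unfolding g(2) enc[OF S g(1)] using presented(1) S g(1) a by (rule M.arr_closed)
      fix d assume "d \<in> carrier (obj hom_functor S)"
      then obtain h where h: "h \<in> lin R A S" "d = enc S h" unfolding hom_functor_carrier by blast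
      have plus: "(\<lambda>x. g x \<oplus>\<^bsub>S\<^esub> h x) \<in> lin R A S" using Mods_module[OF S] g(1) h(1) by (rule lin_add_map)
      show "yoneda M a S (c \<otimes>\<^bsub>obj hom_functor S\<^esub> d) = yoneda M a S c \<otimes>\<^bsub>obj M S\<^esub> yoneda M a S d"
        unfolding g(2) h(2) hom_functor_mult[OF S g(1) h(1)] enc[OF S g(1)] enc[OF S h(1)] enc[OF S plus]
        using presented(1) S g(1) h(1) a by (rule M.arr_add)
    qed
    fix T f c assume T: "T \<in> Mods U R" and f: "f \<in> lin R S T" and "c \<in> carrier (obj hom_functor S)"
    then obtain g where g: "g \<in> lin R A S" "c = enc S g" unfolding hom_functor_carrier by blast
    show "yoneda M a T (arr hom_functor S T f c) = arr M S T f (yoneda M a S c)"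
      unfolding g(2) hom_functor_arr[OF S g(1)] enc[OF S g(1)] enc[OF T lin_comp[OF g(1) f]]
      using M.arr_comp[OF presented(1) S T g(1) f a] by simp
  qed
qed

end

section \<open>Characterisations of Mittag-Leffler modules\<close>

context additive_functor
begin

text \<open>The inclusions are injective, so only surjectivity is a condition.\<close>

lemma submodule_system_iso_iff:
  assumes dir: "directed_set I leq" and sub: "\<forall>i\<in>I. rsubmodule U R (F i) M"
    and incl: "\<forall>i\<in>I. \<forall>j\<in>I. leq i j \<longrightarrow> rsubmodule U R (F i) (F j)" and S: "S \<in> Mods U R"
  shows "limit_map (\<lambda>i x. x) \<in> iso (direct_limit I leq (\<lambda>i. obj (F i) S) (\<lambda>i j x. x)) (obj M S) \<longleftrightarrow>
    carrier (obj M S) \<subseteq> (\<Union>i\<in>I. carrier (obj (F i) S))"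
proof -
  have F: "additive_functor U R (F i)" if "i \<in> I" for i
    using sub that by (intro additive_functor.intro module_universe_axioms additive_functor_axioms.intro)
      (simp add: rsubmodule_def)
  have F_M: "(\<lambda>x. x) \<in> hom (obj (F i) S) (obj M S)" if "i \<in> I" for i
    using sub that S unfolding rsubmodule_def rmorphism_def by blast
  have F_F: "(\<lambda>x. x) \<in> hom (obj (F i) S) (obj (F j) S)" if "i \<in> I" "j \<in> I" "leq i j" for i j
    using incl that S unfolding rsubmodule_def rmorphism_def by blast
  interpret group_cocone I leq "\<lambda>i. obj (F i) S" "\<lambda>i j x. x" "obj M S" "\<lambda>i x. x"
    by (rule group_cocone.intro)
      (simp_all add: dir F_M F_F additive_functor.obj_group[OF F] S obj_group)
  have "x = \<one>\<^bsub>obj (F i) S\<^esub>" if "i \<in> I" "x = \<one>\<^bsub>obj M S\<^esub>" for i x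
    using hom_one[OF F_M additive_functor.obj_group[OF F] obj_group] that S by simp
  then show ?thesis unfolding limit_iso_iff using leq_refl by blast
qed

text \<open>The submodules are the images of \<open>Hom(A, -)\<close> for all \<open>a \<in> M A\<close>, with \<open>A\<close> in the small set
\<open>presented_modules\<close>, ordered by inclusion.\<close>

lemma Mittag_Leffler_imp_limit_of_FP:
  assumes mittag: "Mittag_Leffler_module U R M"
  shows "direct_limit_of_FP_submodules U R M"
proof -
  have limits: "preserves_direct_limits U R M" using mittag by (simp add: Mittag_Leffler_iff)
  note fp = presented_modules_finitely_presented and mods = presented_modules_finitely_presented[THEN finitely_presentedD(1)]
  \<comment> \<open>An index is a code of a pair \<open>(A, a)\<close> with \<open>a \<in> M A\<close>.\<close>
  define G where "G = Sigma presented_modules (\<lambda>A. carrier (obj M A))"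
  have "small U G"
    unfolding G_def by (intro small_Sigma small_presented_modules small_mem obj_small mods)
  then obtain I d where I: "I \<in> U" "d ` I = G" by (rule small_index)
  define C where "C i = orbit (fst (d i)) (snd (d i))" for i
  define leq where "leq i j \<longleftrightarrow> (\<forall>S\<in>Mods U R. C i S \<subseteq> C j S)" for i j
  have dI: "fst (d i) \<in> presented_modules" "snd (d i) \<in> carrier (obj M (fst (d i)))" if "i \<in> I" for i
  proof -
    have "d i \<in> G" using that I(2) by blast
    then show "fst (d i) \<in> presented_modules" "snd (d i) \<in> carrier (obj M (fst (d i)))"
      by (auto simp: G_def)
  qed
  have index: "\<exists>i\<in>I. C i = orbit A a" if "A \<in> presented_modules" "a \<in> carrier (obj M A)" for A a
  proof -
    have "(A, a) \<in> d ` I" using that by (simp add: I(2) G_def)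
    then show ?thesis unfolding C_def by (metis fst_conv imageE snd_conv)
  qed
  have C: "functor_with_subfunctor U R M (C i)" if "i \<in> I" for i
    unfolding C_def using dI[OF that] by (intro orbit_subfunctor mods)
  have source: "\<exists>i\<in>I. x \<in> C i S" if "S \<in> Mods U R" "x \<in> carrier (obj M S)" for S x
    using element_from_presented[OF limits that] index by (metis image_eqI orbit_def)
  have dir: "directed_set I leq"
    unfolding directed_set_def
  proof (intro conjI ballI)
    show "reflp_on I leq" "transp_on I leq"
      unfolding reflp_on_def transp_on_def leq_def by blast+
    have "\<one>\<^bsub>obj M zero_module\<^esub> \<in> carrier (obj M zero_module)"
      using obj_group[OF zero_module_Mods] by (rule group.is_monoid[THEN monoid.one_closed])
    then show "I \<noteq> {}" using source[OF zero_module_Mods] by blast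
    fix i j assume i: "i \<in> I" and j: "j \<in> I"
    obtain E e where "E \<in> presented_modules" "e \<in> carrier (obj M E)"
      and "\<forall>S\<in>Mods U R. C i S \<subseteq> orbit E e S" "\<forall>S\<in>Mods U R. C j S \<subseteq> orbit E e S"
      using orbits_directed[OF limits mods[OF dI(1)] dI(2) mods[OF dI(1)] dI(2), OF i i j j]
      unfolding C_def by blast
    moreover from this obtain k where "k \<in> I" "C k = orbit E e" using index by blast
    ultimately show "\<exists>k\<in>I. leq i k \<and> leq j k" unfolding leq_def by (intro bexI[of _ k]) auto
  qed
  have sub: "\<forall>i\<in>I. rsubmodule U R (subfunctor M (C i)) M"
    using functor_with_subfunctor.rsubmodule_subfunctor[OF C] by blast
  have incl: "\<forall>i\<in>I. \<forall>j\<in>I. leq i j \<longrightarrow> rsubmodule U R (subfunctor M (C i)) (subfunctor M (C j))"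
    using functor_with_subfunctor.rsubmodule_subfunctors[OF C C] by (simp add: leq_def)
  have "\<forall>i\<in>I. FP_module U R (subfunctor M (C i))"
    unfolding C_def using dI by (intro ballI orbit_FP[OF mittag] fp)
  moreover have "limit_map (\<lambda>i x. x) \<in>
      iso (direct_limit I leq (\<lambda>i. obj (subfunctor M (C i)) S) (\<lambda>i j x. x)) (obj M S)"
    if S: "S \<in> Mods U R" for S
    unfolding submodule_system_iso_iff[OF dir sub incl S] using source[OF S] by auto
  ultimately show ?thesis
    unfolding direct_limit_of_FP_submodules_def using I(1) dir sub incl
    by (intro bexI[of _ I] exI[of _ leq] exI[of _ "\<lambda>i. subfunctor M (C i)"] conjI) auto
qed

text \<open>An element with trivial components lies in some \<open>F i\<close>, and its components are then trivial in \<open>F i\<close>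
already, which preserves products.\<close>

lemma limit_of_FP_imp_Mittag_Leffler:
  assumes limits: "preserves_direct_limits U R M" and "direct_limit_of_FP_submodules U R M"
  shows "Mittag_Leffler_module U R M"
proof -
  obtain I :: "'u set" and leq F where dir: "directed_set I leq"
    and sub_FP: "\<forall>i\<in>I. rsubmodule U R (F i) M \<and> FP_module U R (F i)"
    and incl: "\<forall>i\<in>I. \<forall>j\<in>I. leq i j \<longrightarrow> rsubmodule U R (F i) (F j)"
    and iso: "\<forall>S\<in>Mods U R.
        limit_map (\<lambda>i x. x) \<in> iso (direct_limit I leq (\<lambda>i. obj (F i) S) (\<lambda>i j x. x)) (obj M S)"
    using assms(2) unfolding direct_limit_of_FP_submodules_def by blast
  then have sub: "\<forall>i\<in>I. rsubmodule U R (F i) M" by blast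
  have "product_injective M J S P p" if J: "J \<in> U" and P: "is_product U R J S P p" for J S P p
    unfolding product_injective_def
  proof (intro ballI impI)
    fix x assume x: "x \<in> carrier (obj M P)" and one: "\<forall>j\<in>J. arr M P (S j) (p j) x = \<one>\<^bsub>obj M (S j)\<^esub>"
    have mods: "P \<in> Mods U R" "\<And>j. j \<in> J \<Longrightarrow> S j \<in> Mods U R" "\<And>j. j \<in> J \<Longrightarrow> p j \<in> lin R P (S j)"
      using P by (auto simp: is_product_def)
    obtain i where i: "i \<in> I" "x \<in> carrier (obj (F i) P)"
      using iso mods(1) submodule_system_iso_iff[OF dir sub incl mods(1)] x by blast
    interpret F: additive_functor U R "F i"
      using sub i(1) by (intro additive_functor.intro module_universe_axioms additive_functor_axioms.intro)
        (simp add: rsubmodule_def)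
    have one_eq: "\<one>\<^bsub>obj (F i) T\<^esub> = \<one>\<^bsub>obj M T\<^esub>" if T: "T \<in> Mods U R" for T
    proof (rule hom_one[OF _ F.obj_group[OF T] obj_group[OF T]])
      show "(\<lambda>x. x) \<in> hom (obj (F i) T) (obj M T)"
        using sub i(1) T unfolding rsubmodule_def rmorphism_def by blast
    qed
    have "arr (F i) P (S j) (p j) x = \<one>\<^bsub>obj (F i) (S j)\<^esub>" if j: "j \<in> J" for j
    proof -
      have "arr (F i) P (S j) (p j) x = arr M P (S j) (p j) x"
        using sub i mods(1) mods(2,3)[OF j] unfolding rsubmodule_def rmorphism_def by blast
      then show ?thesis using one j one_eq[OF mods(2)[OF j]] by simp
    qed
    moreover have "product_injective (F i) J S P p"
    proof -
      have "FP_module U R (F i)" using sub_FP i(1) by blast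
      then show ?thesis using J P unfolding F.FP_iff F.Mittag_Leffler_iff by blast
    qed
    ultimately show "x = \<one>\<^bsub>obj M P\<^esub>"
      using i(2) one_eq[OF mods(1)] unfolding product_injective_def by simp
  qed
  then show ?thesis using limits by (simp add: Mittag_Leffler_iff)
qed

text \<open>For direct limits, a preimage of \<open>y \<in> K L\<close> in some \<open>F (S i)\<close> is carried by \<open>\<alpha>\<close> to an element that dies in \<open>M L\<close>,
hence at a later stage, where the preimage enters the kernel. For products, a preimage of a family in the
kernels is carried by \<open>\<alpha>\<close> to an element of \<open>M P\<close> with trivial components, so it is in the kernel.\<close>

lemma Mittag_Leffler_imp_kernel_FP:
  assumes mittag: "Mittag_Leffler_module U R M" and FP: "FP_module U R F" and \<alpha>: "rmorphism U R F M \<alpha>"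
  shows "FP_module U R (rkernel F M \<alpha>)"
proof -
  interpret F: additive_functor U R F
    using FP by (intro additive_functor.intro module_universe_axioms additive_functor_axioms.intro)
      (simp add: FP_module_def)
  define K where "K S = kernel (obj F S) (obj M S) (\<alpha> S)" for S
  have mem_K: "x \<in> K S \<longleftrightarrow> x \<in> carrier (obj F S) \<and> \<alpha> S x = \<one>\<^bsub>obj M S\<^esub>" for x S
    by (simp add: K_def kernel_def)
  have \<alpha>_hom: "\<alpha> S \<in> hom (obj F S) (obj M S)" if "S \<in> Mods U R" for S
    using \<alpha> that by (simp add: rmorphism_def)
  have nat: "\<alpha> T (arr F S T f x) = arr M S T f (\<alpha> S x)"
    if "S \<in> Mods U R" "T \<in> Mods U R" "f \<in> lin R S T" "x \<in> carrier (obj F S)" for S T f x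
    using \<alpha> that by (simp add: rmorphism_def)
  interpret K: functor_with_subfunctor U R F K
  proof (intro functor_with_subfunctor.intro functor_with_subfunctor_axioms.intro F.additive_functor_axioms)
    show "subgroup (K S) (obj F S)" if "S \<in> Mods U R" for S
      using group_hom.subgroup_kernel[of "obj F S" "obj M S" "\<alpha> S"] that F.obj_group obj_group \<alpha>_hom
      by (simp add: K_def group_hom_def group_hom_axioms_def)
    show "arr F S T f x \<in> K T" if "S \<in> Mods U R" "T \<in> Mods U R" "f \<in> lin R S T" "x \<in> K S" for S T f x
      using that by (simp add: mem_K F.arr_closed nat arr_one)
  qed
  have "FP_module U R (subfunctor F K)"
  proof (rule K.subfunctor_FP)
    show "Mittag_Leffler_module U R F" using FP by (simp add: F.FP_iff)
    fix I and leq :: "'u \<Rightarrow> 'u \<Rightarrow> bool" and S s L f y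
    assume I: "I \<in> U" and lim: "module_limit U R I leq S s L f" and y: "y \<in> K L"
    interpret lim: module_limit U R I leq S s L f by (rule lim)
    have "limit_surjective F I S L f" "limit_injective M I leq S s L f"
      using FP mittag I lim
      by (auto simp: F.FP_iff F.Mittag_Leffler_iff Mittag_Leffler_iff F.preserves_direct_limits_iff
          preserves_direct_limits_iff)
    note surj = this(1)[unfolded limit_surjective_def] and inj = this(2)[unfolded limit_injective_def]
    obtain i x where i: "i \<in> I" and x: "x \<in> carrier (obj F (S i))" "arr F (S i) L (f i) x = y"
      using surj y mem_K by blast
    have "arr M (S i) L (f i) (\<alpha> (S i) x) = \<one>\<^bsub>obj M L\<^esub>"
      using nat[OF lim.source[OF i] lim.target lim.leg[OF i] x(1)] x(2) y mem_K by simp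
    moreover have "\<alpha> (S i) x \<in> carrier (obj M (S i))"
      using \<alpha>_hom[OF lim.source[OF i]] x(1) by (rule hom_in_carrier)
    ultimately obtain j where j: "j \<in> I" "leq i j" "arr M (S i) (S j) (s i j) (\<alpha> (S i) x) = \<one>\<^bsub>obj M (S j)\<^esub>"
      using inj i by blast
    note lin = lim.source[OF i] lim.source[OF j(1)] lim.transition[OF i j(1,2)]
    have "arr F (S i) (S j) (s i j) x \<in> K (S j)"
      using nat[OF lin x(1)] j(3) F.arr_closed[OF lin x(1)] by (simp add: mem_K)
    moreover have "arr F (S j) L (f j) (arr F (S i) (S j) (s i j) x) = y"
      using group_cocone.leg_transition[OF F.functor_cocone[OF lim] i j(1,2) x(1)] x(2) by simp
    ultimately show "\<exists>i\<in>I. \<exists>x\<in>K (S i). arr F (S i) L (f i) x = y" using j(1) by blast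
  next
    fix I :: "'u set" and S P p y
    assume I: "I \<in> U" and P: "is_product U R I S P p" and y: "\<And>i. i \<in> I \<Longrightarrow> y i \<in> K (S i)"
    have mods: "P \<in> Mods U R" "\<And>i. i \<in> I \<Longrightarrow> S i \<in> Mods U R" "\<And>i. i \<in> I \<Longrightarrow> p i \<in> lin R P (S i)"
      using P by (auto simp: is_product_def)
    have "product_surjective F I S P p" "product_injective M I S P p"
      using FP mittag I P by (auto simp: F.FP_iff Mittag_Leffler_iff)
    note surj = this(1)[unfolded product_surjective_def] and inj = this(2)[unfolded product_injective_def]
    obtain x where x: "x \<in> carrier (obj F P)" "\<forall>i\<in>I. arr F P (S i) (p i) x = y i"
      using surj y mem_K by blast
    have "arr M P (S i) (p i) (\<alpha> P x) = \<one>\<^bsub>obj M (S i)\<^esub>" if i: "i \<in> I" for i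
      using nat[OF mods(1) mods(2,3)[OF i] x(1)] x(2) i y[OF i] by (simp add: mem_K)
    then have "\<alpha> P x = \<one>\<^bsub>obj M P\<^esub>"
      using inj hom_in_carrier[OF \<alpha>_hom[OF mods(1)] x(1)] by blast
    then show "\<exists>x\<in>K P. \<forall>i\<in>I. arr F P (S i) (p i) x = y i" using x mem_K by blast
  qed
  then show ?thesis by (simp add: subfunctor_def rkernel_def K_def)
qed

text \<open>Write \<open>x = M g a\<close> with \<open>g : A \<rightarrow> P\<close>. The kernel of \<open>Hom(A, -) \<rightarrow> M\<close> contains the components of \<open>g\<close>, hence,
as it preserves products, an element \<open>h\<close> with these components. Then \<open>h = g\<close>, so \<open>M g a\<close> is trivial.\<close>

lemma kernel_FP_imp_Mittag_Leffler:
  assumes limits: "preserves_direct_limits U R M"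
    and kernels: "\<And>F \<alpha>. FP_module U R F \<Longrightarrow> rmorphism U R F M \<alpha> \<Longrightarrow> FP_module U R (rkernel F M \<alpha>)"
  shows "Mittag_Leffler_module U R M"
proof -
  have "product_injective M I S P p" if I: "I \<in> U" and P: "is_product U R I S P p" for I S P p
    unfolding product_injective_def
  proof (intro ballI impI)
    fix x assume x: "x \<in> carrier (obj M P)" and one: "\<forall>i\<in>I. arr M P (S i) (p i) x = \<one>\<^bsub>obj M (S i)\<^esub>"
    have mods: "P \<in> Mods U R" "\<And>i. i \<in> I \<Longrightarrow> S i \<in> Mods U R" "\<And>i. i \<in> I \<Longrightarrow> p i \<in> lin R P (S i)"
      using P by (auto simp: is_product_def)
    obtain A a g where A: "A \<in> presented_modules" and a: "a \<in> carrier (obj M A)"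
      and g: "g \<in> lin R A P" "arr M A P g a = x"
      using element_from_presented[OF limits mods(1) x] by blast
    interpret A: presented_module U R A
      using presented_modules_finitely_presented[OF A]
      by (intro presented_module.intro module_universe_axioms presented_module_axioms.intro)
    let ?H = A.hom_functor and ?\<alpha> = "A.yoneda M a"
    note mor = A.yoneda_rmorphism[OF additive_functor_axioms a]
      and yoneda = A.yoneda_enc[OF additive_functor_axioms a]
    let ?K = "rkernel ?H M ?\<alpha>"
    have FP: "FP_module U R ?K" using A.hom_functor_FP mor by (rule kernels)
    then interpret K: additive_functor U R ?K
      by (intro additive_functor.intro module_universe_axioms additive_functor_axioms.intro)
        (simp add: FP_module_def)
    have mem_K: "c \<in> carrier (obj ?K T) \<longleftrightarrow> c \<in> carrier (obj ?H T) \<and> ?\<alpha> T c = \<one>\<^bsub>obj M T\<^esub>" for c T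
      by (simp add: rkernel_def kernel_def)
    have arr_K: "arr ?K = arr ?H" by (simp add: rkernel_def)
    \<comment> \<open>\<open>M (p i \<circ> g) a\<close> is the component \<open>i\<close> of \<open>x\<close>, which is trivial.\<close>
    have mem: "A.enc (S i) (p i \<circ> g) \<in> carrier (obj ?K (S i))" if i: "i \<in> I" for i
    proof -
      note pg = lin_comp[OF g(1) mods(3)[OF i]]
      have "arr M A (S i) (p i \<circ> g) a = \<one>\<^bsub>obj M (S i)\<^esub>"
        using arr_comp[OF A.presented(1) mods(1) mods(2)[OF i] g(1) mods(3)[OF i] a] g(2) one i by simp
      then show ?thesis
        unfolding mem_K yoneda[OF mods(2)[OF i] pg] A.hom_functor_carrier using pg by blast
    qed
    have surj: "product_surjective ?K I S P p" using FP I P by (simp add: K.FP_iff)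
    obtain c where c: "c \<in> carrier (obj ?K P)"
      "\<forall>i\<in>I. arr ?H P (S i) (p i) c = A.enc (S i) (p i \<circ> g)"
      using surj[unfolded product_surjective_def arr_K, rule_format, of "\<lambda>i. A.enc (S i) (p i \<circ> g)"] mem
      by blast
    then obtain h where h: "h \<in> lin R A P" "c = A.enc P h"
      unfolding mem_K A.hom_functor_carrier by blast
    have "p i (h z) = p i (g z)" if i: "i \<in> I" and z: "z \<in> carrier A" for i z
    proof -
      have "A.enc (S i) (p i \<circ> h) = A.enc (S i) (p i \<circ> g)"
        using c(2) i A.hom_functor_arr[OF mods(1) h(1)] h(2) by simp
      then have "(p i \<circ> h) z = (p i \<circ> g) z"
        using z by (rule A.enc_eqD[OF mods(2)[OF i] lin_comp[OF h(1) mods(3)[OF i]] lin_comp[OF g(1) mods(3)[OF i]]])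
      then show ?thesis by simp
    qed
    then have "h z = g z" if "z \<in> carrier A" for z
      using that by (intro product_separates[OF P lin_closed[OF h(1)] lin_closed[OF g(1)]])
    then have "arr M A P h a = x"
      unfolding g(2)[symmetric] by (intro arr_cong[OF A.presented(1) mods(1) h(1) g(1) _ a])
    then show "x = \<one>\<^bsub>obj M P\<^esub>"
      using c(1) yoneda[OF mods(1) h(1)] unfolding mem_K h(2) by simp
  qed
  then show ?thesis using limits by (simp add: Mittag_Leffler_iff)
qed

end

theorem theorem1p4:
  fixes U :: "'u set set" and R :: "'u ring" and M :: "('u, 'u) rfunctor"
  assumes "small_universe U"
    and "ring R" and "carrier R \<in> U"
    and "rmodule U R M" and "preserves_direct_limits U R M"
  shows "(Mittag_Leffler_module U R M \<longleftrightarrow> direct_limit_of_FP_submodules U R M) \<and>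
    (Mittag_Leffler_module U R M \<longleftrightarrow>
      (\<forall>F \<alpha>. FP_module U R F \<and> rmorphism U R F M \<alpha> \<longrightarrow> FP_module U R (rkernel F M \<alpha>)))"
proof -
  interpret additive_functor U R M
    using assms(1-4)
    by (intro additive_functor.intro module_universe.intro small_sets.intro
        module_universe_axioms.intro additive_functor_axioms.intro)
  show ?thesis
    using Mittag_Leffler_imp_limit_of_FP limit_of_FP_imp_Mittag_Leffler[OF assms(5)]
      Mittag_Leffler_imp_kernel_FP kernel_FP_imp_Mittag_Leffler[OF assms(5)] by blast
qed

end
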